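(* Let $d,N,k\geq 1$ be integers and let $P$ be a germ of a $\mathbb{C}$-valued holomorphic function at $0\in\mathbb{C}^d$, with $P(0)=0$. For $j=1,\dots,k$ let $$L_j=\sum_{|\alpha|=j} a_\alpha^{(j)}(x)\,\partial_\alpha$$ be a differential operator with coefficients $a_\alpha^{(j)}$ holomorphic near $0\in\mathbb{C}^d$, and set $$L_j^\star(P)=\sum_{|\alpha|=j} a_\alpha^{(j)}(x)\,(\partial_{x_1}P)^{\alpha_1}\cdots(\partial_{x_d}P)^{\alpha_d}.$$ Let $F$ be a $\mathbb{C}^N$-valued holomorphic map defined near $(0,0)\in\mathbb{C}^d\times\mathbb{C}^N$, and consider the system of partial differential equations $$P(x)^kL_k(y)(x)+\cdots+P(x)L_1(y)(x)=F(x,y),\qquad x\in(\mathbb{C}^d,0),\quad y=(y_1,\dots,y_N).$$ Suppose that $F(0,0)=0$ and that the matrix $D_yF(0,0)$ is invertible. If $L_k^\star(P)(0)\neq 0$ and $$\left[\sum_{j=1}^k\frac{n!}{(n-j)!}L_j^\star(P)(0)\right]I_N-D_yF(0,0)\in\mathrm{GL}_N(\mathbb{C})\quad\text{for all integers } n\geq 0,$$ then the system has a unique analytic solution $\widehat{y}\in\mathbb{C}\{x\}^N$ with $\widehat{y}(0)=0$.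
   Context: Notation: $x=(x_1,\dots,x_d)$; for $\alpha\in\mathbb{N}^d$ (with $0\in\mathbb{N}$), $|\alpha|=\alpha_1+\cdots+\alpha_d$ and $\partial_\alpha=\partial^{|\alpha|}/\partial x_1^{\alpha_1}\cdots\partial x_d^{\alpha_d}$. The operators $L_j$ act on vectors componentwise. $\mathbb{C}\{x\}$ denotes convergent power series in $x$, $I_N$ is the $N\times N$ identity matrix, and $D_yF(0,0)\in\mathbb{C}^{N\times N}$ is the Jacobian matrix of $F$ with respect to $y$ at the origin. The quotient $\frac{n!}{(n-j)!}$ means $n(n-1)\cdots(n-j+1)$; in particular it is $0$ when $n<j$. *)

theory Defs
  imports "HOL-Analysis.Analysis"
begin

text \<open>
  \<open>\<complex>\<^sup>d\<close> is \<open>complex^'d\<close> with \<open>'d :: {finite, linorder}\<close> and multi-indices are vectors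
  \<open>nat^'d\<close>.  The linear order names the coordinates \<open>x_1, ..., x_d\<close>; it is only used to fix the
  order in which iterated partial derivatives are taken.
\<close>

text \<open>
  Holomorphy in several variables: Frechet differentiability with a complex-linear differential.
  The parameters \<open>s\<close> and \<open>t\<close> are the complex scalar multiplications of domain and codomain
  (additivity and continuity of \<open>D\<close> are part of \<open>has_derivative\<close>).
\<close>

definition holomorphic_germ ::
    "(complex \<Rightarrow> 'a \<Rightarrow> 'a) \<Rightarrow> (complex \<Rightarrow> 'b \<Rightarrow> 'b) \<Rightarrow>
     ('a::real_normed_vector \<Rightarrow> 'b::real_normed_vector) \<Rightarrow> 'a \<Rightarrow> bool" where
  "holomorphic_germ s t f p \<longleftrightarrow>
     (\<exists>U. open U \<and> p \<in> U \<and>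
        (\<forall>z\<in>U. \<exists>D. (f has_derivative D) (at z) \<and> (\<forall>c v. D (s c v) = t c (D v))))"

definition scale_pair :: "complex \<Rightarrow> (complex^'d) \<times> (complex^'m) \<Rightarrow> (complex^'d) \<times> (complex^'m)" where
  "scale_pair c v = (c *s fst v, c *s snd v)"

definition mdeg :: "nat^'d::finite \<Rightarrow> nat" where
  "mdeg \<alpha> = (\<Sum>i\<in>UNIV. \<alpha> $ i)"

definition monom_at :: "complex^'d \<Rightarrow> nat^'d::finite \<Rightarrow> complex" where
  "monom_at x \<alpha> = (\<Prod>i\<in>UNIV. (x $ i) ^ (\<alpha> $ i))"

definition partial_deriv :: "'d \<Rightarrow> (complex^'d::finite \<Rightarrow> complex) \<Rightarrow> complex^'d \<Rightarrow> complex" where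
  "partial_deriv i f x = deriv (\<lambda>t. f (x + axis i t)) 0"

definition partial_derivs ::
    "nat^'d::{finite,linorder} \<Rightarrow> (complex^'d::{finite,linorder} \<Rightarrow> complex) \<Rightarrow> complex^'d::{finite,linorder} \<Rightarrow> complex" where
  "partial_derivs \<alpha> f =
     foldr (\<lambda>i. partial_deriv i ^^ (\<alpha> $ i)) (sorted_list_of_set UNIV) f"

definition diff_op ::
    "nat \<Rightarrow> (nat^'d::{finite,linorder} \<Rightarrow> complex^'d::{finite,linorder} \<Rightarrow> complex) \<Rightarrow>
     (complex^'d::{finite,linorder} \<Rightarrow> complex^'m) \<Rightarrow> complex^'d::{finite,linorder} \<Rightarrow> complex^'m" where
  "diff_op j a y x =
     (\<Sum>\<alpha> | mdeg \<alpha> = j. a \<alpha> x *s (\<chi> l. partial_derivs \<alpha> (\<lambda>u. y u $ l) x))"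

definition diff_op_star ::
    "nat \<Rightarrow> (nat^'d \<Rightarrow> complex^'d \<Rightarrow> complex) \<Rightarrow>
     (complex^'d::finite \<Rightarrow> complex) \<Rightarrow> complex^'d \<Rightarrow> complex" where
  "diff_op_star j a P x =
     (\<Sum>\<alpha> | mdeg \<alpha> = j. a \<alpha> x * monom_at (\<chi> i. partial_deriv i P x) \<alpha>)"

text \<open>The sums above range over finite sets, so they are genuine sums.\<close>

lemma finite_mdeg: "finite {\<alpha> :: nat^'d::finite. mdeg \<alpha> = j}"
proof -
  have "{\<alpha> :: nat^'d. mdeg \<alpha> = j} \<subseteq> vec_lambda ` (UNIV \<rightarrow>\<^sub>E {..j})"
  proof
    fix \<alpha> :: "nat^'d" assume "\<alpha> \<in> {\<alpha>. mdeg \<alpha> = j}"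
    hence j: "(\<Sum>i\<in>UNIV. \<alpha> $ i) = j" by (simp add: mdeg_def)
    have "\<alpha> $ i \<le> j" for i
      using member_le_sum[of i UNIV "\<lambda>i. \<alpha> $ i"] j by simp
    hence "vec_nth \<alpha> \<in> UNIV \<rightarrow>\<^sub>E {..j}" by auto
    moreover have "\<alpha> = vec_lambda (vec_nth \<alpha>)" by simp
    ultimately show "\<alpha> \<in> vec_lambda ` (UNIV \<rightarrow>\<^sub>E {..j})" by blast
  qed
  moreover have "finite ((UNIV :: 'd set) \<rightarrow>\<^sub>E {..j})" by (intro finite_PiE) auto
  ultimately show ?thesis using finite_subset by blast
qed

definition jacobian_snd ::
    "((complex^'d) \<times> (complex^'m) \<Rightarrow> complex^'m) \<Rightarrow>
     complex^'d \<Rightarrow> complex^'m \<Rightarrow> complex^'m^'m::finite" where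
  "jacobian_snd F x y = (\<chi> i l. partial_deriv l (\<lambda>v. F (x, v) $ i) y)"

text \<open>
  An element of \<open>\<complex>{x}\<^sup>N\<close> is its family of coefficients, subject to convergence near the origin.
  In finite dimension \<open>summable_on\<close> means absolute convergence.
\<close>

definition ps_convergent :: "(nat^'d::finite \<Rightarrow> complex^'m::finite) \<Rightarrow> bool" where
  "ps_convergent c \<longleftrightarrow>
     (\<exists>r>0. \<forall>x\<in>ball 0 r. (\<lambda>\<alpha>. monom_at x \<alpha> *s c \<alpha>) summable_on UNIV)"

definition ps_sum :: "(nat^'d::finite \<Rightarrow> complex^'m::finite) \<Rightarrow> complex^'d \<Rightarrow> complex^'m" where
  "ps_sum c x = (\<Sum>\<^sub>\<infinity>\<alpha>. monom_at x \<alpha> *s c \<alpha>)"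

definition solves_system ::
    "nat \<Rightarrow> (complex^'d::{finite,linorder} \<Rightarrow> complex) \<Rightarrow> (nat \<Rightarrow> nat^'d::{finite,linorder} \<Rightarrow> complex^'d::{finite,linorder} \<Rightarrow> complex) \<Rightarrow>
     ((complex^'d::{finite,linorder}) \<times> (complex^'m) \<Rightarrow> complex^'m) \<Rightarrow>
     (complex^'d::{finite,linorder} \<Rightarrow> complex^'m::finite) \<Rightarrow> bool" where
  "solves_system k P a F y \<longleftrightarrow>
     (\<forall>\<^sub>F x in nhds 0. (\<Sum>j=1..k. P x ^ j *s diff_op j (a j) y x) = F (x, y x))"

end

theory Submission
  imports Defs "HOL-Complex_Analysis.Cauchy_Integral_Formula"
begin

text \<open>
  Since \<open>L\<^sub>k\<^sup>\<star>(P)(0) \<noteq> 0\<close>, some \<open>\<partial>\<^sub>p P(0)\<close> does not vanish, so \<open>P\<close> can replace the coordinate \<open>x\<^sub>p\<close>.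
  In the new coordinates \<open>P = t\<close> and \<open>\<partial>\<^sub>i\<close> becomes \<open>D\<^sub>i = \<pi>\<^sub>i \<partial>\<^sub>t + [i \<noteq> p] \<partial>\<^sub>i\<close>.  Writing
  \<open>t\<^sup>j D\<^sub>\<alpha>\<close> as a product of \<open>j\<close> factors \<open>t D\<^sub>i - l \<pi>\<^sub>i\<close>, each of them is \<open>\<pi>\<^sub>i(0) (t \<partial>\<^sub>t - l)\<close> plus an
  operator that becomes small, relative to \<open>1 + t \<partial>\<^sub>t\<close>, for a suitable weighted \<open>\<ell>\<^sup>1\<close> norm on
  coefficients as its radius \<open>\<rho>\<close> tends to 0.  Hence the system reads
  \<open>(q(t \<partial>\<^sub>t) - D\<^sub>y F(0,0)) y = (small operator) y + (higher order terms)\<close>, where \<open>q\<close> has degree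
  exactly \<open>k\<close>.  By the nonresonance condition the left-hand side is invertible with a gain of
  \<open>k\<close> powers of \<open>1 + t \<partial>\<^sub>t\<close>, and the contraction principle applies; uniqueness among all
  convergent series follows because any two of them lie in the ball of contraction for small \<open>\<rho>\<close>.
\<close>

subsection \<open>Multi-indices\<close>

text \<open>The resolvent sees only the exponent n of t: inverting q(n) - \<open>J\<close> gains (1
  + n)^k, which pays for k operators of order one in t but says nothing about the exponents of the
  other variables. The dangerous term is t \<partial>_i with i \<noteq> p. It preserves the total
  degree and sends x_i^m to m t x_i^(m-1), whereas t \<partial>_t kills x_i^m; in the plain weight
  \<rho>^|\<alpha>| it is neither small nor even bounded relative to 1 + t \<partial>_t. The weight
  \<open>wt\<close> repairs both defects: the binomial denominator makes t x_i^(m-1) cheaper than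
  x_i^m by the missing factor m, and counting the exponent of t twice in the power of \<rho>
  supplies the smallness. Two small parameters have separate duties. The radius R of the ball tames
  the terms of degree at least two of F; \<rho> tames the variable coefficients, the tangential
  derivatives and the inhomogeneity F(x, 0). Since R is fixed before \<rho>, the latter can still be
  decreased when two given solutions are compared.\<close>

lemma mdeg_0 [simp]: "mdeg 0 = 0"
  by (simp add: mdeg_def)

lemma mdeg_add [simp]: "mdeg (\<alpha> + \<beta>) = mdeg \<alpha> + mdeg \<beta>"
  by (simp add: mdeg_def sum.distrib)

lemma mdeg_axis [simp]: "mdeg (axis i n) = n"
  by (simp add: mdeg_def axis_def)

lemma mdeg_eq_0_iff [simp]: "mdeg \<alpha> = 0 \<longleftrightarrow> \<alpha> = 0"
  by (auto simp: mdeg_def vec_eq_iff)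

lemma component_le_mdeg: "\<alpha> $ i \<le> mdeg \<alpha>"
  unfolding mdeg_def by (rule member_le_sum) auto

lemma two_components_le_mdeg: "i \<noteq> j \<Longrightarrow> \<alpha> $ i + \<alpha> $ j \<le> mdeg (\<alpha> :: nat^'d::finite)"
proof -
  assume "i \<noteq> j"
  then have "\<alpha> $ i + \<alpha> $ j = (\<Sum>l\<in>{i,j}. \<alpha> $ l)" by simp
  also have "\<dots> \<le> mdeg \<alpha>" unfolding mdeg_def by (rule sum_mono2) auto
  finally show ?thesis .
qed

lemma finite_mdeg_le: "finite {\<alpha> :: nat^'d::finite. mdeg \<alpha> \<le> n}"
proof -
  have "{\<alpha> :: nat^'d. mdeg \<alpha> \<le> n} = (\<Union>j\<le>n. {\<alpha>. mdeg \<alpha> = j})" by auto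
  then show ?thesis by (simp add: finite_mdeg)
qed

lemma mdeg_eq_1E:
  assumes "mdeg (\<alpha> :: nat^'d::finite) = 1"
  obtains i where "\<alpha> = axis i 1"
proof -
  have "\<exists>i. \<alpha> $ i \<noteq> 0"
    using assms by (metis mdeg_eq_0_iff vec_eq_iff zero_index zero_neq_one)
  then obtain i where i: "\<alpha> $ i \<ge> 1" by (auto simp: Suc_le_eq)
  have "\<alpha> $ j = 0" if "j \<noteq> i" for j
    using two_components_le_mdeg[OF that, of \<alpha>] i assms by simp
  moreover have "\<alpha> $ i = 1" using component_le_mdeg[of \<alpha> i] i assms by simp
  ultimately have "\<alpha> = axis i 1" by (auto simp: vec_eq_iff axis_def)
  then show ?thesis by (rule that)
qed

lemma axis_add_diff: "\<alpha> $ i \<ge> 1 \<Longrightarrow> axis i 1 + (\<alpha> - axis i 1) = (\<alpha> :: nat^'d::finite)"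
  by (auto simp: vec_eq_iff axis_def)

lemma finite_convolution: "finite {p :: (nat^'d::finite) \<times> (nat^'d). fst p + snd p = \<alpha>}"
proof (rule finite_subset)
  show "{p :: (nat^'d) \<times> (nat^'d). fst p + snd p = \<alpha>}
      \<subseteq> {\<beta>. mdeg \<beta> \<le> mdeg \<alpha>} \<times> {\<beta>. mdeg \<beta> \<le> mdeg \<alpha>}" by auto
qed (simp add: finite_mdeg_le)

lemma monom_at_0 [simp]: "monom_at x 0 = 1"
  by (simp add: monom_at_def)

lemma monom_at_add: "monom_at x (\<alpha> + \<beta>) = monom_at x \<alpha> * monom_at x \<beta>"
  by (simp add: monom_at_def power_add prod.distrib)

lemma monom_at_axis [simp]: "monom_at x (axis i 1) = x $ i"
proof -
  have "monom_at x (axis i 1) = (\<Prod>j\<in>UNIV. if j = i then x $ j else 1)"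
    unfolding monom_at_def by (rule prod.cong) (auto simp: axis_def)
  then show ?thesis by simp
qed

lemma norm_monom_at_le:
  assumes "\<And>i. norm (x $ i) \<le> r"
  shows "norm (monom_at x \<alpha>) \<le> r ^ mdeg \<alpha>"
proof -
  have "norm (monom_at x \<alpha>) \<le> (\<Prod>i\<in>UNIV. r ^ (\<alpha> $ i))"
    unfolding monom_at_def prod_norm[symmetric]
    by (auto intro!: prod_mono simp: norm_power power_mono assms)
  then show ?thesis by (simp add: mdeg_def power_sum)
qed

lemma monom_at_zero: "monom_at 0 \<alpha> = (if \<alpha> = 0 then 1 else 0)"
proof (cases "\<alpha> = 0")
  case False
  then obtain i where "\<alpha> $ i \<noteq> 0" by (metis vec_eq_iff zero_index)
  then have "(\<Prod>i\<in>UNIV. (0::complex) ^ (\<alpha> $ i)) = 0" by (intro prod_zero) auto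
  then show ?thesis using False by (simp add: monom_at_def)
qed simp

text \<open>Enclosing \<open>S\<close> in a cube of exponents turns the sum into a product of
  CARD('d) geometric sums. The bound does not depend on \<open>S\<close>, as the partial-sum norms
  below require.\<close>

lemma sum_power_mdeg_le:
  fixes S :: "(nat^'d::finite) set" and q :: real
  assumes S: "finite S" and q: "0 \<le> q" "q < 1"
  shows "(\<Sum>\<alpha>\<in>S. q ^ mdeg \<alpha>) \<le> (1 / (1 - q)) ^ CARD('d)"
proof -
  define n where "n = Max (insert 0 (mdeg ` S))"
  have n: "mdeg \<alpha> \<le> n" if "\<alpha> \<in> S" for \<alpha>
    using S that by (auto simp: n_def intro!: Max_ge)
  have bij: "bij_betw vec_nth {\<alpha>::nat^'d. \<forall>i. \<alpha> $ i \<le> n} (UNIV \<rightarrow>\<^sub>E {..n})"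
    by (rule bij_betwI[where g = vec_lambda]) auto
  have fin: "finite {\<alpha>::nat^'d. \<forall>i. \<alpha> $ i \<le> n}"
    using bij_betw_finite[OF bij] by (simp add: finite_PiE)
  have "S \<subseteq> {\<alpha>::nat^'d. \<forall>i. \<alpha> $ i \<le> n}"
    using n component_le_mdeg le_trans by blast
  then have "(\<Sum>\<alpha>\<in>S. q ^ mdeg \<alpha>) \<le> (\<Sum>\<alpha> | \<forall>i. \<alpha> $ i \<le> n. q ^ mdeg (\<alpha>::nat^'d))"
    using fin q by (intro sum_mono2) auto
  also have "\<dots> = (\<Sum>f\<in>UNIV \<rightarrow>\<^sub>E {..n}. \<Prod>i::'d\<in>UNIV. q ^ f i)"
    using bij by (subst sum.reindex_bij_betw[OF bij, symmetric]) (simp add: mdeg_def power_sum)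
  also have "\<dots> = (\<Prod>i::'d\<in>UNIV. \<Sum>j\<le>n. q ^ j)"
    by (rule prod_sum_PiE[symmetric]) auto
  also have "\<dots> \<le> (\<Prod>i::'d\<in>UNIV. 1 / (1 - q))"
  proof (rule prod_mono, safe)
    have "(\<Sum>j\<le>n. q ^ j) = (1 - q ^ Suc n) / (1 - q)"
      using q sum_gp0[of q n] by simp
    also have "\<dots> \<le> 1 / (1 - q)" using q by (intro divide_right_mono) auto
    finally show "(\<Sum>j\<le>n. q ^ j) \<le> 1 / (1 - q)" .
  qed (use q in \<open>auto intro!: sum_nonneg\<close>)
  finally show ?thesis by simp
qed


subsection \<open>Weighted norms of formal power series\<close>

text \<open>
  \<open>wbound W c B\<close> says that the weighted \<open>\<ell>\<^sup>1\<close> norm of \<open>c\<close> is at most \<open>B\<close>; bounding the finite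
  partial sums avoids all summability side conditions.
\<close>

definition wbound :: "('a \<Rightarrow> real) \<Rightarrow> ('a \<Rightarrow> complex) \<Rightarrow> real \<Rightarrow> bool" where
  "wbound W c B \<longleftrightarrow> (\<forall>S. finite S \<longrightarrow> (\<Sum>\<alpha>\<in>S. norm (c \<alpha>) * W \<alpha>) \<le> B)"

lemma wboundI: "(\<And>S. finite S \<Longrightarrow> (\<Sum>\<alpha>\<in>S. norm (c \<alpha>) * W \<alpha>) \<le> B) \<Longrightarrow> wbound W c B"
  by (simp add: wbound_def)

lemma wboundD: "wbound W c B \<Longrightarrow> finite S \<Longrightarrow> (\<Sum>\<alpha>\<in>S. norm (c \<alpha>) * W \<alpha>) \<le> B"
  by (simp add: wbound_def)

lemma wbound_nonneg: "wbound W c B \<Longrightarrow> 0 \<le> B"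
  using wboundD[of W c B "{}"] by simp

lemma wbound_mono: "wbound W c B \<Longrightarrow> B \<le> B' \<Longrightarrow> wbound W c B'"
  unfolding wbound_def by (meson order_trans)

lemma wbound_point: "wbound W c B \<Longrightarrow> norm (c \<alpha>) * W \<alpha> \<le> B"
  using wboundD[of W c B "{\<alpha>}"] by simp

lemma wbound_cong: "(\<And>\<alpha>. c \<alpha> = d \<alpha>) \<Longrightarrow> wbound W c B \<Longrightarrow> wbound W d B"
  by (simp add: wbound_def)

lemma wbound_0: "0 \<le> B \<Longrightarrow> wbound W (\<lambda>\<alpha>. 0) B"
  by (simp add: wbound_def)

text \<open>Covers every operator that acts exponent by exponent. Two different weights are allowed
  in order to record the exchange of powers of \<open>1 + \<alpha> $ p\<close>: \<open>theta\<close>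
  and \<open>ff\<close> lose them, the resolvent gains them.\<close>

lemma wbound_diag:
  assumes "wbound V c B" and e: "\<And>\<alpha>. norm (e \<alpha>) * W \<alpha> \<le> C * V \<alpha>" and "0 \<le> C"
  shows "wbound W (\<lambda>\<alpha>. e \<alpha> * c \<alpha>) (C * B)"
proof (rule wboundI)
  fix S :: "'a set" assume S: "finite S"
  have "(\<Sum>\<alpha>\<in>S. norm (e \<alpha> * c \<alpha>) * W \<alpha>) \<le> (\<Sum>\<alpha>\<in>S. C * (norm (c \<alpha>) * V \<alpha>))"
  proof (rule sum_mono)
    fix \<alpha>
    show "norm (e \<alpha> * c \<alpha>) * W \<alpha> \<le> C * (norm (c \<alpha>) * V \<alpha>)"
      using mult_left_mono[OF e norm_ge_zero[of "c \<alpha>"]] by (simp add: norm_mult mult_ac)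
  qed
  also have "\<dots> \<le> C * B"
    unfolding sum_distrib_left[symmetric] using wboundD[OF assms(1) S] \<open>0 \<le> C\<close>
    by (rule mult_left_mono)
  finally show "(\<Sum>\<alpha>\<in>S. norm (e \<alpha> * c \<alpha>) * W \<alpha>) \<le> C * B" .
qed

lemma wbound_scale: "wbound W c B \<Longrightarrow> wbound W (\<lambda>\<alpha>. k * c \<alpha>) (norm k * B)"
  by (rule wbound_diag) auto

lemma wbound_weight_mono:
  assumes "wbound V c B" "\<And>\<alpha>. W \<alpha> \<le> V \<alpha>"
  shows "wbound W c B"
  using wbound_diag[OF assms(1), of "\<lambda>_. 1" W 1] assms(2) by simp

lemma wbound_add:
  assumes "wbound W c B" "wbound W d B'" and W: "\<And>\<alpha>. 0 \<le> W \<alpha>"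
  shows "wbound W (\<lambda>\<alpha>. c \<alpha> + d \<alpha>) (B + B')"
proof (rule wboundI)
  fix S :: "'a set" assume S: "finite S"
  have "(\<Sum>\<alpha>\<in>S. norm (c \<alpha> + d \<alpha>) * W \<alpha>)
      \<le> (\<Sum>\<alpha>\<in>S. norm (c \<alpha>) * W \<alpha> + norm (d \<alpha>) * W \<alpha>)"
    by (intro sum_mono) (metis distrib_right mult_right_mono norm_triangle_ineq W)
  also have "\<dots> \<le> B + B'"
    unfolding sum.distrib by (intro add_mono wboundD[OF assms(1) S] wboundD[OF assms(2) S])
  finally show "(\<Sum>\<alpha>\<in>S. norm (c \<alpha> + d \<alpha>) * W \<alpha>) \<le> B + B'" .
qed

lemma wbound_diff:
  assumes "wbound W c B" "wbound W d B'" "\<And>\<alpha>. 0 \<le> W \<alpha>"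
  shows "wbound W (\<lambda>\<alpha>. c \<alpha> - d \<alpha>) (B + B')"
  using wbound_add[OF assms(1) wbound_scale[OF assms(2), of "-1"] assms(3)] by simp

lemma wbound_sum:
  assumes "\<And>i. i \<in> I \<Longrightarrow> wbound W (c i) (B i)" "\<And>\<alpha>. 0 \<le> W \<alpha>" "finite I"
  shows "wbound W (\<lambda>\<alpha>. \<Sum>i\<in>I. c i \<alpha>) (\<Sum>i\<in>I. B i)"
  using assms(3,1)
proof (induction I rule: finite_induct)
  case empty
  then show ?case by (simp add: wbound_0)
next
  case (insert i I)
  then show ?case using wbound_add[of W "c i" "B i"] assms(2) by auto
qed

text \<open>Injectivity of \<open>\<phi>\<close> keeps a coefficient from being counted twice. Meant
  for \<open>shiftd\<close>, which transports coefficients to other exponents.\<close>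

lemma wbound_reindex:
  fixes \<phi> :: "'b \<Rightarrow> 'a"
  assumes c: "wbound V c B" and inj: "inj_on \<phi> A"
    and e: "\<And>\<alpha>. \<alpha> \<in> A \<Longrightarrow> norm (e \<alpha>) * W \<alpha> \<le> C * V (\<phi> \<alpha>)" and "0 \<le> C"
  shows "wbound W (\<lambda>\<alpha>. if \<alpha> \<in> A then e \<alpha> * c (\<phi> \<alpha>) else 0) (C * B)"
proof (rule wboundI)
  fix S :: "'b set" assume S: "finite S"
  have "(\<Sum>\<alpha>\<in>S. norm (if \<alpha> \<in> A then e \<alpha> * c (\<phi> \<alpha>) else 0) * W \<alpha>)
      = (\<Sum>\<alpha>\<in>S \<inter> A. norm (e \<alpha> * c (\<phi> \<alpha>)) * W \<alpha>)"
    using S by (intro sum.mono_neutral_cong_right) auto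
  also have "\<dots> \<le> (\<Sum>\<alpha>\<in>S \<inter> A. C * (norm (c (\<phi> \<alpha>)) * V (\<phi> \<alpha>)))"
  proof (rule sum_mono)
    fix \<alpha> assume "\<alpha> \<in> S \<inter> A"
    then show "norm (e \<alpha> * c (\<phi> \<alpha>)) * W \<alpha> \<le> C * (norm (c (\<phi> \<alpha>)) * V (\<phi> \<alpha>))"
      using mult_left_mono[OF e norm_ge_zero[of "c (\<phi> \<alpha>)"]] by (simp add: norm_mult mult_ac)
  qed
  also have "\<dots> = C * (\<Sum>\<beta>\<in>\<phi> ` (S \<inter> A). norm (c \<beta>) * V \<beta>)"
    using inj_on_subset[OF inj, of "S \<inter> A"] by (subst sum.reindex) (auto simp: sum_distrib_left)
  also have "\<dots> \<le> C * B"
    using wboundD[OF c, of "\<phi> ` (S \<inter> A)"] S \<open>0 \<le> C\<close> by (intro mult_left_mono) auto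
  finally show "(\<Sum>\<alpha>\<in>S. norm (if \<alpha> \<in> A then e \<alpha> * c (\<phi> \<alpha>) else 0) * W \<alpha>) \<le> C * B" .
qed

section \<open>Cauchy products and submultiplicative weights\<close>

definition cmul ::
    "(nat^'d::finite \<Rightarrow> complex) \<Rightarrow> (nat^'d \<Rightarrow> complex) \<Rightarrow> nat^'d \<Rightarrow> complex" where
  "cmul c d \<alpha> = (\<Sum>p | fst p + snd p = \<alpha>. c (fst p) * d (snd p))"

definition submult :: "(nat^'d::finite \<Rightarrow> real) \<Rightarrow> bool" where
  "submult W \<longleftrightarrow> W 0 = 1 \<and> (\<forall>\<alpha>. 0 < W \<alpha>) \<and> (\<forall>\<alpha> \<beta>. W (\<alpha> + \<beta>) \<le> W \<alpha> * W \<beta>)"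

lemma submult_nonneg: "submult W \<Longrightarrow> 0 \<le> W \<alpha>"
  by (simp add: submult_def less_imp_le)

lemma wbound_cmul:
  fixes c d :: "nat^'d::finite \<Rightarrow> complex"
  assumes W: "submult W" and c: "wbound W c B" and d: "wbound W d B'"
  shows "wbound W (cmul c d) (B * B')"
proof (rule wboundI)
  fix S :: "(nat^'d) set" assume S: "finite S"
  define Q where "Q = (SIGMA \<alpha>:S. {p. fst p + snd p = \<alpha>})"
  have fQ: "finite Q" unfolding Q_def using S finite_convolution by auto
  define C where "C = (\<lambda>p :: (nat^'d) \<times> (nat^'d). norm (c (fst p)) * W (fst p))"
  define D where "D = (\<lambda>p :: (nat^'d) \<times> (nat^'d). norm (d (snd p)) * W (snd p))"
  have nn: "0 \<le> C p" "0 \<le> D p" for p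
    using submult_nonneg[OF W] by (auto simp: C_def D_def)
  have "(\<Sum>\<alpha>\<in>S. norm (cmul c d \<alpha>) * W \<alpha>) \<le> (\<Sum>\<alpha>\<in>S. \<Sum>p | fst p + snd p = \<alpha>. C p * D p)"
  proof (rule sum_mono)
    fix \<alpha>
    have "norm (cmul c d \<alpha>) * W \<alpha> \<le> (\<Sum>p | fst p + snd p = \<alpha>. norm (c (fst p) * d (snd p))) * W \<alpha>"
      unfolding cmul_def using submult_nonneg[OF W] by (intro mult_right_mono norm_sum)
    also have "\<dots> \<le> (\<Sum>p | fst p + snd p = \<alpha>. C p * D p)"
      unfolding sum_distrib_right
    proof (rule sum_mono)
      fix p assume "p \<in> {p. fst p + snd p = \<alpha>}"
      then have "W \<alpha> \<le> W (fst p) * W (snd p)" using W by (auto simp: submult_def)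
      then have "norm (c (fst p) * d (snd p)) * W \<alpha>
          \<le> norm (c (fst p) * d (snd p)) * (W (fst p) * W (snd p))"
        by (rule mult_left_mono) simp
      then show "norm (c (fst p) * d (snd p)) * W \<alpha> \<le> C p * D p"
        by (simp add: C_def D_def norm_mult mult_ac)
    qed
    finally show "norm (cmul c d \<alpha>) * W \<alpha> \<le> (\<Sum>p | fst p + snd p = \<alpha>. C p * D p)" .
  qed
  also have "\<dots> = (\<Sum>q\<in>Q. C (snd q) * D (snd q))"
    unfolding Q_def using S finite_convolution by (subst sum.Sigma) (auto simp: case_prod_unfold)
  also have "\<dots> = (\<Sum>p\<in>snd ` Q. C p * D p)"
    by (subst sum.reindex) (auto simp: inj_on_def Q_def)
  \<comment> \<open>Nonnegativity allows the finite set of pairs to be enlarged to a rectangle, over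
    which the double sum factorises.\<close>
  also have "\<dots> \<le> (\<Sum>p\<in>(fst ` snd ` Q) \<times> (snd ` snd ` Q). C p * D p)"
    using fQ nn by (intro sum_mono2) (auto simp: image_iff, force+)
  also have "\<dots> = (\<Sum>\<beta>\<in>fst ` snd ` Q. norm (c \<beta>) * W \<beta>) * (\<Sum>\<gamma>\<in>snd ` snd ` Q. norm (d \<gamma>) * W \<gamma>)"
    unfolding sum_product sum.cartesian_product by (simp add: C_def D_def case_prod_unfold)
  also have "\<dots> \<le> B * B'"
    using fQ submult_nonneg[OF W] wbound_nonneg[OF c]
    by (intro mult_mono wboundD[OF c] wboundD[OF d] sum_nonneg) auto
  finally show "(\<Sum>\<alpha>\<in>S. norm (cmul c d \<alpha>) * W \<alpha>) \<le> B * B'" .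
qed

lemma cmul_diff_left: "cmul (\<lambda>\<alpha>. c \<alpha> - c' \<alpha>) d \<alpha> = cmul c d \<alpha> - cmul c' d \<alpha>"
  by (simp add: cmul_def left_diff_distrib sum_subtractf)

lemma cmul_diff_right: "cmul c (\<lambda>\<alpha>. d \<alpha> - d' \<alpha>) \<alpha> = cmul c d \<alpha> - cmul c d' \<alpha>"
  by (simp add: cmul_def right_diff_distrib sum_subtractf)

lemma cmul_const: "cmul (\<lambda>\<alpha>. if \<alpha> = 0 then k else 0) d \<alpha> = k * d \<alpha>"
proof -
  have "cmul (\<lambda>\<alpha>. if \<alpha> = 0 then k else 0) d \<alpha>
      = (\<Sum>p\<in>{(0 :: nat^'a, \<alpha>)}. k * d (snd p))"
    unfolding cmul_def by (rule sum.mono_neutral_cong_right) (use finite_convolution in auto)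
  then show ?thesis by simp
qed

lemma cmul_0: "cmul c d 0 = c 0 * d 0"
proof -
  have "a + b = 0 \<longleftrightarrow> a = 0 \<and> b = 0" for a b :: "nat^'a"
    by (auto simp: vec_eq_iff)
  then have "{p :: (nat^'a) \<times> (nat^'a). fst p + snd p = 0} = {(0, 0)}" by auto
  then show ?thesis by (simp add: cmul_def)
qed


subsection \<open>Series with geometrically bounded coefficients\<close>

text \<open>The coefficient form of convergence near 0. No radius is fixed, so the class is closed
  under products, derivatives and substitution, and it coincides with finiteness of the
  \<open>wt\<close> norm for some small \<rho>.\<close>

definition geo :: "(nat^'d::finite \<Rightarrow> complex) \<Rightarrow> bool" where
  "geo c \<longleftrightarrow> (\<exists>M>0. \<exists>K>0. \<forall>\<alpha>. norm (c \<alpha>) \<le> M * K ^ mdeg \<alpha>)"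

text \<open>
  The binomial coefficient in the denominator keeps the weight submultiplicative (Vandermonde)
  and makes \<open>x\<^sub>p \<partial>\<^sub>i\<close>, \<open>i \<noteq> p\<close>, bounded by \<open>\<rho>\<close> relative to \<open>x\<^sub>p \<partial>\<^sub>p\<close>.
\<close>

definition wt :: "'d \<Rightarrow> nat \<Rightarrow> real \<Rightarrow> nat^'d::finite \<Rightarrow> real" where
  "wt p s \<rho> \<alpha> = (1 + real (\<alpha> $ p)) ^ s * \<rho> ^ (\<alpha> $ p + mdeg \<alpha>) / real (mdeg \<alpha> choose (\<alpha> $ p))"

lemma choose_mult_choose_le: "(a choose n) * (b choose m) \<le> ((a + b) choose (n + m))"
proof -
  have "(a choose n) * (b choose m) = (\<Sum>k\<in>{n}. (a choose k) * (b choose (n + m - k)))" by simp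
  also have "\<dots> \<le> (\<Sum>k\<le>n + m. (a choose k) * (b choose (n + m - k)))"
    by (rule sum_mono2) auto
  finally show ?thesis by (simp add: vandermonde)
qed

lemma choose_component_pos: "0 < mdeg \<alpha> choose (\<alpha> $ p)"
  by (simp add: component_le_mdeg)

lemma submult_wt:
  assumes "0 < \<rho>"
  shows "submult (wt (p :: 'd::finite) s \<rho>)"
  unfolding submult_def
proof (intro conjI allI)
  show "wt p s \<rho> 0 = 1" by (simp add: wt_def)
next
  fix \<alpha> :: "nat^'d"
  show "0 < wt p s \<rho> \<alpha>"
    using assms choose_component_pos[of \<alpha> p] by (simp add: wt_def add_pos_nonneg)
next
  fix \<alpha> \<beta> :: "nat^'d"
  let ?a = "real (\<alpha> $ p)" and ?b = "real (\<beta> $ p)"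
  let ?A = "real (mdeg \<alpha> choose (\<alpha> $ p))" and ?B = "real (mdeg \<beta> choose (\<beta> $ p))"
  let ?C = "real ((mdeg \<alpha> + mdeg \<beta>) choose (\<alpha> $ p + \<beta> $ p))"
  have "?A * ?B \<le> ?C"
    using choose_mult_choose_le[of "mdeg \<alpha>" "\<alpha> $ p" "mdeg \<beta>" "\<beta> $ p"]
    by (metis of_nat_mono of_nat_mult)
  moreover have "0 < ?A" "0 < ?B" using choose_component_pos by auto
  moreover have "(1 + (?a + ?b)) ^ s \<le> ((1 + ?a) * (1 + ?b)) ^ s"
    by (intro power_mono) (auto simp: algebra_simps)
  ultimately have "(1 + (?a + ?b)) ^ s * \<rho> ^ (\<alpha> $ p + \<beta> $ p + (mdeg \<alpha> + mdeg \<beta>)) / ?C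
      \<le> ((1 + ?a) * (1 + ?b)) ^ s * \<rho> ^ (\<alpha> $ p + \<beta> $ p + (mdeg \<alpha> + mdeg \<beta>)) / (?A * ?B)"
    using assms by (intro frac_le mult_right_mono) auto
  then show "wt p s \<rho> (\<alpha> + \<beta>) \<le> wt p s \<rho> \<alpha> * wt p s \<rho> \<beta>"
    by (simp add: wt_def power_add power_mult_distrib mult_ac)
qed

lemma wt_pos: "0 < \<rho> \<Longrightarrow> 0 < wt p s \<rho> \<alpha>"
  using submult_wt[of \<rho> p s] by (simp add: submult_def)

lemma wt_Suc: "wt p (Suc s) \<rho> \<alpha> = (1 + real (\<alpha> $ p)) * wt p s \<rho> \<alpha>"
  by (simp add: wt_def)

lemma wt_mono:
  assumes "0 < \<rho>" "s \<le> t"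
  shows "wt p s \<rho> \<alpha> \<le> wt p t \<rho> \<alpha>"
  unfolding wt_def using assms by (intro divide_right_mono mult_right_mono power_increasing) auto

text \<open>A nonzero exponent carries at least one factor \<rho>. All smallness of non-constant
  parts of coefficients as \<rho> tends to 0 comes from this ratio.\<close>

lemma wt_le_scale:
  assumes "0 < \<rho>" "\<rho> \<le> \<rho>'" "\<alpha> \<noteq> 0"
  shows "wt p s \<rho> \<alpha> \<le> \<rho> / \<rho>' * wt p s \<rho>' \<alpha>"
proof -
  let ?m = "\<alpha> $ p + mdeg \<alpha>"
  have "?m \<ge> 1" using assms(3) mdeg_eq_0_iff[of \<alpha>] by linarith
  then obtain j where j: "?m = Suc j" by (metis One_nat_def Suc_le_D)
  have "\<rho> ^ j \<le> \<rho>' ^ j" using assms by (intro power_mono) auto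
  then have "\<rho> ^ ?m \<le> \<rho> / \<rho>' * \<rho>' ^ ?m"
    using assms unfolding j by (simp add: mult_left_mono)
  then have "(1 + real (\<alpha> $ p)) ^ s * \<rho> ^ ?m / real (mdeg \<alpha> choose (\<alpha> $ p))
      \<le> (1 + real (\<alpha> $ p)) ^ s * (\<rho> / \<rho>' * \<rho>' ^ ?m) / real (mdeg \<alpha> choose (\<alpha> $ p))"
    by (intro divide_right_mono mult_left_mono) auto
  then show ?thesis by (simp add: wt_def mult_ac)
qed

lemma real_le_two_power: "1 + real n \<le> 2 ^ n"
  by (metis Suc_leI less_exp of_nat_1 of_nat_Suc of_nat_mono of_nat_numeral of_nat_power add.commute)

lemma geo_imp_wbound:
  assumes "geo c"
  obtains \<rho> B where "0 < \<rho>" "\<rho> \<le> 1" "0 < B" "wbound (wt p s \<rho>) c B"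
proof -
  obtain M K where MK: "M > 0" "K > 0" "\<And>\<alpha>. norm (c \<alpha>) \<le> M * K ^ mdeg \<alpha>"
    using assms unfolding geo_def by blast
  \<comment> \<open>The factor \<open>2 ^ s\<close> absorbs the polynomial part of the weight, since
    \<open>(1 + n) ^ s \<le> (2 ^ s) ^ n\<close>; what remains is geometric of ratio at most
    1/2.\<close>
  define \<rho> where "\<rho> = min 1 (1 / (2 * K * 2 ^ s))"
  have \<rho>: "0 < \<rho>" "\<rho> \<le> 1" "\<rho> * (K * 2 ^ s) \<le> 1 / 2"
  proof -
    have "\<rho> * (K * 2 ^ s) \<le> 1 / (2 * K * 2 ^ s) * (K * 2 ^ s)"
      using MK by (intro mult_right_mono) (auto simp: \<rho>_def)
    then show "\<rho> * (K * 2 ^ s) \<le> 1 / 2" using MK by simp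
  qed (use MK in \<open>auto simp: \<rho>_def\<close>)
  have "wbound (wt p s \<rho>) c (M * 2 ^ CARD('a))"
  proof (rule wboundI)
    fix S :: "(nat^'a) set" assume S: "finite S"
    have "(\<Sum>\<alpha>\<in>S. norm (c \<alpha>) * wt p s \<rho> \<alpha>) \<le> (\<Sum>\<alpha>\<in>S. M * (1 / 2) ^ mdeg \<alpha>)"
    proof (rule sum_mono)
      fix \<alpha> :: "nat^'a"
      let ?n = "\<alpha> $ p" and ?m = "mdeg \<alpha>"
      have "(1 + real ?n) ^ s \<le> (2 ^ ?m) ^ s"
        using real_le_two_power[of ?n] power_increasing[OF component_le_mdeg[of \<alpha> p], of "2::real"]
        by (intro power_mono) linarith+
      then have 1: "(1 + real ?n) ^ s \<le> (2 ^ s) ^ ?m" by (simp add: power_mult[symmetric] mult.commute)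
      have 2: "\<rho> ^ (?n + ?m) \<le> \<rho> ^ ?m" using \<rho> by (intro power_decreasing) auto
      have "wt p s \<rho> \<alpha> \<le> (1 + real ?n) ^ s * \<rho> ^ (?n + ?m) / 1"
        unfolding wt_def using \<rho> choose_component_pos[of \<alpha> p] by (intro divide_left_mono) (auto simp del: zero_less_binomial_iff simp: Suc_le_eq)
      also have "\<dots> \<le> (2 ^ s) ^ ?m * \<rho> ^ ?m" using 1 2 \<rho> by (auto intro!: mult_mono)
      finally have "norm (c \<alpha>) * wt p s \<rho> \<alpha> \<le> (M * K ^ ?m) * ((2 ^ s) ^ ?m * \<rho> ^ ?m)"
        using MK \<rho> wt_pos[of \<rho> p s \<alpha>] by (intro mult_mono) auto
      also have "\<dots> = M * (\<rho> * (K * 2 ^ s)) ^ ?m" by (simp add: power_mult_distrib mult_ac)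
      also have "\<dots> \<le> M * (1 / 2) ^ ?m"
        using MK \<rho> by (intro mult_left_mono power_mono) auto
      finally show "norm (c \<alpha>) * wt p s \<rho> \<alpha> \<le> M * (1 / 2) ^ ?m" .
    qed
    also have "\<dots> \<le> M * (1 / (1 - 1 / 2)) ^ CARD('a)"
      unfolding sum_distrib_left[symmetric] using MK S
      by (intro mult_left_mono sum_power_mdeg_le) auto
    finally show "(\<Sum>\<alpha>\<in>S. norm (c \<alpha>) * wt p s \<rho> \<alpha>) \<le> M * 2 ^ CARD('a)" by simp
  qed
  then show ?thesis using \<rho> MK that[of \<rho> "M * 2 ^ CARD('a)"] by simp
qed

text \<open>The power of \<rho> in the weight is at most \<open>2 * mdeg \<alpha>\<close> and the
  binomial coefficient at most \<open>2 ^ mdeg \<alpha>\<close>. Consequently the weight dominates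
  all monomials on the polydisc of radius \<open>\<rho>\<^sup>2 / 2\<close>.\<close>

lemma wt_lower_bound:
  assumes "0 < \<rho>" "\<rho> \<le> 1"
  shows "(\<rho>\<^sup>2 / 2) ^ mdeg \<alpha> \<le> wt p s \<rho> \<alpha>"
proof -
  let ?n = "\<alpha> $ p" and ?m = "mdeg \<alpha>"
  have le: "\<rho> ^ (2 * ?m) \<le> \<rho> ^ (?n + ?m)"
    using assms component_le_mdeg[of \<alpha> p] by (intro power_decreasing) auto
  have ch: "real (?m choose ?n) \<le> 2 ^ ?m"
    using binomial_le_pow2[of ?m ?n] of_nat_mono by fastforce
  have "\<rho> ^ (2 * ?m) / 2 ^ ?m \<le> 1 * \<rho> ^ (?n + ?m) / real (?m choose ?n)"
    using le ch assms choose_component_pos[of \<alpha> p] by (intro frac_le) auto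
  also have "\<dots> \<le> wt p s \<rho> \<alpha>"
    unfolding wt_def using assms by (intro divide_right_mono mult_right_mono) auto
  finally show ?thesis by (simp add: power_divide power_mult)
qed

lemma wbound_imp_geo:
  assumes c: "wbound (wt p s \<rho>) c B" and \<rho>: "0 < \<rho>" "\<rho> \<le> 1"
  shows "geo c"
proof -
  have B: "0 \<le> B" using wbound_nonneg[OF c] .
  have "norm (c \<alpha>) \<le> (B + 1) * (2 / \<rho>\<^sup>2) ^ mdeg \<alpha>" for \<alpha>
  proof -
    let ?m = "mdeg \<alpha>"
    have "norm (c \<alpha>) * (\<rho>\<^sup>2 / 2) ^ ?m \<le> norm (c \<alpha>) * wt p s \<rho> \<alpha>"
      by (intro mult_left_mono wt_lower_bound \<rho>) simp
    also have "\<dots> \<le> B + 1" using wbound_point[OF c, of \<alpha>] by simp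
    finally have "norm (c \<alpha>) \<le> (B + 1) / (\<rho>\<^sup>2 / 2) ^ ?m"
      using \<rho> by (simp add: pos_le_divide_eq)
    then show ?thesis by (simp add: power_divide)
  qed
  moreover have "B + 1 > 0" "2 / \<rho>\<^sup>2 > 0" using B \<rho> by auto
  ultimately show ?thesis unfolding geo_def by blast
qed

lemma wbound_shrink:
  assumes c: "wbound (wt p s \<rho>') c B" and "c 0 = 0" and \<rho>: "0 < \<rho>" "\<rho> \<le> \<rho>'"
  shows "wbound (wt p s \<rho>) c (\<rho> / \<rho>' * B)"
proof -
  have "wbound (wt p s \<rho>) (\<lambda>\<alpha>. (if \<alpha> = 0 then 0 else 1) * c \<alpha>) (\<rho> / \<rho>' * B)"
    using wt_le_scale[OF \<rho>] wt_pos[of \<rho>' p s] \<rho> by (intro wbound_diag[OF c]) (auto simp: less_imp_le)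
  then show ?thesis by (rule wbound_cong[rotated]) (auto simp: assms(2))
qed

lemma wbound_decrease:
  assumes c: "wbound (wt p s \<rho>') c B" and \<rho>: "0 < \<rho>" "\<rho> \<le> \<rho>'"
  shows "wbound (wt p s \<rho>) c B"
proof (rule wbound_weight_mono[OF c])
  fix \<alpha> show "wt p s \<rho> \<alpha> \<le> wt p s \<rho>' \<alpha>"
    unfolding wt_def using \<rho> by (intro divide_right_mono mult_left_mono power_mono) auto
qed

lemma eventually_at_right_0I:
  assumes "0 < b" "\<And>\<rho>. 0 < \<rho> \<Longrightarrow> \<rho> \<le> b \<Longrightarrow> P \<rho>"
  shows "\<forall>\<^sub>F \<rho> in at_right (0::real). P \<rho>"
  unfolding eventually_at_right_field using assms by (intro exI[of _ b]) auto

text \<open>Used for coefficients stripped of their constant term, and again to place a convergent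
  solution of unknown radius inside a ball of prescribed size.\<close>

lemma geo_small:
  assumes "geo c" "c 0 = 0" "0 < \<epsilon>"
  shows "\<forall>\<^sub>F \<rho> in at_right 0. wbound (wt p s \<rho>) c \<epsilon>"
proof -
  obtain \<rho>' B where *: "0 < \<rho>'" "\<rho>' \<le> 1" "0 < B" "wbound (wt p s \<rho>') c B"
    using geo_imp_wbound[OF assms(1)] by metis
  show ?thesis
  proof (rule eventually_at_right_0I[of "min \<rho>' (\<rho>' * \<epsilon> / B)"])
    fix \<rho> assume that: "0 < \<rho>" "\<rho> \<le> min \<rho>' (\<rho>' * \<epsilon> / B)"
    have "\<rho> * B \<le> \<rho>' * \<epsilon>" using that * by (simp add: field_simps)
    then have "\<rho> / \<rho>' * B \<le> \<epsilon>" using * by (simp add: field_simps)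
    moreover have "wbound (wt p s \<rho>) c (\<rho> / \<rho>' * B)"
      using that by (intro wbound_shrink[OF *(4) assms(2)]) auto
    ultimately show "wbound (wt p s \<rho>) c \<epsilon>" by (rule wbound_mono[rotated])
  qed (use * assms(3) in auto)
qed

lemma geo_bounded:
  assumes "geo c"
  obtains B where "0 < B" "\<forall>\<^sub>F \<rho> in at_right 0. wbound (wt p s \<rho>) c B"
proof -
  obtain \<rho>' B where *: "0 < \<rho>'" "\<rho>' \<le> 1" "0 < B" "wbound (wt p s \<rho>') c B"
    using geo_imp_wbound[OF assms(1)] by metis
  show ?thesis
    using * wbound_decrease[OF *(4)] by (intro that[of B] eventually_at_right_0I[of \<rho>']) auto
qed


subsection \<open>Substitution of formal power series\<close>

text \<open>Writing a multi-index as a word lets products and compositions of operators recurse on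
  lists. The order is a parameter: differentiation must follow the order of
  \<open>partial_derivs\<close>, substitution may follow any.\<close>

definition letters :: "'i list \<Rightarrow> nat^'i::finite \<Rightarrow> 'i list" where
  "letters xs \<nu> = concat (map (\<lambda>i. replicate (\<nu> $ i) i) xs)"

lemma prod_list_letters:
  fixes f :: "'i::finite \<Rightarrow> 'a::comm_monoid_mult"
  assumes "distinct xs" "set xs = UNIV"
  shows "prod_list (map f (letters xs \<nu>)) = (\<Prod>i\<in>UNIV. f i ^ (\<nu> $ i))"
proof -
  have "prod_list (map f (letters ys \<nu>)) = (\<Prod>i\<in>set ys. f i ^ (\<nu> $ i))" if "distinct ys" for ys
    using that by (induction ys) (auto simp: letters_def map_replicate_const prod_list_replicate)
  then show ?thesis using assms by metis
qed

lemma length_letters: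
  assumes "distinct xs" "set xs = UNIV"
  shows "length (letters xs \<nu>) = mdeg \<nu>"
proof -
  have "length (letters ys \<nu>) = (\<Sum>i\<in>set ys. \<nu> $ i)" if "distinct ys" for ys
    using that by (induction ys) (auto simp: letters_def)
  then show ?thesis using assms by (simp add: mdeg_def)
qed

lemma letters_axis:
  assumes "distinct xs" "set xs = UNIV"
  shows "letters xs (axis i 1) = [i]"
proof -
  have "length (letters xs (axis i 1)) = 1" using length_letters[OF assms] by simp
  then obtain j where j: "letters xs (axis i 1) = [j]" by (auto simp: length_Suc_conv)
  have "j \<in> set (letters xs (axis i 1))" unfolding j by simp
  then have "j = i" by (auto simp: letters_def axis_def split: if_splits)
  with j show ?thesis by simp
qed

text \<open>The index type of a substitution is only assumed finite. An arbitrary enumeration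
  serves, because the values of the factors commute (\<open>prod_list_letters\<close>).\<close>

definition letter_order :: "'i::finite list" where
  "letter_order = (SOME xs. distinct xs \<and> set xs = UNIV)"

lemma letter_order: "distinct (letter_order :: 'i::finite list)" "set (letter_order :: 'i list) = UNIV"
proof -
  have "\<exists>xs :: 'i list. distinct xs \<and> set xs = UNIV"
    using finite_distinct_list[of "UNIV :: 'i set"] by auto
  then have "distinct (letter_order :: 'i list) \<and> set (letter_order :: 'i list) = UNIV"
    unfolding letter_order_def by (rule someI_ex)
  then show "distinct (letter_order :: 'i list)" "set (letter_order :: 'i list) = UNIV" by auto
qed

definition mpow :: "('i \<Rightarrow> nat^'d::finite \<Rightarrow> complex) \<Rightarrow> 'i list \<Rightarrow> nat^'d \<Rightarrow> complex" where
  "mpow Z ws = foldr (\<lambda>i. cmul (Z i)) ws (\<lambda>\<alpha>. if \<alpha> = 0 then 1 else 0)"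

lemma mpow_Nil: "mpow Z [] = (\<lambda>\<alpha>. if \<alpha> = 0 then 1 else 0)"
  and mpow_Cons: "mpow Z (i # ws) = cmul (Z i) (mpow Z ws)"
  by (simp_all add: mpow_def)

lemma cmul_one_right: "cmul c (\<lambda>\<alpha>. if \<alpha> = 0 then 1 else 0) = c"
proof
  fix \<alpha> :: "nat^'a"
  have "cmul c (\<lambda>\<alpha>. if \<alpha> = 0 then 1 else 0) \<alpha> = (\<Sum>p\<in>{(\<alpha>, 0 :: nat^'a)}. c (fst p))"
    unfolding cmul_def by (rule sum.mono_neutral_cong_right) (use finite_convolution in auto)
  then show "cmul c (\<lambda>\<alpha>. if \<alpha> = 0 then 1 else 0) \<alpha> = c \<alpha>" by simp
qed

lemma mpow_single: "mpow Z [i] = Z i"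
  by (simp add: mpow_Cons mpow_Nil cmul_one_right)

text \<open>Each factor without constant term contributes at least one degree. This is what makes
  the truncated sum in \<open>subst_series\<close> the full substitution.\<close>

lemma mpow_eq_0:
  assumes "\<And>i. Z i 0 = 0" "mdeg \<alpha> < length ws"
  shows "mpow Z ws \<alpha> = 0"
  using assms(2)
proof (induction ws arbitrary: \<alpha>)
  case (Cons i ws)
  have "Z i (fst p) * mpow Z ws (snd p) = 0" if "fst p + snd p = \<alpha>" for p
  proof (cases "fst p = 0")
    case False
    then have "mdeg (fst p) > 0" using mdeg_eq_0_iff[of "fst p"] by linarith
    then have "mdeg (snd p) < length ws" using that Cons.prems by auto
    then show ?thesis by (simp add: Cons.IH)
  qed (simp add: assms(1))
  then show ?case unfolding mpow_Cons cmul_def by (intro sum.neutral) auto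
qed simp

lemma wbound_mpow:
  assumes W: "submult W" and Z: "\<And>i. wbound W (Z i) R"
  shows "wbound W (mpow Z ws) (R ^ length ws)"
proof (induction ws)
  case Nil
  have "(\<Sum>\<alpha>\<in>S. norm (mpow Z [] \<alpha>) * W \<alpha>) \<le> 1" if "finite S" for S
  proof -
    have "(\<Sum>\<alpha>\<in>S. norm (mpow Z [] \<alpha>) * W \<alpha>) = (\<Sum>\<alpha>\<in>S \<inter> {0}. W \<alpha>)"
      using that by (intro sum.mono_neutral_cong_right) (auto simp: mpow_Nil)
    also have "\<dots> \<le> 1" using W by (cases "0 \<in> S") (auto simp: submult_def)
    finally show ?thesis .
  qed
  then show ?case by (simp add: wbound_def)
next
  case (Cons i ws)
  then show ?case using wbound_cmul[OF W Z[of i] Cons.IH] by (simp add: mpow_Cons)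
qed

text \<open>Telescoping: one factor at a time is exchanged, through Z u - Z' u' = (Z - Z') u + Z' (u
  - u'). The bound is the derivative n R^(n-1) of the n-th power times \<delta>.\<close>

lemma wbound_mpow_diff:
  assumes W: "submult W" and Z: "\<And>i. wbound W (Z i) R" "\<And>i. wbound W (Z' i) R"
    and d: "\<And>i. wbound W (\<lambda>\<alpha>. Z i \<alpha> - Z' i \<alpha>) \<delta>"
  shows "wbound W (\<lambda>\<alpha>. mpow Z ws \<alpha> - mpow Z' ws \<alpha>) (real (length ws) * R ^ (length ws - 1) * \<delta>)"
proof (induction ws)
  case Nil
  then show ?case by (simp add: mpow_Nil wbound_def)
next
  case (Cons i ws)
  let ?n = "length ws"
  have "wbound W (\<lambda>\<alpha>. cmul (\<lambda>\<alpha>. Z i \<alpha> - Z' i \<alpha>) (mpow Z ws) \<alpha>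
      + cmul (Z' i) (\<lambda>\<alpha>. mpow Z ws \<alpha> - mpow Z' ws \<alpha>) \<alpha>)
      (\<delta> * R ^ ?n + R * (real ?n * R ^ (?n - 1) * \<delta>))"
    by (intro wbound_add wbound_cmul W Z d wbound_mpow Cons.IH submult_nonneg)
  \<comment> \<open>For the empty word the truncated exponent \<open>?n - 1\<close> is harmless, its
    term having the factor 0.\<close>
  moreover have "\<delta> * R ^ ?n + R * (real ?n * R ^ (?n - 1) * \<delta>)
      = real (length (i # ws)) * R ^ (length (i # ws) - 1) * \<delta>"
    by (cases ?n) (auto simp: algebra_simps)
  ultimately show ?case
    by (simp add: mpow_Cons cmul_diff_left cmul_diff_right)
qed

text \<open>
  Only exponents \<open>\<nu>\<close> with \<open>mdeg \<nu> \<le> mdeg \<alpha>\<close> contribute to the coefficient of \<open>x\<^sup>\<alpha>\<close> as soon as the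
  substituted series have no constant term, which is assumed throughout.
\<close>

definition subst_series ::
    "(nat^'i::finite \<Rightarrow> complex) \<Rightarrow> ('i \<Rightarrow> nat^'d::finite \<Rightarrow> complex) \<Rightarrow> nat^'d \<Rightarrow> complex" where
  "subst_series f Z \<alpha> = (\<Sum>\<nu> | mdeg \<nu> \<le> mdeg \<alpha>. f \<nu> * mpow Z (letters letter_order \<nu>) \<alpha>)"

text \<open>In a difference the constant term of \<open>f\<close> cancels and the linear part is the
  one that enters the matrix \<open>J\<close>. What is left has degree at least two, hence a small
  Lipschitz constant on a small ball.\<close>

lemma subst_series_diff_linear:
  fixes Z Z' :: "'i::finite \<Rightarrow> nat^'d::finite \<Rightarrow> complex"
  assumes "\<And>i. Z i 0 = 0" "\<And>i. Z' i 0 = 0"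
  shows "subst_series f Z \<alpha> - subst_series f Z' \<alpha> - (\<Sum>i\<in>UNIV. f (axis i 1) * (Z i \<alpha> - Z' i \<alpha>))
    = (\<Sum>\<nu> | 2 \<le> mdeg \<nu> \<and> mdeg \<nu> \<le> mdeg \<alpha>.
        f \<nu> * (mpow Z (letters letter_order \<nu>) \<alpha> - mpow Z' (letters letter_order \<nu>) \<alpha>))"
proof -
  define g where "g = (\<lambda>\<nu>. f \<nu> * (mpow Z (letters letter_order \<nu>) \<alpha> - mpow Z' (letters letter_order \<nu>) \<alpha>))"
  have diff: "subst_series f Z \<alpha> - subst_series f Z' \<alpha> = sum g {\<nu>. mdeg \<nu> \<le> mdeg \<alpha>}"
    by (simp add: subst_series_def g_def sum_subtractf right_diff_distrib)
  have g0: "g 0 = 0"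
  proof -
    have "letters letter_order (0 :: nat^'i) = []"
      using length_letters[OF letter_order, of "0 :: nat^'i"] by simp
    then show ?thesis by (simp add: g_def mpow_Nil)
  qed
  have g1: "g (axis i 1) = f (axis i 1) * (Z i \<alpha> - Z' i \<alpha>)" for i
    by (simp add: g_def letters_axis[OF letter_order, unfolded One_nat_def] mpow_single)
  have lin: "(\<Sum>i\<in>UNIV. f (axis i 1) * (Z i \<alpha> - Z' i \<alpha>)) = sum g {\<nu>. mdeg \<nu> \<le> mdeg \<alpha> \<and> mdeg \<nu> \<le> 1}"
  \<comment> \<open>At \<alpha> = 0 the truncation \<open>mdeg \<nu> \<le> mdeg \<alpha>\<close>
    excludes the linear exponents; the identity survives because \<open>Z\<close> and
    \<open>Z'\<close> have no constant terms.\<close>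
  proof (cases "\<alpha> = 0")
    case True
    have "{\<nu> :: nat^'i. mdeg \<nu> \<le> mdeg \<alpha> \<and> mdeg \<nu> \<le> 1} = {0}" using True by auto
    then show ?thesis using True assms g0 by simp
  next
    case False
    then have "1 \<le> mdeg \<alpha>" using mdeg_eq_0_iff[of \<alpha>] by linarith
    then have "{\<nu> :: nat^'i. mdeg \<nu> \<le> mdeg \<alpha> \<and> mdeg \<nu> \<le> 1} = insert 0 (range (\<lambda>i. axis i 1))"
      by (auto simp: le_Suc_eq elim: mdeg_eq_1E[unfolded One_nat_def])
    moreover have "0 \<notin> range (\<lambda>i. axis i 1 :: nat^'i)"
      by (metis imageE mdeg_0 mdeg_axis zero_neq_one)
    moreover have "inj (\<lambda>i. axis i 1 :: nat^'i)" by (auto intro!: injI simp: axis_eq_axis)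
    ultimately show ?thesis using g0 by (simp add: sum.reindex g1[unfolded One_nat_def])
  qed
  have "sum g {\<nu>. mdeg \<nu> \<le> mdeg \<alpha>}
      = sum g {\<nu>. mdeg \<nu> \<le> mdeg \<alpha> \<and> mdeg \<nu> \<le> 1} + sum g {\<nu>. 2 \<le> mdeg \<nu> \<and> mdeg \<nu> \<le> mdeg \<alpha>}"
  proof (subst sum.union_disjoint[symmetric])
    show "finite {\<nu> :: nat^'i. mdeg \<nu> \<le> mdeg \<alpha> \<and> mdeg \<nu> \<le> 1}"
      "finite {\<nu> :: nat^'i. 2 \<le> mdeg \<nu> \<and> mdeg \<nu> \<le> mdeg \<alpha>}"
      by (rule finite_subset[OF _ finite_mdeg_le[of "mdeg \<alpha>"]]; auto)+
  qed (auto intro!: sum.cong)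
  then show ?thesis unfolding diff lin by (simp add: g_def)
qed

lemma wbound_subst_series_diff:
  fixes Z Z' :: "'i::finite \<Rightarrow> nat^'d::finite \<Rightarrow> complex"
  assumes f: "\<And>\<nu>. norm (f \<nu>) \<le> M * K ^ mdeg \<nu>" "0 < M" "0 < K"
    and R: "0 < R" "4 * K * R \<le> 1"
    and W: "submult W" and Z: "\<And>i. wbound W (Z i) R" "\<And>i. wbound W (Z' i) R"
    and d: "\<And>i. wbound W (\<lambda>\<alpha>. Z i \<alpha> - Z' i \<alpha>) \<delta>"
    and Z0: "\<And>i. Z i 0 = 0" "\<And>i. Z' i 0 = 0"
  shows "wbound W (\<lambda>\<alpha>. subst_series f Z \<alpha> - subst_series f Z' \<alpha>
      - (\<Sum>i\<in>UNIV. f (axis i 1) * (Z i \<alpha> - Z' i \<alpha>))) (M * (16 * K\<^sup>2 * R) * 2 ^ CARD('i) * \<delta>)"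
  unfolding subst_series_diff_linear[of Z Z', OF Z0]
proof (rule wboundI)
  fix S :: "(nat^'d) set" assume S: "finite S"
  define \<Delta> where "\<Delta> \<nu> \<alpha> = mpow Z (letters letter_order \<nu>) \<alpha> - mpow Z' (letters letter_order \<nu>) \<alpha>" for \<nu> \<alpha>
  define n where "n = Max (insert 0 (mdeg ` S))"
  define V where "V = {\<nu> :: nat^'i. 2 \<le> mdeg \<nu> \<and> mdeg \<nu> \<le> n}"
  have \<delta>: "0 \<le> \<delta>" using wbound_nonneg[OF d] .
  have V: "finite V" unfolding V_def by (rule finite_subset[OF _ finite_mdeg_le[of n]]) auto
  have n: "mdeg \<alpha> \<le> n" if "\<alpha> \<in> S" for \<alpha>
    using S that by (auto simp: n_def intro!: Max_ge)
  have "(\<Sum>\<alpha>\<in>S. norm (\<Sum>\<nu> | 2 \<le> mdeg \<nu> \<and> mdeg \<nu> \<le> mdeg \<alpha>. f \<nu> * \<Delta> \<nu> \<alpha>) * W \<alpha>)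
      \<le> (\<Sum>\<alpha>\<in>S. \<Sum>\<nu>\<in>V. norm (f \<nu>) * (norm (\<Delta> \<nu> \<alpha>) * W \<alpha>))"
  proof (rule sum_mono)
    fix \<alpha> assume "\<alpha> \<in> S"
    have "norm (\<Sum>\<nu> | 2 \<le> mdeg \<nu> \<and> mdeg \<nu> \<le> mdeg \<alpha>. f \<nu> * \<Delta> \<nu> \<alpha>)
        \<le> (\<Sum>\<nu> | 2 \<le> mdeg \<nu> \<and> mdeg \<nu> \<le> mdeg \<alpha>. norm (f \<nu> * \<Delta> \<nu> \<alpha>))"
      by (rule norm_sum)
    also have "\<dots> \<le> (\<Sum>\<nu>\<in>V. norm (f \<nu> * \<Delta> \<nu> \<alpha>))"
      using n[OF \<open>\<alpha> \<in> S\<close>] V by (intro sum_mono2) (auto simp: V_def)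
    finally have "norm (\<Sum>\<nu> | 2 \<le> mdeg \<nu> \<and> mdeg \<nu> \<le> mdeg \<alpha>. f \<nu> * \<Delta> \<nu> \<alpha>)
        \<le> (\<Sum>\<nu>\<in>V. norm (f \<nu> * \<Delta> \<nu> \<alpha>))" .
    from mult_right_mono[OF this submult_nonneg[OF W, of \<alpha>]]
    show "norm (\<Sum>\<nu> | 2 \<le> mdeg \<nu> \<and> mdeg \<nu> \<le> mdeg \<alpha>. f \<nu> * \<Delta> \<nu> \<alpha>) * W \<alpha>
        \<le> (\<Sum>\<nu>\<in>V. norm (f \<nu>) * (norm (\<Delta> \<nu> \<alpha>) * W \<alpha>))"
      by (simp add: sum_distrib_right norm_mult mult.assoc)
  qed
  also have "\<dots> = (\<Sum>\<nu>\<in>V. norm (f \<nu>) * (\<Sum>\<alpha>\<in>S. norm (\<Delta> \<nu> \<alpha>) * W \<alpha>))"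
    by (subst sum.swap) (simp add: sum_distrib_left)
  also have "\<dots> \<le> (\<Sum>\<nu>\<in>V. M * (16 * K\<^sup>2 * R) * \<delta> * (1 / 2) ^ mdeg \<nu>)"
  proof (rule sum_mono)
    fix \<nu> assume "\<nu> \<in> V"
    let ?n = "mdeg \<nu>"
    have n2: "2 \<le> ?n" using \<open>\<nu> \<in> V\<close> by (simp add: V_def)
    have "wbound W (\<Delta> \<nu>) (real ?n * R ^ (?n - 1) * \<delta>)"
      using wbound_mpow_diff[of W Z R Z' \<delta> "letters letter_order \<nu>", OF W Z d]
      by (simp add: \<Delta>_def[abs_def] length_letters[OF letter_order])
    then have "norm (f \<nu>) * (\<Sum>\<alpha>\<in>S. norm (\<Delta> \<nu> \<alpha>) * W \<alpha>)
        \<le> (M * K ^ ?n) * (real ?n * R ^ (?n - 1) * \<delta>)"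
      using f R \<delta> submult_nonneg[OF W] S
      by (intro mult_mono wboundD f) (auto intro!: sum_nonneg)
    \<comment> \<open>Of the factor 4 in \<open>4 * K * R\<close>, one 2 absorbs the number n of
      letters and the other leaves the geometric weights \<open>(1 / 2) ^ mdeg \<nu>\<close> that
      make the sum over \<nu> converge. Degree at least two then yields
      \<open>(4 * K * R)\<^sup>2 / R\<close>, which is linear in \<open>R\<close>.\<close>
    also have "\<dots> \<le> (M * K ^ ?n) * (2 ^ ?n * R ^ (?n - 1) * \<delta>)"
      using f R \<delta> real_le_two_power[of ?n] by (intro mult_left_mono mult_right_mono) auto
    also have "\<dots> = M * ((4 * K * R) ^ ?n / R) * \<delta> * (1 / 2) ^ ?n"
    proof -
      have "R ^ ?n = R * R ^ (?n - 1)" using n2 by (metis power_eq_if not_numeral_le_zero)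
      moreover have "(4::real) ^ ?n = 2 ^ ?n * 2 ^ ?n" by (simp add: power_mult_distrib[symmetric])
      ultimately show ?thesis using R by (simp add: power_mult_distrib power_divide)
    qed
    also have "\<dots> \<le> M * ((4 * K * R) ^ 2 / R) * \<delta> * (1 / 2) ^ ?n"
      using f R \<delta> n2
      by (intro mult_right_mono mult_left_mono divide_right_mono power_decreasing) auto
    also have "(4 * K * R) ^ 2 / R = 16 * K\<^sup>2 * R" using R by (simp add: power2_eq_square)
    finally show "norm (f \<nu>) * (\<Sum>\<alpha>\<in>S. norm (\<Delta> \<nu> \<alpha>) * W \<alpha>)
        \<le> M * (16 * K\<^sup>2 * R) * \<delta> * (1 / 2) ^ ?n" .
  qed
  also have "\<dots> \<le> M * (16 * K\<^sup>2 * R) * \<delta> * (1 / (1 - 1 / 2)) ^ CARD('i)"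
    unfolding sum_distrib_left[symmetric] using f R \<delta> V
    by (intro mult_left_mono sum_power_mdeg_le) auto
  finally show "(\<Sum>\<alpha>\<in>S. norm (\<Sum>\<nu> | 2 \<le> mdeg \<nu> \<and> mdeg \<nu> \<le> mdeg \<alpha>.
      f \<nu> * (mpow Z (letters letter_order \<nu>) \<alpha> - mpow Z' (letters letter_order \<nu>) \<alpha>)) * W \<alpha>)
      \<le> M * (16 * K\<^sup>2 * R) * 2 ^ CARD('i) * \<delta>"
    by (simp add: \<Delta>_def mult_ac)
qed

lemma subst_series_0: "subst_series f Z 0 = f 0" if "\<And>i. Z i 0 = 0"
proof -
  have "{\<nu> :: nat^'a. mdeg \<nu> \<le> mdeg (0 :: nat^'b)} = {0}" by auto
  moreover have "letters letter_order (0 :: nat^'a) = []"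
    using length_letters[OF letter_order, of "0 :: nat^'a"] by simp
  ultimately show ?thesis by (simp add: subst_series_def mpow_Nil)
qed

lemma subst_series_zero: "subst_series f (\<lambda>i \<alpha>. 0) \<alpha> = (if \<alpha> = 0 then f 0 else 0)"
proof -
  have "mpow (\<lambda>i \<alpha>. 0) (letters letter_order \<nu>) \<alpha> = (if \<nu> = 0 \<and> \<alpha> = 0 then 1 else 0)" for \<nu> :: "nat^'a"
  proof (cases "letters letter_order \<nu>")
    case Nil
    then have "\<nu> = 0" using length_letters[OF letter_order, of \<nu>] by simp
    then show ?thesis using Nil by (simp add: mpow_Nil)
  next
    case (Cons i ws)
    then have "\<nu> \<noteq> 0" using length_letters[OF letter_order, of \<nu>] by auto
    then show ?thesis using Cons by (simp add: mpow_Cons cmul_def)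
  qed
  then have "subst_series f (\<lambda>i \<alpha>. 0) \<alpha> = (\<Sum>\<nu>\<in>{0}. if \<alpha> = 0 then f \<nu> else 0)"
    unfolding subst_series_def by (intro sum.mono_neutral_cong_right) (auto simp: finite_mdeg_le)
  then show ?thesis by simp
qed


subsection \<open>The straightened differential operator on formal series\<close>

text \<open>With t = x_p, \<open>theta p j\<close> is t \<partial>_t - j and
  \<open>shiftd p i\<close> is t \<partial>_i for i \<noteq> p, both given directly on coefficients
  so that norm estimates need no convergence. \<open>theta_eq\<close> and \<open>shiftd_eq\<close>
  confirm the reading.\<close>

definition theta :: "'d \<Rightarrow> nat \<Rightarrow> (nat^'d::finite \<Rightarrow> complex) \<Rightarrow> nat^'d \<Rightarrow> complex" where
  "theta p j c \<alpha> = (of_nat (\<alpha> $ p) - of_nat j) * c \<alpha>"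

definition shiftd :: "'d \<Rightarrow> 'd \<Rightarrow> (nat^'d::finite \<Rightarrow> complex) \<Rightarrow> nat^'d \<Rightarrow> complex" where
  "shiftd p i c \<alpha> =
     (if 1 \<le> \<alpha> $ p then (of_nat (\<alpha> $ i) + 1) * c (\<alpha> - axis p 1 + axis i 1) else 0)"

text \<open>
  With \<open>D\<^sub>i = \<pi>\<^sub>i \<partial>\<^sub>p + [i \<noteq> p] \<partial>\<^sub>i\<close> and \<open>t = x\<^sub>p\<close>, this is \<open>t\<^sup>j D\<^bsub>i\<^sub>1\<^esub> \<cdots> D\<^bsub>i\<^sub>j\<^esub>\<close>: the identity
  \<open>t\<^sup>j D\<^sub>i G = (t D\<^sub>i - (j - 1) \<pi>\<^sub>i) (t\<^bsup>j-1\<^esup> G)\<close> allows one factor \<open>t\<close> to be moved to each \<open>D\<^sub>i\<close>.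
\<close>

fun Top :: "'d \<Rightarrow> ('d \<Rightarrow> nat^'d::finite \<Rightarrow> complex) \<Rightarrow> 'd list \<Rightarrow> (nat^'d \<Rightarrow> complex) \<Rightarrow> nat^'d \<Rightarrow> complex" where
  "Top p \<pi> [] c = c"
| "Top p \<pi> (i # ws) c = (\<lambda>\<alpha>. cmul (\<pi> i) (theta p (length ws) (Top p \<pi> ws c)) \<alpha>
      + (if i = p then 0 else shiftd p i (Top p \<pi> ws c) \<alpha>))"

definition lead :: "('d \<Rightarrow> nat^'d::finite \<Rightarrow> complex) \<Rightarrow> 'd list \<Rightarrow> complex" where
  "lead \<pi> ws = prod_list (map (\<lambda>i. \<pi> i 0) ws)"

text \<open>The quotient n!/(n-j)!, taken over the complex numbers so that n < j is settled by a
  vanishing factor and not by truncated subtraction.\<close>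

definition ff :: "nat \<Rightarrow> nat \<Rightarrow> complex" where
  "ff j n = (\<Prod>i<j. of_nat n - of_nat i)"

lemma ff_Suc: "ff (Suc j) n = (of_nat n - of_nat j) * ff j n"
  by (simp add: ff_def)

lemma norm_diff_le_mult: "norm (of_nat n - of_nat j :: complex) \<le> (1 + real j) * (1 + real n)"
proof -
  have "norm (of_nat n - of_nat j :: complex) \<le> real n + real j"
    using norm_triangle_ineq4[of "of_nat n :: complex" "of_nat j"] by simp
  also have "\<dots> \<le> (1 + real j) * (1 + real n)" by (simp add: algebra_simps)
  finally show ?thesis .
qed

lemma norm_ff_le: "norm (ff j n) \<le> fact j * (1 + real n) ^ j"
proof (induction j)
  case (Suc j)
  have "norm (ff (Suc j) n) \<le> ((1 + real j) * (1 + real n)) * (fact j * (1 + real n) ^ j)"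
    unfolding ff_Suc norm_mult by (intro mult_mono norm_diff_le_mult Suc) auto
  then show ?case by (simp add: algebra_simps)
qed (simp add: ff_def)

lemma wbound_theta:
  assumes "0 < \<rho>" "wbound (wt p (Suc s) \<rho>) c B"
  shows "wbound (wt p s \<rho>) (theta p j c) ((1 + real j) * B)"
  unfolding theta_def
proof (rule wbound_diag[OF assms(2)])
  fix \<alpha> :: "nat^'a"
  show "norm (of_nat (\<alpha> $ p) - of_nat j :: complex) * wt p s \<rho> \<alpha> \<le> (1 + real j) * wt p (Suc s) \<rho> \<alpha>"
    using mult_right_mono[OF norm_diff_le_mult less_imp_le[OF wt_pos[OF assms(1)]], of "\<alpha> $ p" j p s \<alpha>]
    by (simp add: wt_Suc mult_ac)
qed simp

lemma wt_add: "wt p (s + j) \<rho> \<alpha> = (1 + real (\<alpha> $ p)) ^ j * wt p s \<rho> \<alpha>"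
  by (simp add: wt_def power_add)

lemma wbound_ff:
  assumes "0 < \<rho>" "wbound (wt p (s + j) \<rho>) c B"
  shows "wbound (wt p s \<rho>) (\<lambda>\<alpha>. ff j (\<alpha> $ p) * c \<alpha>) (fact j * B)"
proof (rule wbound_diag[OF assms(2)])
  fix \<alpha> :: "nat^'a"
  show "norm (ff j (\<alpha> $ p)) * wt p s \<rho> \<alpha> \<le> fact j * wt p (s + j) \<rho> \<alpha>"
    using mult_right_mono[OF norm_ff_le less_imp_le[OF wt_pos[OF assms(1)]], of j "\<alpha> $ p" p s \<alpha>]
    by (simp add: wt_add mult_ac)
qed simp

text \<open>A coefficient moves from exponent \<open>\<phi> \<alpha>\<close> to \<alpha>: the total
  degree m is kept and the exponent of x_p grows from n to n + 1, which yields the factor \<rho>.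
  The derivative factor \<open>\<alpha> $ i + 1\<close> is at most m - n and is absorbed by the
  ratio of the two binomial coefficients, at the price of n + 1, that is, of one power of the
  weight. The constant \<open>2 ^ s\<close> comes from n + 2 \<le> 2 (n + 1).\<close>

lemma wbound_shiftd:
  assumes \<rho>: "0 < \<rho>" and "i \<noteq> p" and c: "wbound (wt p (Suc s) \<rho>) c B"
  shows "wbound (wt p s \<rho>) (shiftd p i c) (2 ^ s * \<rho> * B)"
proof -
  define \<phi> where "\<phi> \<alpha> = \<alpha> - axis p 1 + axis i 1" for \<alpha> :: "nat^'a"
  let ?A = "{\<alpha> :: nat^'a. 1 \<le> \<alpha> $ p}"
  have inj: "inj_on \<phi> ?A"
  proof (rule inj_onI)
    fix \<alpha> \<beta> assume "\<alpha> \<in> ?A" "\<beta> \<in> ?A" "\<phi> \<alpha> = \<phi> \<beta>"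
    then have "\<alpha> - axis p 1 = \<beta> - axis p 1" by (simp add: \<phi>_def)
    then have "axis p 1 + (\<alpha> - axis p 1) = axis p 1 + (\<beta> - axis p 1)" by simp
    then show "\<alpha> = \<beta>" using axis_add_diff \<open>\<alpha> \<in> ?A\<close> \<open>\<beta> \<in> ?A\<close> by (metis mem_Collect_eq)
  qed
  have "wbound (wt p s \<rho>)
      (\<lambda>\<alpha>. if \<alpha> \<in> ?A then (of_nat (\<alpha> $ i) + 1) * c (\<phi> \<alpha>) else 0) (2 ^ s * \<rho> * B)"
  proof (rule wbound_reindex[OF c inj])
    fix \<alpha> assume "\<alpha> \<in> ?A"
    then obtain n where n: "\<alpha> $ p = Suc n" by (metis One_nat_def Suc_le_D mem_Collect_eq)
    have \<phi>p: "\<phi> \<alpha> $ p = n" using n \<open>i \<noteq> p\<close> by (simp add: \<phi>_def axis_def)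
    have "axis p 1 + \<phi> \<alpha> = \<alpha> + axis i 1"
      using axis_add_diff[of \<alpha> p] \<open>\<alpha> \<in> ?A\<close> by (simp add: \<phi>_def add.assoc[symmetric])
    then have "mdeg (axis p 1 + \<phi> \<alpha>) = mdeg (\<alpha> + axis i 1)" by simp
    then have \<phi>m: "mdeg (\<phi> \<alpha>) = mdeg \<alpha>" by simp
    define m where "m = mdeg \<alpha>"
    have le: "\<alpha> $ i + 1 \<le> m - n"
      using two_components_le_mdeg[OF \<open>i \<noteq> p\<close>, of \<alpha>] n by (simp add: m_def)
    then have nm: "Suc n \<le> m" by linarith
    let ?C = "real (m choose n)" and ?C' = "real (m choose Suc n)"
    have pos: "0 < ?C" "0 < ?C'" using nm by auto
    have "(m choose Suc n) * Suc n = (m choose n) * (m - n)"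
      using binomial_absorb_comp[of m n] binomial_absorption[of n "m"] nm
      by (metis Suc_diff_le Suc_times_binomial_add add.commute binomial_absorption diff_Suc_Suc le_add_diff_inverse2 mult.commute)
    then have "?C' * real (Suc n) = ?C * real (m - n)" by (metis of_nat_mult)
    then have "real (m - n) / ?C' = real (Suc n) / ?C" using pos by (simp add: field_simps)
    moreover have "real (\<alpha> $ i + 1) / ?C' \<le> real (m - n) / ?C'"
      using le by (intro divide_right_mono) (auto simp: of_nat_le_iff[symmetric] simp del: of_nat_le_iff)
    ultimately have A: "real (\<alpha> $ i + 1) / ?C' \<le> real (Suc n) / ?C" by simp
    have B: "(1 + real (Suc n)) ^ s \<le> 2 ^ s * (1 + real n) ^ s"
      unfolding power_mult_distrib[symmetric] by (intro power_mono) auto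
    have "(1 + real (Suc n)) ^ s * \<rho> ^ (Suc n + m) * (real (\<alpha> $ i + 1) / ?C')
        \<le> 2 ^ s * (1 + real n) ^ s * \<rho> ^ (Suc n + m) * (real (Suc n) / ?C)"
      using \<rho> by (intro mult_mono A B) auto
    moreover have "wt p s \<rho> \<alpha> = (1 + real (Suc n)) ^ s * \<rho> ^ (Suc n + m) / ?C'"
      by (simp add: wt_def n m_def)
    moreover have "wt p (Suc s) \<rho> (\<phi> \<alpha>) = (1 + real n) ^ s * real (Suc n) * \<rho> ^ (n + m) / ?C"
      by (simp add: wt_def \<phi>p \<phi>m m_def)
    moreover have "norm (of_nat (\<alpha> $ i) + 1 :: complex) = real (\<alpha> $ i + 1)"
      using norm_of_nat[of "\<alpha> $ i + 1", where ?'a = complex] by (simp add: add.commute)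
    ultimately show "norm (of_nat (\<alpha> $ i) + 1 :: complex) * wt p s \<rho> \<alpha> \<le> 2 ^ s * \<rho> * wt p (Suc s) \<rho> (\<phi> \<alpha>)"
      by (simp only: power_Suc add_Suc mult_ac times_divide_eq_left times_divide_eq_right)
  qed (use \<rho> in simp)
  then show ?thesis
    by (rule wbound_cong[rotated]) (simp add: shiftd_def \<phi>_def)
qed


lemma cmul_split_const: "cmul a X \<alpha> = cmul (\<lambda>\<alpha>. if \<alpha> = 0 then 0 else a \<alpha>) X \<alpha> + a 0 * X \<alpha>"
proof -
  have "cmul a X \<alpha> - cmul (\<lambda>\<alpha>. if \<alpha> = 0 then a 0 else 0) X \<alpha>
      = cmul (\<lambda>\<alpha>. a \<alpha> - (if \<alpha> = 0 then a 0 else 0)) X \<alpha>"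
    by (simp add: cmul_diff_left)
  also have "(\<lambda>\<alpha>. a \<alpha> - (if \<alpha> = 0 then a 0 else 0)) = (\<lambda>\<alpha>. if \<alpha> = 0 then 0 else a \<alpha>)"
    by auto
  finally show ?thesis by (simp add: cmul_const algebra_simps)
qed

lemma geo_drop_const: "geo a \<Longrightarrow> geo (\<lambda>\<alpha>. if \<alpha> = 0 then 0 else a \<alpha>)"
  unfolding geo_def by (smt (verit) norm_zero zero_le_mult_iff zero_le_power)

text \<open>Each letter adds a main part \<pi>_i(0) (t \<partial>_t - j) and three errors: the
  non-constant part of \<pi>_i, the error of the shorter word, and the tangential derivative. The
  quantifiers over \<open>c\<close> and \<open>B\<close> stand inside the filter so that one \<rho>
  serves all series. The power \<open>s\<close> varies in the induction because every letter costs
  one power of \<open>1 + \<alpha> $ p\<close>.\<close>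

lemma wbound_Top:
  fixes \<pi> :: "'d::finite \<Rightarrow> nat^'d \<Rightarrow> complex"
  assumes \<pi>: "\<And>i. geo (\<pi> i)" and "0 < \<epsilon>"
  shows "\<forall>\<^sub>F \<rho> in at_right 0. \<forall>c B. wbound (wt p (s + length ws) \<rho>) c B \<longrightarrow>
    wbound (wt p s \<rho>) (\<lambda>\<alpha>. Top p \<pi> ws c \<alpha> - lead \<pi> ws * ff (length ws) (\<alpha> $ p) * c \<alpha>) (\<epsilon> * B)"
  using \<open>0 < \<epsilon>\<close>
proof (induction ws arbitrary: s \<epsilon>)
  case Nil
  then have "0 \<le> \<epsilon> * B" if "wbound W c B" for W :: "nat^'d \<Rightarrow> real" and c B
    using wbound_nonneg[OF that] by simp
  then show ?case
    by (intro always_eventually) (auto simp: lead_def ff_def intro!: wbound_0)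
next
  case (Cons i ws)
  define j where "j = length ws"
  \<comment> \<open>\<open>D\<close> bounds the operator of the shorter word, error included (hence
    the cap 1 in \<open>\<epsilon>1\<close>). The other two constants are the accuracies for which
    each of the three errors costs at most \<open>\<epsilon> / 3\<close>.\<close>
  define D where "D = 1 + norm (lead \<pi> ws) * fact j"
  define \<epsilon>1 where "\<epsilon>1 = min 1 (\<epsilon> / (3 * (norm (\<pi> i 0) + 1) * (1 + real j)))"
  define \<eta> where "\<eta> = \<epsilon> / (3 * (1 + real j) * D)"
  have D: "0 < D" by (simp add: D_def add_pos_nonneg)
  have \<epsilon>1: "0 < \<epsilon>1" "\<epsilon>1 \<le> 1" and \<eta>: "0 < \<eta>"
    using Cons.prems D by (auto simp: \<epsilon>1_def \<eta>_def add_nonneg_pos)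
  define a where "a = (\<lambda>\<alpha>. if \<alpha> = 0 then 0 else \<pi> i \<alpha>)"
  have "\<forall>\<^sub>F \<rho> in at_right (0::real). 0 < \<rho> \<and> \<rho> \<le> \<epsilon> / (3 * 2 ^ s * D)"
    using Cons.prems D by (intro eventually_at_right_0I[of "\<epsilon> / (3 * 2 ^ s * D)"]) auto
  moreover have "\<forall>\<^sub>F \<rho> in at_right 0. wbound (wt p s \<rho>) a \<eta>"
    unfolding a_def using geo_drop_const[OF \<pi>] \<eta> by (intro geo_small) auto
  moreover note Cons.IH[OF \<epsilon>1(1), of "Suc s"]
  ultimately show ?case
  proof eventually_elim
    case (elim \<rho>)
    then have \<rho>: "0 < \<rho>" and \<rho>2: "\<rho> \<le> \<epsilon> / (3 * 2 ^ s * D)" by auto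
    note W = submult_wt[OF \<rho>, of p s] and W1 = submult_wt[OF \<rho>, of p "Suc s"]
    show ?case
    proof (intro allI impI)
      fix c B assume "wbound (wt p (s + length (i # ws)) \<rho>) c B"
      then have c: "wbound (wt p (Suc s + j) \<rho>) c B" by (simp add: j_def)
      have B: "0 \<le> B" using wbound_nonneg[OF c] .
      define H where "H = Top p \<pi> ws c"
      define E where "E = (\<lambda>\<alpha>. H \<alpha> - lead \<pi> ws * ff j (\<alpha> $ p) * c \<alpha>)"
      have E: "wbound (wt p (Suc s) \<rho>) E (\<epsilon>1 * B)"
        using elim(3) c by (auto simp: E_def H_def j_def)
      have "wbound (wt p (Suc s) \<rho>) (\<lambda>\<alpha>. E \<alpha> + lead \<pi> ws * (ff j (\<alpha> $ p) * c \<alpha>))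
          (\<epsilon>1 * B + norm (lead \<pi> ws) * (fact j * B))"
        by (intro wbound_add wbound_scale wbound_ff E \<rho> c submult_nonneg[OF W1])
      then have H1: "wbound (wt p (Suc s) \<rho>) H (\<epsilon>1 * B + norm (lead \<pi> ws) * (fact j * B))"
        by (rule wbound_cong[rotated]) (simp add: E_def)
      have "\<epsilon>1 * B + norm (lead \<pi> ws) * (fact j * B) \<le> D * B"
        using mult_right_mono[OF \<epsilon>1(2) B] by (simp add: D_def algebra_simps)
      with H1 have H: "wbound (wt p (Suc s) \<rho>) H (D * B)" by (rule wbound_mono)
      define X where "X = (\<lambda>\<alpha>. if i = p then 0 else shiftd p i H \<alpha>)"
      have X: "wbound (wt p s \<rho>) X (2 ^ s * \<rho> * (D * B))"
      proof (cases "i = p")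
        case True
        then show ?thesis using \<rho> B D by (auto simp: X_def intro!: wbound_0)
      next
        case False
        then show ?thesis using wbound_shiftd[OF \<rho> False H] by (simp add: X_def)
      qed
      have "wbound (wt p s \<rho>) (\<lambda>\<alpha>. cmul a (theta p j H) \<alpha> + \<pi> i 0 * theta p j E \<alpha> + X \<alpha>)
          (\<eta> * ((1 + real j) * (D * B)) + norm (\<pi> i 0) * ((1 + real j) * (\<epsilon>1 * B)) + 2 ^ s * \<rho> * (D * B))"
        by (intro wbound_add wbound_cmul wbound_scale wbound_theta W E H X \<rho> elim(2) submult_nonneg[OF W])
      then have main: "wbound (wt p s \<rho>) (\<lambda>\<alpha>. Top p \<pi> (i # ws) c \<alpha>
          - lead \<pi> (i # ws) * ff (length (i # ws)) (\<alpha> $ p) * c \<alpha>)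
          (\<eta> * ((1 + real j) * (D * B)) + norm (\<pi> i 0) * ((1 + real j) * (\<epsilon>1 * B)) + 2 ^ s * \<rho> * (D * B))"
      proof (rule wbound_cong[rotated])
        fix \<alpha>
        have "cmul (\<pi> i) (theta p j H) \<alpha> = cmul a (theta p j H) \<alpha> + \<pi> i 0 * theta p j H \<alpha>"
          unfolding a_def by (rule cmul_split_const)
        then show "cmul a (theta p j H) \<alpha> + \<pi> i 0 * theta p j E \<alpha> + X \<alpha> = Top p \<pi> (i # ws) c \<alpha>
            - lead \<pi> (i # ws) * ff (length (i # ws)) (\<alpha> $ p) * c \<alpha>"
          by (simp add: H_def[symmetric] j_def[symmetric] X_def ff_Suc)
            (simp add: E_def theta_def lead_def algebra_simps)
      qed
      have 1: "\<eta> * ((1 + real j) * (D * B)) = \<epsilon> / 3 * B"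
      proof -
        have "\<eta> * ((1 + real j) * D) = \<epsilon> / 3"
          unfolding \<eta>_def using D by (simp add: divide_simps)
        then show ?thesis by (simp add: mult.assoc[symmetric])
      qed
      have 2: "norm (\<pi> i 0) * ((1 + real j) * (\<epsilon>1 * B)) \<le> \<epsilon> / 3 * B"
      proof -
        have "norm (\<pi> i 0) * ((1 + real j) * \<epsilon>1) \<le> (norm (\<pi> i 0) + 1) * ((1 + real j) * \<epsilon>1)"
          using \<epsilon>1 by (intro mult_right_mono) auto
        also have "\<dots> \<le> (norm (\<pi> i 0) + 1) * ((1 + real j) * (\<epsilon> / (3 * (norm (\<pi> i 0) + 1) * (1 + real j))))"
          by (intro mult_left_mono) (auto simp: \<epsilon>1_def add_nonneg_pos)
        also have "\<dots> = \<epsilon> / 3"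
        proof -
          have *: "x * (y * (\<epsilon> / (3 * x * y))) = \<epsilon> / 3" if "0 < x" "0 < y" for x y using that by simp
          show ?thesis by (rule *) (simp_all add: add_nonneg_pos)
        qed
        finally have "norm (\<pi> i 0) * ((1 + real j) * \<epsilon>1) \<le> \<epsilon> / 3" .
        from mult_right_mono[OF this B] show ?thesis by (simp only: mult.assoc)
      qed
      have 3: "2 ^ s * \<rho> * (D * B) \<le> \<epsilon> / 3 * B"
      proof -
        have "2 ^ s * \<rho> * D \<le> \<epsilon> / 3" using \<rho>2 D by (simp add: field_simps)
        from mult_right_mono[OF this B] show ?thesis by (simp add: mult.assoc)
      qed
      show "wbound (wt p s \<rho>) (\<lambda>\<alpha>. Top p \<pi> (i # ws) c \<alpha>
          - lead \<pi> (i # ws) * ff (length (i # ws)) (\<alpha> $ p) * c \<alpha>) (\<epsilon> * B)"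
        by (rule wbound_mono[OF main]) (use 1 2 3 in \<open>simp add: field_simps\<close>)
    qed
  qed
qed

lemma wbound_cmul_Top:
  fixes \<pi> :: "'d::finite \<Rightarrow> nat^'d \<Rightarrow> complex"
  assumes \<pi>: "\<And>i. geo (\<pi> i)" and a: "geo a" and "0 < \<epsilon>" and k: "length ws \<le> k"
  shows "\<forall>\<^sub>F \<rho> in at_right 0. \<forall>c B. wbound (wt p k \<rho>) c B \<longrightarrow>
    wbound (wt p 0 \<rho>) (\<lambda>\<alpha>. cmul a (Top p \<pi> ws c) \<alpha> - a 0 * lead \<pi> ws * ff (length ws) (\<alpha> $ p) * c \<alpha>) (\<epsilon> * B)"
proof -
  define j where "j = length ws"
  define L where "L = norm (lead \<pi> ws) * fact j + 1"
  have L: "0 < L" by (simp add: L_def add_nonneg_pos)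
  \<comment> \<open>The bound must hold for all small \<rho>, since the accuracy
    \<open>\<epsilon> / 2 / A\<close> demanded of the word is chosen before \<rho>.\<close>
  obtain A where A: "0 < A" "\<forall>\<^sub>F \<rho> in at_right 0. wbound (wt p 0 \<rho>) a A"
    using geo_bounded[OF a] by metis
  define b where "b = (\<lambda>\<alpha>. if \<alpha> = 0 then 0 else a \<alpha>)"
  have "\<forall>\<^sub>F \<rho> in at_right 0. wbound (wt p 0 \<rho>) b (\<epsilon> / 2 / L)"
    unfolding b_def using geo_drop_const[OF a] assms L by (intro geo_small) auto
  moreover have "\<forall>\<^sub>F \<rho> in at_right (0::real). 0 < \<rho>" by (rule eventually_at_right_0I[of 1]) auto
  moreover have "0 < \<epsilon> / 2 / A" using A assms by simp
  note wbound_Top[where \<pi> = \<pi> and s = 0 and p = p and ws = ws, OF \<pi> this]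
  moreover note A(2)
  ultimately show ?thesis
  proof eventually_elim
    case (elim \<rho>)
    then have \<rho>: "0 < \<rho>" by auto
    note W = submult_wt[OF \<rho>, of p 0]
    show ?case
    proof (intro allI impI)
      fix c B assume c: "wbound (wt p k \<rho>) c B"
      have B: "0 \<le> B" using wbound_nonneg[OF c] .
      have cj: "wbound (wt p (0 + j) \<rho>) c B"
        using c by (rule wbound_weight_mono) (use k \<rho> in \<open>auto simp: j_def intro: wt_mono\<close>)
      define E where "E = (\<lambda>\<alpha>. Top p \<pi> ws c \<alpha> - lead \<pi> ws * ff j (\<alpha> $ p) * c \<alpha>)"
      have E: "wbound (wt p 0 \<rho>) E (\<epsilon> / 2 / A * B)"
        using elim(3) cj by (auto simp: E_def j_def)
      define Y where "Y = (\<lambda>\<alpha>. lead \<pi> ws * (ff j (\<alpha> $ p) * c \<alpha>))"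
      have Y: "wbound (wt p 0 \<rho>) Y (norm (lead \<pi> ws) * (fact j * B))"
        unfolding Y_def by (intro wbound_scale wbound_ff cj \<rho>)
      have "norm (lead \<pi> ws) * (fact j * B) \<le> L * B" using B by (simp add: L_def algebra_simps)
      with Y have Y: "wbound (wt p 0 \<rho>) Y (L * B)" by (rule wbound_mono)
      \<comment> \<open>With \<open>Top\<close> = \<open>E\<close> + \<open>Y\<close>, subtracting
        \<open>a 0 * Y\<close> from the product by \<open>a\<close> leaves a E + b Y: in the first
        term the operand is small, in the second the coefficient.\<close>
      have "wbound (wt p 0 \<rho>) (\<lambda>\<alpha>. cmul a E \<alpha> + cmul b Y \<alpha>)
          (A * (\<epsilon> / 2 / A * B) + \<epsilon> / 2 / L * (L * B))"
        by (intro wbound_add wbound_cmul W E Y elim submult_nonneg[OF W])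
      moreover have "A * (\<epsilon> / 2 / A * B) + \<epsilon> / 2 / L * (L * B) = \<epsilon> * B"
        using A L by (simp add: field_simps)
      ultimately have *: "wbound (wt p 0 \<rho>) (\<lambda>\<alpha>. cmul a E \<alpha> + cmul b Y \<alpha>) (\<epsilon> * B)" by simp
      show "wbound (wt p 0 \<rho>) (\<lambda>\<alpha>. cmul a (Top p \<pi> ws c) \<alpha>
          - a 0 * lead \<pi> ws * ff (length ws) (\<alpha> $ p) * c \<alpha>) (\<epsilon> * B)"
        using *
      proof (rule wbound_cong[rotated])
        fix \<alpha>
        have "E = (\<lambda>\<alpha>. Top p \<pi> ws c \<alpha> - Y \<alpha>)" by (simp add: E_def Y_def mult.assoc)
        then have "cmul a E \<alpha> = cmul a (Top p \<pi> ws c) \<alpha> - cmul a Y \<alpha>" by (simp add: cmul_diff_right)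
        moreover have "cmul a Y \<alpha> = cmul b Y \<alpha> + a 0 * Y \<alpha>" unfolding b_def by (rule cmul_split_const)
        ultimately show "cmul a E \<alpha> + cmul b Y \<alpha> = cmul a (Top p \<pi> ws c) \<alpha>
            - a 0 * lead \<pi> ws * ff (length ws) (\<alpha> $ p) * c \<alpha>"
          by (simp add: Y_def j_def mult.assoc)
      qed
    qed
  qed
qed

section \<open>Linearity, the complete operator and its symbol\<close>

lemma cmul_uminus_add: "cmul a (\<lambda>\<alpha>. c \<alpha> - d \<alpha>) = (\<lambda>\<alpha>. cmul a c \<alpha> - cmul a d \<alpha>)"
  by (simp add: fun_eq_iff cmul_diff_right)

lemma Top_diff: "Top p \<pi> ws (\<lambda>\<alpha>. c \<alpha> - d \<alpha>) = (\<lambda>\<alpha>. Top p \<pi> ws c \<alpha> - Top p \<pi> ws d \<alpha>)"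
proof (induction ws)
  case (Cons i ws)
  have "theta p j (\<lambda>\<alpha>. c \<alpha> - d \<alpha>) = (\<lambda>\<alpha>. theta p j c \<alpha> - theta p j d \<alpha>)" for j c d
    by (simp add: fun_eq_iff theta_def algebra_simps)
  moreover have "shiftd p i (\<lambda>\<alpha>. c \<alpha> - d \<alpha>) = (\<lambda>\<alpha>. shiftd p i c \<alpha> - shiftd p i d \<alpha>)" for c d
    by (simp add: fun_eq_iff shiftd_def algebra_simps)
  ultimately show ?case by (intro ext) (simp add: Cons.IH cmul_uminus_add)
qed simp

text \<open>The left-hand side of the system in the new coordinates, where the power t^j is already
  distributed over the derivatives inside \<open>Top\<close>; \<open>A j \<mu>\<close> is meant to
  be the series of the transformed coefficient \<open>a j \<mu>\<close>.\<close>

definition Lop :: "nat \<Rightarrow> 'd \<Rightarrow> ('d \<Rightarrow> nat^'d \<Rightarrow> complex) \<Rightarrow> (nat \<Rightarrow> nat^'d \<Rightarrow> nat^'d \<Rightarrow> complex) \<Rightarrow>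
    'd list \<Rightarrow> (nat^'d::finite \<Rightarrow> complex) \<Rightarrow> nat^'d \<Rightarrow> complex" where
  "Lop k p \<pi> A xs c \<alpha> = (\<Sum>j=1..k. \<Sum>\<mu> | mdeg \<mu> = j. cmul (A j \<mu>) (Top p \<pi> (letters xs \<mu>) c) \<alpha>)"

text \<open>The scalar in the nonresonance condition, once \<open>lead\<close> is a monomial in the
  gradient of P at 0. It depends on an exponent only through its p-th entry.\<close>

definition symb :: "nat \<Rightarrow> ('d \<Rightarrow> nat^'d \<Rightarrow> complex) \<Rightarrow> (nat \<Rightarrow> nat^'d \<Rightarrow> nat^'d \<Rightarrow> complex) \<Rightarrow>
    'd::finite list \<Rightarrow> nat \<Rightarrow> complex" where
  "symb k \<pi> A xs n = (\<Sum>j=1..k. ff j n * (\<Sum>\<mu> | mdeg \<mu> = j. A j \<mu> 0 * lead \<pi> (letters xs \<mu>)))"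

lemma Lop_diff: "Lop k p \<pi> A xs (\<lambda>\<alpha>. c \<alpha> - d \<alpha>) \<alpha> = Lop k p \<pi> A xs c \<alpha> - Lop k p \<pi> A xs d \<alpha>"
  by (simp add: Lop_def Top_diff cmul_diff_right sum_subtractf)

lemma wbound_Lop:
  fixes \<pi> :: "'d::finite \<Rightarrow> nat^'d \<Rightarrow> complex"
  assumes \<pi>: "\<And>i. geo (\<pi> i)" and A: "\<And>j \<mu>. 1 \<le> j \<Longrightarrow> j \<le> k \<Longrightarrow> mdeg \<mu> = j \<Longrightarrow> geo (A j \<mu>)"
    and xs: "distinct xs" "set xs = UNIV" and "0 < \<epsilon>"
  shows "\<forall>\<^sub>F \<rho> in at_right 0. \<forall>c B. wbound (wt p k \<rho>) c B \<longrightarrow>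
    wbound (wt p 0 \<rho>) (\<lambda>\<alpha>. Lop k p \<pi> A xs c \<alpha> - symb k \<pi> A xs (\<alpha> $ p) * c \<alpha>) (\<epsilon> * B)"
proof -
  define I where "I = (SIGMA j:{1..k}. {\<mu> :: nat^'d. mdeg \<mu> = j})"
  have I: "finite I" unfolding I_def using finite_mdeg by auto
  define t where "t q c \<alpha> = cmul (A (fst q) (snd q)) (Top p \<pi> (letters xs (snd q)) c) \<alpha>
    - A (fst q) (snd q) 0 * lead \<pi> (letters xs (snd q)) * ff (fst q) (\<alpha> $ p) * c \<alpha>" for q c \<alpha>
  define \<epsilon>' where "\<epsilon>' = \<epsilon> / (1 + real (card I))"
  have \<epsilon>': "0 < \<epsilon>'" using assms by (simp add: \<epsilon>'_def add_pos_nonneg)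
  have "\<forall>\<^sub>F \<rho> in at_right 0. \<forall>q\<in>I. \<forall>c B. wbound (wt p k \<rho>) c B \<longrightarrow> wbound (wt p 0 \<rho>) (t q c) (\<epsilon>' * B)"
  proof (rule eventually_ball_finite[OF I], safe)
    fix j \<mu> assume "(j, \<mu>) \<in> I"
    then have j: "1 \<le> j" "j \<le> k" "mdeg \<mu> = j" by (auto simp: I_def)
    have "length (letters xs \<mu>) = j" using length_letters[OF xs, of \<mu>] j by simp
    then show "\<forall>\<^sub>F \<rho> in at_right 0. \<forall>c B. wbound (wt p k \<rho>) c B \<longrightarrow> wbound (wt p 0 \<rho>) (t (j, \<mu>) c) (\<epsilon>' * B)"
      using wbound_cmul_Top[where \<pi> = \<pi>, OF \<pi> A[OF j] \<epsilon>', of "letters xs \<mu>" k p] j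
      by (simp add: t_def[abs_def])
  qed
  moreover have "\<forall>\<^sub>F \<rho> in at_right (0::real). 0 < \<rho>" by (rule eventually_at_right_0I[of 1]) auto
  ultimately show ?thesis
  proof eventually_elim
    case (elim \<rho>)
    show ?case
    proof (intro allI impI)
      fix c B assume c: "wbound (wt p k \<rho>) c B"
      have B: "0 \<le> B" using wbound_nonneg[OF c] .
      have "wbound (wt p 0 \<rho>) (\<lambda>\<alpha>. \<Sum>q\<in>I. t q c \<alpha>) (\<Sum>q\<in>I. \<epsilon>' * B)"
        using elim c I submult_nonneg[OF submult_wt] by (intro wbound_sum) auto
      moreover have "(\<Sum>q\<in>I. \<epsilon>' * B) \<le> \<epsilon> * B"
      proof -
        have "real (card I) * \<epsilon>' \<le> \<epsilon>" using assms(5) by (simp add: \<epsilon>'_def divide_simps algebra_simps)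
        from mult_right_mono[OF this B] show ?thesis by (simp add: mult.assoc)
      qed
      ultimately have *: "wbound (wt p 0 \<rho>) (\<lambda>\<alpha>. \<Sum>q\<in>I. t q c \<alpha>) (\<epsilon> * B)" by (rule wbound_mono)
      show "wbound (wt p 0 \<rho>) (\<lambda>\<alpha>. Lop k p \<pi> A xs c \<alpha> - symb k \<pi> A xs (\<alpha> $ p) * c \<alpha>) (\<epsilon> * B)"
        using *
      proof (rule wbound_cong[rotated])
        fix \<alpha>
        have "(\<Sum>q\<in>I. t q c \<alpha>) = (\<Sum>j=1..k. \<Sum>\<mu> | mdeg \<mu> = j. t (j, \<mu>) c \<alpha>)"
          unfolding I_def by (subst sum.Sigma) (auto simp: finite_mdeg)
        then show "(\<Sum>q\<in>I. t q c \<alpha>) = Lop k p \<pi> A xs c \<alpha> - symb k \<pi> A xs (\<alpha> $ p) * c \<alpha>"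
          by (simp add: Lop_def symb_def t_def sum_subtractf sum_distrib_left sum_distrib_right mult_ac)
      qed
    qed
  qed
qed


subsection \<open>Contractions\<close>

text \<open>Starting from the crude bound 2 R for the difference, each application of
  \<open>contr\<close> halves it; so it vanishes.\<close>

lemma contraction_unique:
  fixes Y Y' :: "'m \<Rightarrow> 'a \<Rightarrow> complex"
  assumes W: "\<And>\<alpha>. 0 < W \<alpha>" and Y: "\<And>l. wbound W (Y l) R" and Y': "\<And>l. wbound W (Y' l) R"
    and contr: "\<And>\<delta>. (\<And>l. wbound W (\<lambda>\<alpha>. Y l \<alpha> - Y' l \<alpha>) \<delta>) \<Longrightarrow>
        (\<And>l. wbound W (\<lambda>\<alpha>. Y l \<alpha> - Y' l \<alpha>) (\<delta> / 2))"
  shows "Y = Y'"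
proof (intro ext)
  fix l \<alpha>
  have "wbound W (\<lambda>\<alpha>. Y l \<alpha> - Y' l \<alpha>) (2 * R / 2 ^ n)" for n l
  proof (induction n arbitrary: l)
    case 0
    then show ?case using wbound_diff[OF Y Y' less_imp_le[OF W]] by simp
  next
    case (Suc n)
    then show ?case using contr[of "2 * R / 2 ^ n"] by (simp add: mult.commute)
  qed
  then have le: "norm (Y l \<alpha> - Y' l \<alpha>) * W \<alpha> \<le> 2 * R / 2 ^ n" for n
    by (rule wbound_point)
  have "(\<lambda>n. 2 * R / 2 ^ n) \<longlonglongrightarrow> 0" by (rule LIMSEQ_divide_realpow_zero) simp
  then have "norm (Y l \<alpha> - Y' l \<alpha>) * W \<alpha> \<le> 0"
    using le by (intro LIMSEQ_le_const) auto
  then show "Y l \<alpha> = Y' l \<alpha>" using W[of \<alpha>] by (simp add: mult_le_0_iff)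
qed

text \<open>Banach's fixed point theorem carried out on coefficients. The exponent \<open>z\<close>
  marks the coefficient kept at 0 during the iteration, since substitution is only controlled for
  series without constant term.\<close>

lemma contraction_exists:
  fixes G :: "('m \<Rightarrow> 'a \<Rightarrow> complex) \<Rightarrow> 'm \<Rightarrow> 'a \<Rightarrow> complex"
  assumes W: "\<And>\<alpha>. 0 < W \<alpha>"
    and G0: "\<And>l. wbound W (G (\<lambda>l \<alpha>. 0) l) (R / 2)"
    and Gz: "\<And>Y l. (\<And>l. Y l z = 0) \<Longrightarrow> G Y l z = 0"
    and contr: "\<And>Y Y' \<delta> l. (\<And>l. Y l z = 0) \<Longrightarrow> (\<And>l. Y' l z = 0) \<Longrightarrow>
      (\<And>l. wbound W (Y l) R) \<Longrightarrow> (\<And>l. wbound W (Y' l) R) \<Longrightarrow>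
      (\<And>l. wbound W (\<lambda>\<alpha>. Y l \<alpha> - Y' l \<alpha>) \<delta>) \<Longrightarrow> wbound W (\<lambda>\<alpha>. G Y l \<alpha> - G Y' l \<alpha>) (\<delta> / 2)"
  shows "\<exists>Y. (\<forall>l. Y l z = 0 \<and> wbound W (Y l) R) \<and> G Y = Y"
proof -
  have W0: "0 \<le> W \<alpha>" for \<alpha> using W less_imp_le by blast
  define Y where "Y n = (G ^^ n) (\<lambda>l \<alpha>. 0)" for n
  have Y0: "Y 0 = (\<lambda>l \<alpha>. 0)" and YS: "Y (Suc n) = G (Y n)" for n by (simp_all add: Y_def)
  have R: "0 \<le> R" using wbound_nonneg[OF G0] by simp
  have Yz: "Y n l z = 0" for n l by (induction n arbitrary: l) (auto simp: Y0 YS Gz)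
  \<comment> \<open>The first step is at most R/2 and later ones are halved, so the n-th iterate
    keeps the margin \<open>R / 2 ^ n\<close> inside the ball and \<open>contr\<close> stays
    applicable.\<close>
  have step: "(\<forall>l. wbound W (\<lambda>\<alpha>. Y (Suc n) l \<alpha> - Y n l \<alpha>) (R / 2 ^ Suc n)) \<and>
      (\<forall>l. wbound W (Y n l) (R - R / 2 ^ n)) \<and> (\<forall>l. wbound W (Y (Suc n) l) (R - R / 2 ^ Suc n))" for n
  proof (induction n)
    case 0
    then show ?case using G0 by (simp add: Y0 YS wbound_0)
  next
    case (Suc n)
    have ball: "wbound W (Y n l) R" "wbound W (Y (Suc n) l) R" for l
      using Suc R by (auto intro: wbound_mono)
    have d: "wbound W (\<lambda>\<alpha>. Y (Suc (Suc n)) l \<alpha> - Y (Suc n) l \<alpha>) (R / 2 ^ Suc (Suc n))" for l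
    proof -
      have "wbound W (\<lambda>\<alpha>. G (Y (Suc n)) l \<alpha> - G (Y n) l \<alpha>) (R / 2 ^ Suc n / 2)"
        using Suc ball by (intro contr Yz) auto
      then show ?thesis by (simp add: YS[of n, symmetric] YS[of "Suc n", symmetric] mult.commute)
    qed
    have "wbound W (\<lambda>\<alpha>. (Y (Suc (Suc n)) l \<alpha> - Y (Suc n) l \<alpha>) + Y (Suc n) l \<alpha>)
        (R / 2 ^ Suc (Suc n) + (R - R / 2 ^ Suc n))" for l
      using d Suc by (intro wbound_add W0) auto
    then have "wbound W (Y (Suc (Suc n)) l) (R - R / 2 ^ Suc (Suc n))" for l
      by (rule wbound_cong[rotated, THEN wbound_mono]) (auto simp: field_simps)
    then show ?case using d Suc by blast
  qed
  have ball: "wbound W (Y n l) R" for n l using step[of n] R by (auto intro: wbound_mono)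
  have tail: "wbound W (\<lambda>\<alpha>. Y (n + i) l \<alpha> - Y n l \<alpha>) (R / 2 ^ n - R / 2 ^ (n + i))" for n i l
  proof (induction i)
    case 0
    then show ?case by (simp add: wbound_0)
  next
    case (Suc i)
    have "wbound W (\<lambda>\<alpha>. (Y (Suc (n + i)) l \<alpha> - Y (n + i) l \<alpha>) + (Y (n + i) l \<alpha> - Y n l \<alpha>))
        (R / 2 ^ Suc (n + i) + (R / 2 ^ n - R / 2 ^ (n + i)))"
      using Suc step[of "n + i"] by (intro wbound_add W0) auto
    then show ?case by (rule wbound_cong[rotated, THEN wbound_mono]) (auto simp: field_simps)
  qed
  have conv: "convergent (\<lambda>n. Y n l \<alpha>)" for l \<alpha>
  proof (rule Cauchy_convergent, rule CauchyI')
    fix e :: real assume "0 < e"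
    have "(\<lambda>n. R / 2 ^ n) \<longlonglongrightarrow> 0" by (rule LIMSEQ_divide_realpow_zero) simp
    moreover have "0 < e * W \<alpha>" using \<open>0 < e\<close> W by simp
    ultimately have "\<forall>\<^sub>F n in sequentially. R / 2 ^ n < e * W \<alpha>" by (rule order_tendstoD(2))
    then obtain N where N: "\<And>n. n \<ge> N \<Longrightarrow> R / 2 ^ n < e * W \<alpha>"
      unfolding eventually_sequentially by blast
    have "dist (Y m l \<alpha>) (Y n l \<alpha>) < e" if "N \<le> m" "m < n" for m n
    proof -
      obtain i where i: "n = m + i" using le_Suc_ex[OF less_imp_le[OF \<open>m < n\<close>]] by blast
      have "wbound W (\<lambda>\<alpha>. Y n l \<alpha> - Y m l \<alpha>) (R / 2 ^ m - R / 2 ^ n)"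
        unfolding i by (rule tail)
      then have "norm (Y n l \<alpha> - Y m l \<alpha>) * W \<alpha> \<le> R / 2 ^ m - R / 2 ^ n"
        by (rule wbound_point)
      also have "\<dots> \<le> R / 2 ^ m" using R by simp
      also have "\<dots> < e * W \<alpha>" using N[OF that(1)] .
      finally have "norm (Y n l \<alpha> - Y m l \<alpha>) < e" using W[of \<alpha>] mult_less_cancel_right_pos by blast
      then show ?thesis by (simp add: dist_norm norm_minus_commute)
    qed
    then show "\<exists>M. \<forall>m\<ge>M. \<forall>n>m. dist (Y m l \<alpha>) (Y n l \<alpha>) < e" by blast
  qed
  define V where "V l \<alpha> = lim (\<lambda>n. Y n l \<alpha>)" for l \<alpha>
  have lim: "(\<lambda>n. Y n l \<alpha>) \<longlonglongrightarrow> V l \<alpha>" for l \<alpha>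
    using conv unfolding V_def by (simp add: convergent_LIMSEQ_iff)
  \<comment> \<open>Coefficientwise limits suffice: every finite partial sum is continuous in
    finitely many coefficients, so the bound passes to the limit, and this replaces completeness of
    the weighted space.\<close>
  have limit: "wbound W (\<lambda>\<alpha>. V l \<alpha> - d \<alpha>) B"
    if "\<And>i. i \<ge> N \<Longrightarrow> wbound W (\<lambda>\<alpha>. Y i l \<alpha> - d \<alpha>) B" for l d B N
  proof (rule wboundI)
    fix S :: "'a set" assume S: "finite S"
    have "(\<lambda>i. \<Sum>\<alpha>\<in>S. norm (Y i l \<alpha> - d \<alpha>) * W \<alpha>) \<longlonglongrightarrow> (\<Sum>\<alpha>\<in>S. norm (V l \<alpha> - d \<alpha>) * W \<alpha>)"
      by (intro tendsto_intros lim)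
    then show "(\<Sum>\<alpha>\<in>S. norm (V l \<alpha> - d \<alpha>) * W \<alpha>) \<le> B"
      using that S by (intro LIMSEQ_le_const2) (auto intro!: exI[of _ N] wboundD)
  qed
  have VY: "wbound W (\<lambda>\<alpha>. V l \<alpha> - Y n l \<alpha>) (R / 2 ^ n)" for n l
  proof (rule limit[of n])
    fix i assume "n \<le> i"
    then obtain j where "i = n + j" using le_Suc_ex by blast
    then show "wbound W (\<lambda>\<alpha>. Y i l \<alpha> - Y n l \<alpha>) (R / 2 ^ n)"
      using tail[of n j l] R by (auto intro: wbound_mono)
  qed
  have VR: "wbound W (V l) R" for l using limit[of 0 l "\<lambda>_. 0" R] ball by simp
  have Vz: "V l z = 0" for l using LIMSEQ_unique[OF lim[of l z]] Yz by simp
  have "wbound W (\<lambda>\<alpha>. G V l \<alpha> - V l \<alpha>) (R / 2 ^ n)" for n l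
  proof -
    have "wbound W (\<lambda>\<alpha>. G V l \<alpha> - G (Y n) l \<alpha>) (R / 2 ^ n / 2)"
      by (intro contr Vz Yz VR ball VY)
    from wbound_diff[OF this VY[of l "Suc n"] W0]
    have "wbound W (\<lambda>\<alpha>. G V l \<alpha> - G (Y n) l \<alpha> - (V l \<alpha> - G (Y n) l \<alpha>)) (R / 2 ^ n / 2 + R / 2 ^ Suc n)"
      by (simp add: YS)
    then show ?thesis by (rule wbound_cong[rotated, THEN wbound_mono]) (auto simp: field_simps)
  qed
  then have le: "norm (G V l \<alpha> - V l \<alpha>) * W \<alpha> \<le> R / 2 ^ n" for n l \<alpha> by (rule wbound_point)
  have "G V l \<alpha> = V l \<alpha>" for l \<alpha>
  proof -
    have "(\<lambda>n. R / 2 ^ n) \<longlonglongrightarrow> 0" by (rule LIMSEQ_divide_realpow_zero) simp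
    then have "norm (G V l \<alpha> - V l \<alpha>) * W \<alpha> \<le> 0" using le by (intro LIMSEQ_le_const) auto
    then show ?thesis using W[of \<alpha>] by (simp add: mult_le_0_iff)
  qed
  then show ?thesis using Vz VR by blast
qed


subsection \<open>Unique formal solvability in the straightened coordinates\<close>

lemma ff_ratio_tendsto:
  assumes "1 \<le> j" "j \<le> k"
  shows "(\<lambda>n. ff j n / (1 + of_nat n) ^ k) \<longlonglongrightarrow> (if j = k then 1 else 0)"
proof -
  have inv: "(\<lambda>n. 1 / (1 + of_nat n :: complex)) \<longlonglongrightarrow> 0"
    using LIMSEQ_Suc[OF lim_1_over_n[where 'a = complex]] by simp
  have nz: "1 + of_nat n \<noteq> (0 :: complex)" for n
    by (metis of_nat_Suc of_nat_eq_0_iff old.nat.distinct(2))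
  have "(\<lambda>n. (of_nat n - of_nat i) / (1 + of_nat n) :: complex) \<longlonglongrightarrow> 1" for i
  proof -
    have "(\<lambda>n. 1 - (1 + of_nat i) * (1 / (1 + of_nat n)) :: complex) \<longlonglongrightarrow> 1 - (1 + of_nat i) * 0"
      by (intro tendsto_intros inv)
    moreover have "1 - (1 + of_nat i) * (1 / (1 + of_nat n)) = (of_nat n - of_nat i) / (1 + of_nat n :: complex)" for n
      using nz[of n] by (simp add: field_simps)
    ultimately show ?thesis by simp
  qed
  then have "(\<lambda>n. \<Prod>i<j. (of_nat n - of_nat i) / (1 + of_nat n) :: complex) \<longlonglongrightarrow> (\<Prod>i<j. 1)"
    by (intro tendsto_prod) auto
  then have top: "(\<lambda>n. ff j n / (1 + of_nat n) ^ j) \<longlonglongrightarrow> 1"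
    by (simp add: ff_def prod_dividef)
  have "(\<lambda>n. ff j n / (1 + of_nat n) ^ j * (1 / (1 + of_nat n)) ^ (k - j)) \<longlonglongrightarrow> 1 * 0 ^ (k - j)"
    by (intro tendsto_intros top inv)
  moreover have "ff j n / (1 + of_nat n) ^ j * (1 / (1 + of_nat n)) ^ (k - j) = ff j n / (1 + of_nat n) ^ k" for n
    using assms by (simp add: power_one_over power_add[symmetric])
  moreover have "(0::complex) ^ (k - j) = (if j = k then 1 else 0)" using assms by auto
  ultimately show ?thesis by simp
qed

text \<open>The number assumed nonzero is the coefficient of n^k in the symbol, so after division by
  (1 + n)^k all lower terms disappear in the limit.\<close>

lemma symb_lower_bound:
  assumes k: "1 \<le> k" and nz: "(\<Sum>\<mu> | mdeg \<mu> = k. A k \<mu> 0 * lead \<pi> (letters xs \<mu>)) \<noteq> 0"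
  obtains c where "0 < c" "\<forall>\<^sub>F n in sequentially. c * (1 + real n) ^ k \<le> norm (symb k \<pi> A xs n)"
proof -
  define b where "b j = (\<Sum>\<mu> | mdeg \<mu> = j. A j \<mu> 0 * lead \<pi> (letters xs \<mu>))" for j
  have "(\<lambda>n. \<Sum>j=1..k. ff j n / (1 + of_nat n) ^ k * b j) \<longlonglongrightarrow> (\<Sum>j=1..k. (if j = k then 1 else 0) * b j)"
    by (intro tendsto_intros ff_ratio_tendsto) auto
  moreover have "(\<Sum>j=1..k. (if j = k then 1 else 0) * b j) = b k"
    using k by (subst sum.mono_neutral_right[of _ "{k}"]) auto
  moreover have "(\<Sum>j=1..k. ff j n / (1 + of_nat n) ^ k * b j) = symb k \<pi> A xs n / (1 + of_nat n) ^ k" for n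
    by (simp add: symb_def b_def sum_divide_distrib)
  ultimately have "(\<lambda>n. norm (symb k \<pi> A xs n / (1 + of_nat n) ^ k)) \<longlonglongrightarrow> norm (b k)"
    by (auto intro: tendsto_norm)
  moreover have "norm (b k) / 2 < norm (b k)" using nz by (simp add: b_def)
  ultimately have "\<forall>\<^sub>F n in sequentially. norm (b k) / 2 < norm (symb k \<pi> A xs n / (1 + of_nat n) ^ k)"
    by (rule order_tendstoD(1))
  then have "\<forall>\<^sub>F n in sequentially. norm (b k) / 2 * (1 + real n) ^ k \<le> norm (symb k \<pi> A xs n)"
  proof eventually_elim
    case (elim n)
    have "norm (1 + of_nat n :: complex) = 1 + real n"
      using norm_of_nat[of "Suc n", where ?'a = complex] by simp
    then have "norm (symb k \<pi> A xs n / (1 + of_nat n) ^ k) = norm (symb k \<pi> A xs n) / (1 + real n) ^ k"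
      by (simp add: norm_divide norm_power)
    moreover have "0 < (1 + real n) ^ k" by (simp add: add_pos_nonneg)
    ultimately show ?case using elim by (simp add: pos_less_divide_eq)
  qed
  then show ?thesis using nz by (intro that[of "norm (b k) / 2"]) (auto simp: b_def)
qed

text \<open>For large n the scalar \<open>q n\<close> dominates \<open>J\<close>, and for the
  finitely many remaining n invertibility alone gives a bound.\<close>

lemma resolvent_bound:
  fixes J :: "complex^'m::finite^'m"
  assumes inv: "\<And>n. invertible (mat (q n) - J)" and k: "1 \<le> k"
    and c: "0 < c" "\<forall>\<^sub>F n in sequentially. c * (1 + real n) ^ k \<le> norm (q n)"
  obtains K where "0 < K"
    "\<And>n l l'. norm (matrix_inv (mat (q n) - J) $ l $ l') * (1 + real n) ^ k \<le> K"
proof -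
  define B where "B n = matrix_inv (mat (q n) - J)" for n
  have MB: "(mat (q n) - J) ** B n = mat 1" for n
    unfolding B_def using inv[of n] by (simp add: invertible_def matrix_inv_def) (metis (mono_tags, lifting) someI_ex)
  define S where "S n l' = (\<Sum>l\<in>UNIV. norm (B n $ l $ l'))" for n l'
  define T where "T = (\<Sum>l\<in>UNIV. \<Sum>i\<in>UNIV. norm (J $ l $ i))"
  \<comment> \<open>From q B = I + J B, summed over one column of the inverse
    \<open>B\<close>.\<close>
  have main: "norm (q n) * S n l' \<le> 1 + T * S n l'" for n l'
  proof -
    have S: "norm (B n $ i $ l') \<le> S n l'" for i
      unfolding S_def by (rule member_le_sum) auto
    have "norm (q n * B n $ l $ l') \<le> (if l = l' then 1 else 0) + (\<Sum>i\<in>UNIV. norm (J $ l $ i)) * S n l'" for l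
    proof -
      have "((mat (q n) - J) ** B n) $ l $ l' = (mat 1 :: complex^'m^'m) $ l $ l'" by (simp add: MB)
      then have "(\<Sum>i\<in>UNIV. (if l = i then q n else 0) * B n $ i $ l' - J $ l $ i * B n $ i $ l')
          = (if l = l' then 1 else 0)"
        by (simp add: matrix_matrix_mult_def mat_def left_diff_distrib)
      moreover have "(\<Sum>i\<in>UNIV. (if l = i then q n else 0) * B n $ i $ l' - J $ l $ i * B n $ i $ l')
          = q n * B n $ l $ l' - (\<Sum>i\<in>UNIV. J $ l $ i * B n $ i $ l')"
        by (simp add: sum_subtractf if_distrib[of "\<lambda>x. x * _"] cong: if_cong)
      ultimately have "q n * B n $ l $ l' = (if l = l' then 1 else 0) + (\<Sum>i\<in>UNIV. J $ l $ i * B n $ i $ l')"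
        by (simp only: diff_eq_eq)
      then have "norm (q n * B n $ l $ l') \<le> norm (if l = l' then 1 else 0 :: complex) + norm (\<Sum>i\<in>UNIV. J $ l $ i * B n $ i $ l')"
        by (metis norm_triangle_ineq)
      also have "norm (\<Sum>i\<in>UNIV. J $ l $ i * B n $ i $ l') \<le> (\<Sum>i\<in>UNIV. norm (J $ l $ i) * S n l')"
        by (rule sum_norm_le) (auto simp: norm_mult intro!: mult_left_mono S)
      finally show ?thesis by (auto simp: sum_distrib_right split: if_splits)
    qed
    then have "(\<Sum>l\<in>UNIV. norm (q n * B n $ l $ l'))
        \<le> (\<Sum>l\<in>UNIV. (if l = l' then 1 else 0) + (\<Sum>i\<in>UNIV. norm (J $ l $ i)) * S n l')"
      by (intro sum_mono)
    also have "\<dots> = 1 + T * S n l'"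
      by (simp add: sum.distrib T_def sum_distrib_right[symmetric])
    also have "(\<Sum>l\<in>UNIV. norm (q n * B n $ l $ l')) = norm (q n) * S n l'"
      by (simp add: S_def norm_mult sum_distrib_left)
    finally show ?thesis .
  qed
  have T: "0 \<le> T" unfolding T_def by (intro sum_nonneg) auto
  \<comment> \<open>From here on \<open>T\<close> is at most half of
    \<open>c * (1 + real n) ^ k\<close>, so the term \<open>T * S n l'\<close> can be absorbed on
    the left.\<close>
  obtain n0 :: nat where n0: "2 * T / c \<le> real n0" using real_arch_simple by blast
  have "\<forall>\<^sub>F n in sequentially. \<forall>l'. S n l' * (1 + real n) ^ k \<le> 2 / c"
    using c(2) eventually_ge_at_top[of n0]
  proof eventually_elim
    case (elim n)
    show ?case
    proof
      fix l'
      have S: "0 \<le> S n l'" unfolding S_def by (intro sum_nonneg) auto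
      let ?N = "(1 + real n) ^ k"
      have "1 + real n \<le> ?N" using k by (intro self_le_power) auto
      then have "2 * T / c \<le> ?N" using n0 elim(2) by linarith
      then have TN: "2 * T \<le> c * ?N" using c(1) by (simp add: field_simps)
      have "c * ?N * S n l' \<le> 1 + T * S n l'"
        using mult_right_mono[OF elim(1) S] main[of n l'] by linarith
      moreover have "2 * T * S n l' \<le> c * ?N * S n l'" using mult_right_mono[OF TN S] .
      ultimately have "c * ?N * S n l' \<le> 2" by linarith
      then show "S n l' * ?N \<le> 2 / c" using c(1) by (simp add: field_simps)
    qed
  qed
  then obtain n1 where n1: "\<And>n l'. n \<ge> n1 \<Longrightarrow> S n l' * (1 + real n) ^ k \<le> 2 / c"
    unfolding eventually_sequentially by blast
  define g where "g n = (\<Sum>l'\<in>UNIV. S n l' * (1 + real n) ^ k)" for n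
  have S0: "0 \<le> S n l'" for n l' unfolding S_def by (intro sum_nonneg) auto
  have Sg: "S n l' * (1 + real n) ^ k \<le> g n" for n l'
    unfolding g_def using S0 by (intro member_le_sum) auto
  have g0: "0 \<le> g n" for n unfolding g_def using S0 by (intro sum_nonneg) auto
  define K where "K = 2 / c + (\<Sum>n<n1. g n)"
  have "norm (B n $ l $ l') * (1 + real n) ^ k \<le> K" for n l l'
  proof -
    have "norm (B n $ l $ l') \<le> S n l'" unfolding S_def by (rule member_le_sum) auto
    then have "norm (B n $ l $ l') * (1 + real n) ^ k \<le> S n l' * (1 + real n) ^ k"
      by (rule mult_right_mono) simp
    also have "\<dots> \<le> K"
    proof (cases "n1 \<le> n")
      case True
      then show ?thesis using n1[OF True, of l'] sum_nonneg[of "{..<n1}" g] g0 by (simp add: K_def)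
    next
      case False
      then have "g n \<le> (\<Sum>n<n1. g n)" using g0 by (intro member_le_sum) auto
      then show ?thesis using Sg[of n l'] c(1) by (simp add: K_def add_increasing)
    qed
    finally show ?thesis .
  qed
  moreover have "0 < K" unfolding K_def using c(1) g0 by (intro add_pos_nonneg sum_nonneg) auto
  ultimately show ?thesis using that unfolding B_def by blast
qed

text \<open>The arguments (u, C(u)) of the right-hand side. Treating the coordinates as series makes
  F(x, y(x)) a single substitution in variables indexed by \<open>'d + 'm\<close>.\<close>

definition subst_args :: "('m \<Rightarrow> nat^'d::finite \<Rightarrow> complex) \<Rightarrow> 'd + 'm \<Rightarrow> nat^'d \<Rightarrow> complex" where
  "subst_args C = case_sum (\<lambda>i \<alpha>. if \<alpha> = axis i 1 then 1 else 0) C"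

lemma wbound_coordinate:
  assumes "0 < \<rho>" "\<rho> \<le> 1"
  shows "wbound (wt p 0 \<rho>) (\<lambda>\<alpha>. if \<alpha> = axis i 1 then 1 else 0) \<rho>"
proof (rule wboundI)
  fix S :: "(nat^'a) set" assume S: "finite S"
  have "(\<Sum>\<alpha>\<in>S. norm (if \<alpha> = axis i 1 then 1 else 0 :: complex) * wt p 0 \<rho> \<alpha>)
      = (\<Sum>\<alpha>\<in>S \<inter> {axis i 1}. wt p 0 \<rho> \<alpha>)"
    using S by (intro sum.mono_neutral_cong_right) auto
  also have "\<dots> \<le> (\<Sum>\<alpha>\<in>{axis i 1}. wt p 0 \<rho> \<alpha>)"
    using less_imp_le[OF wt_pos[OF assms(1)]] by (intro sum_mono2) auto
  also have "\<dots> \<le> \<rho>"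
  proof -
    have "axis i (1 :: nat) $ p = (if p = i then 1 else 0)" by (simp add: axis_def)
    then show ?thesis using assms by (simp add: wt_def mult_left_le)
  qed
  finally show "(\<Sum>\<alpha>\<in>S. norm (if \<alpha> = axis i 1 then 1 else 0 :: complex) * wt p 0 \<rho> \<alpha>) \<le> \<rho>" .
qed

lemma sum_UNIV_Plus:
  "(\<Sum>i\<in>UNIV. g i) = (\<Sum>i\<in>UNIV. g (Inl i)) + (\<Sum>l\<in>UNIV. g (Inr l :: 'd::finite + 'm::finite))"
  by (simp add: UNIV_Plus_UNIV[symmetric] sum.Plus del: UNIV_Plus_UNIV)

lemma geo_uniform:
  fixes f :: "'m::finite \<Rightarrow> nat^'i::finite \<Rightarrow> complex"
  assumes "\<And>l. geo (f l)"
  obtains M K where "0 < M" "0 < K" "\<And>l \<nu>. norm (f l \<nu>) \<le> M * K ^ mdeg \<nu>"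
proof -
  have "\<forall>l. \<exists>M K. 0 < M \<and> 0 < K \<and> (\<forall>\<nu>. norm (f l \<nu>) \<le> M * K ^ mdeg \<nu>)"
    using assms unfolding geo_def by blast
  then obtain M K where *: "\<And>l. 0 < M l" "\<And>l. 0 < K l" "\<And>l \<nu>. norm (f l \<nu>) \<le> M l * K l ^ mdeg \<nu>"
    by metis
  have le: "M l \<le> (\<Sum>l\<in>UNIV. M l)" "K l \<le> (\<Sum>l\<in>UNIV. K l)" for l
    using *(1,2) by (auto intro!: member_le_sum simp: less_imp_le)
  have "norm (f l \<nu>) \<le> (\<Sum>l\<in>UNIV. M l) * (\<Sum>l\<in>UNIV. K l) ^ mdeg \<nu>" for l \<nu>
  proof -
    have "norm (f l \<nu>) \<le> M l * K l ^ mdeg \<nu>" by (rule *)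
    also have "\<dots> \<le> (\<Sum>l\<in>UNIV. M l) * (\<Sum>l\<in>UNIV. K l) ^ mdeg \<nu>"
      using le *(1,2) by (intro mult_mono power_mono) (auto simp: less_imp_le intro: sum_nonneg)
    finally show ?thesis .
  qed
  moreover have "0 < (\<Sum>l\<in>UNIV. M l)" "0 < (\<Sum>l\<in>UNIV. K l)" using *(1,2) by (auto intro!: sum_pos)
  ultimately show ?thesis using that by blast
qed

lemma formal_unique_solution:
  fixes f :: "'m::finite \<Rightarrow> nat^('d::finite + 'm) \<Rightarrow> complex" and J :: "complex^'m^'m"
  assumes f: "\<And>l. geo (f l)" "\<And>l. f l 0 = 0" and J: "\<And>l l'. J $ l $ l' = f l (axis (Inr l') 1)"
    and \<pi>: "\<And>i. geo (\<pi> i)" and A: "\<And>j \<mu>. 1 \<le> j \<Longrightarrow> j \<le> k \<Longrightarrow> mdeg \<mu> = j \<Longrightarrow> geo (A j \<mu>)"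
    and xs: "distinct xs" "set xs = UNIV" and k: "1 \<le> k"
    and inv: "\<And>n. invertible (mat (symb k \<pi> A xs n) - J)"
    and nz: "(\<Sum>\<mu> | mdeg \<mu> = k. A k \<mu> 0 * lead \<pi> (letters xs \<mu>)) \<noteq> 0"
  shows "\<exists>!C. (\<forall>l. geo (C l) \<and> C l 0 = 0) \<and>
    (\<forall>l \<alpha>. Lop k p \<pi> A xs (C l) \<alpha> = subst_series (f l) (subst_args C) \<alpha>)"
proof -
  define q where "q = symb k \<pi> A xs"
  obtain c where c: "0 < c" "\<forall>\<^sub>F n in sequentially. c * (1 + real n) ^ k \<le> norm (q n)"
    unfolding q_def using symb_lower_bound[where A = A and \<pi> = \<pi> and xs = xs, OF k nz] by metis
  obtain K where K: "0 < K" "\<And>n l l'. norm (matrix_inv (mat (q n) - J) $ l $ l') * (1 + real n) ^ k \<le> K"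
    using resolvent_bound[OF inv[folded q_def] k c] by metis
  define Mi where "Mi n = matrix_inv (mat (q n) - J)" for n
  have Mi: "(mat (q n) - J) ** Mi n = mat 1" "Mi n ** (mat (q n) - J) = mat 1" for n
    unfolding Mi_def using inv[of n, folded q_def]
    by (simp_all add: invertible_def matrix_inv_def) (metis (mono_tags, lifting) someI_ex)+
  define H where "H C l \<alpha> = subst_series (f l) (subst_args C) \<alpha> - (\<Sum>l'\<in>UNIV. J $ l $ l' * C l' \<alpha>)
    - (Lop k p \<pi> A xs (C l) \<alpha> - q (\<alpha> $ p) * C l \<alpha>)" for C l \<alpha>
  define G where "G C l \<alpha> = (\<Sum>l'\<in>UNIV. Mi (\<alpha> $ p) $ l $ l' * H C l' \<alpha>)" for C l \<alpha>
  have fix_iff: "G C = C \<longleftrightarrow> (\<forall>l \<alpha>. Lop k p \<pi> A xs (C l) \<alpha> = subst_series (f l) (subst_args C) \<alpha>)" for C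
  proof -
    have "(\<forall>l. G C l \<alpha> = C l \<alpha>) \<longleftrightarrow> (\<forall>l. Lop k p \<pi> A xs (C l) \<alpha> = subst_series (f l) (subst_args C) \<alpha>)" for \<alpha>
    proof -
      define n where "n = \<alpha> $ p"
      define w where "w = (\<chi> l. subst_series (f l) (subst_args C) \<alpha> - Lop k p \<pi> A xs (C l) \<alpha>)"
      define v where "v = (\<chi> l. C l \<alpha>)"
      have "(\<chi> l. H C l \<alpha>) = w + (mat (q n) - J) *v v"
        by (simp add: vec_eq_iff H_def w_def v_def n_def matrix_vector_mult_def mat_def left_diff_distrib
            sum_subtractf if_distrib[of "\<lambda>x. x * _"] cong: if_cong)
      then have "(\<chi> l. G C l \<alpha>) = Mi n *v (w + (mat (q n) - J) *v v)"
        by (simp add: vec_eq_iff G_def n_def matrix_vector_mult_def[of "Mi _"])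
      also have "\<dots> = Mi n *v w + v"
        by (simp add: matrix_vector_right_distrib matrix_vector_mul_assoc Mi)
      finally have "(\<chi> l. G C l \<alpha>) = v \<longleftrightarrow> Mi n *v w = 0" by simp
      also have "\<dots> \<longleftrightarrow> w = 0"
        by (metis Mi(1) matrix_vector_mul_assoc matrix_vector_mul_lid matrix_vector_mult_0_right)
      finally show ?thesis by (auto simp: vec_eq_iff v_def w_def)
    qed
    then show ?thesis by (auto simp: fun_eq_iff)
  qed
  obtain M Kf where fb: "0 < M" "0 < Kf" "\<And>l \<nu>. norm (f l \<nu>) \<le> M * Kf ^ mdeg \<nu>"
    using geo_uniform[of f, OF f(1)] by metis
  define m where "m = real CARD('m)"
  have m: "0 < m" by (simp add: m_def)
  define \<Lambda> where "\<Lambda> = M * (16 * Kf\<^sup>2) * 2 ^ CARD('d + 'm)"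
  have \<Lambda>: "0 < \<Lambda>" using fb by (simp add: \<Lambda>_def)
  \<comment> \<open>The first entry makes substitution admissible. Since the resolvent has norm at
    most \<open>m * K\<close>, the second gives the nonlinear terms Lipschitz constant at most 1/4;
    the choice of \<epsilon> below leaves another 1/4 to the operator error, for a total of
    1/2.\<close>
  define R where "R = min (1 / (4 * Kf)) (1 / (4 * m * K * \<Lambda>))"
  have R: "0 < R" "4 * Kf * R \<le> 1" "m * K * (\<Lambda> * R) \<le> 1 / 4"
  proof -
    have "4 * Kf * R \<le> 4 * Kf * (1 / (4 * Kf))" using fb by (intro mult_left_mono) (auto simp: R_def)
    then show "4 * Kf * R \<le> 1" using fb by simp
    have "m * K * \<Lambda> * R \<le> m * K * \<Lambda> * (1 / (4 * m * K * \<Lambda>))"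
      using m K \<Lambda> by (intro mult_left_mono) (auto simp: R_def)
    then show "m * K * (\<Lambda> * R) \<le> 1 / 4" using m K \<Lambda> by (simp add: mult.assoc)
    show "0 < R" using fb m K \<Lambda> by (simp add: R_def)
  qed
  define \<epsilon> where "\<epsilon> = 1 / (4 * m * K)"
  have \<epsilon>: "0 < \<epsilon>" "m * K * \<epsilon> = 1 / 4" using m K by (simp_all add: \<epsilon>_def)
  \<comment> \<open>At C = 0 only the series of F(x, 0) remains; its norm is at most
    \<open>\<Theta> * \<rho>\<close>, the first summand of \<Theta> covering degree at least two and
    the second the linear terms. The bound \<open>\<rho>1\<close> makes the image of 0 at most R/2
    and lets the coordinates fit into the ball.\<close>
  define \<Theta> where "\<Theta> = \<Lambda> * R + (\<Sum>l\<in>UNIV. \<Sum>i\<in>UNIV. norm (f l (axis i 1)))"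
  have \<Theta>: "0 < \<Theta>" using \<Lambda> R by (auto simp: \<Theta>_def intro!: add_pos_nonneg sum_nonneg)
  define \<rho>1 where "\<rho>1 = min (min 1 R) (R / 2 / (m * K * \<Theta>))"
  have \<rho>1: "0 < \<rho>1" using R m K \<Theta> by (simp add: \<rho>1_def)
  define contr where "contr \<rho> \<longleftrightarrow> (\<forall>Y Y' \<delta>. (\<forall>l. Y l 0 = 0) \<longrightarrow> (\<forall>l. Y' l 0 = 0) \<longrightarrow>
      (\<forall>l. wbound (wt p k \<rho>) (Y l) R) \<longrightarrow> (\<forall>l. wbound (wt p k \<rho>) (Y' l) R) \<longrightarrow>
      (\<forall>l. wbound (wt p k \<rho>) (\<lambda>\<alpha>. Y l \<alpha> - Y' l \<alpha>) \<delta>) \<longrightarrow>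
      (\<forall>l. wbound (wt p k \<rho>) (\<lambda>\<alpha>. G Y l \<alpha> - G Y' l \<alpha>) (\<delta> / 2)))" for \<rho>
  \<comment> \<open>The passage from weight power 0 to k is exactly what \<open>wbound_Lop\<close>
    loses in the other direction.\<close>
  have resolvent: "wbound (wt p k \<rho>) (\<lambda>\<alpha>. \<Sum>l'\<in>UNIV. Mi (\<alpha> $ p) $ l $ l' * h l' \<alpha>) (m * K * B)"
    if "0 < \<rho>" "\<And>l'. wbound (wt p 0 \<rho>) (h l') B" for \<rho> h B l
  proof -
    have "wbound (wt p k \<rho>) (\<lambda>\<alpha>. \<Sum>l'\<in>UNIV. Mi (\<alpha> $ p) $ l $ l' * h l' \<alpha>) (\<Sum>l'\<in>(UNIV :: 'm set). K * B)"
    proof (rule wbound_sum)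
      fix l'
      show "wbound (wt p k \<rho>) (\<lambda>\<alpha>. Mi (\<alpha> $ p) $ l $ l' * h l' \<alpha>) (K * B)"
      proof (rule wbound_diag[OF that(2)])
        fix \<alpha>
        show "norm (Mi (\<alpha> $ p) $ l $ l') * wt p k \<rho> \<alpha> \<le> K * wt p 0 \<rho> \<alpha>"
          using mult_right_mono[OF K(2)[of "\<alpha> $ p" l l'] less_imp_le[OF wt_pos[OF that(1), of p 0 \<alpha>]]]
          using wt_add[of p 0 k \<rho> \<alpha>] by (simp add: Mi_def mult.assoc)
      qed (use K in simp)
    qed (use less_imp_le[OF wt_pos[OF that(1)]] in auto)
    then show ?thesis by (simp add: m_def mult.assoc)
  qed
  have args0: "subst_args Y i 0 = 0" if "\<And>l. Y l 0 = 0" for Y :: "'m \<Rightarrow> nat^'d \<Rightarrow> complex" and i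
  proof -
    have "(0 :: nat^'d) \<noteq> axis j (Suc 0)" for j by (metis mdeg_0 mdeg_axis Zero_not_Suc)
    then show ?thesis using that by (auto simp: subst_args_def split: sum.splits)
  qed
  have argsR: "wbound (wt p 0 \<rho>) (subst_args Y i) R"
    if "0 < \<rho>" "\<rho> \<le> \<rho>1" "\<And>l. wbound (wt p k \<rho>) (Y l) R" for \<rho> Y i
  proof (cases i)
    case (Inl j)
    have "wbound (wt p 0 \<rho>) (subst_args Y i) \<rho>"
      using wbound_coordinate[of \<rho> p j] that by (simp add: subst_args_def Inl \<rho>1_def)
    then show ?thesis by (rule wbound_mono) (use that in \<open>simp add: \<rho>1_def\<close>)
  next
    case (Inr l)
    then show ?thesis using that(3)[of l] that(1)
      by (auto simp: subst_args_def intro: wbound_weight_mono wt_mono)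
  qed
  have zero: "wbound (wt p k \<rho>) (G (\<lambda>l \<alpha>. 0) l) (R / 2)" if \<rho>: "0 < \<rho>" "\<rho> \<le> \<rho>1" for \<rho> l
  proof -
    let ?O = "\<lambda>(l::'m) (\<alpha>::nat^'d). 0::complex" and ?Z = "\<lambda>(i::'d + 'm) (\<alpha>::nat^'d). 0::complex"
    have W: "submult (wt p 0 \<rho>)" using submult_wt[OF \<rho>(1)] .
    have \<rho>': "\<rho> \<le> 1" "\<rho> \<le> R" "m * K * \<Theta> * \<rho> \<le> R / 2"
    proof -
      have "m * K * \<Theta> * \<rho> \<le> m * K * \<Theta> * (R / 2 / (m * K * \<Theta>))"
        using \<rho> m K \<Theta> by (intro mult_left_mono) (auto simp: \<rho>1_def)
      then show "m * K * \<Theta> * \<rho> \<le> R / 2" using m K \<Theta> by simp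
    qed (use \<rho> in \<open>auto simp: \<rho>1_def\<close>)
    have small: "wbound (wt p 0 \<rho>) (subst_args ?O i) \<rho>" for i
      using wbound_coordinate[of \<rho> p] \<rho> \<rho>' by (cases i) (auto simp: subst_args_def intro!: wbound_0)
    have "wbound (wt p 0 \<rho>) (H ?O l) (\<Theta> * \<rho>)" for l
    proof -
      have "wbound (wt p 0 \<rho>) (\<lambda>\<alpha>. subst_series (f l) (subst_args ?O) \<alpha> - subst_series (f l) ?Z \<alpha>
          - (\<Sum>i\<in>UNIV. f l (axis i 1) * (subst_args ?O i \<alpha> - ?Z i \<alpha>)))
          (M * (16 * Kf\<^sup>2 * R) * 2 ^ CARD('d + 'm) * \<rho>)"
        using small \<rho> \<rho>' R args0[of ?O]
        by (intro wbound_subst_series_diff fb W wbound_0) (auto intro: wbound_mono)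
      moreover have cz: "subst_series (f l) ?Z \<alpha> = 0" for \<alpha>
        by (simp add: subst_series_zero f(2))
      ultimately have 1: "wbound (wt p 0 \<rho>) (\<lambda>\<alpha>. subst_series (f l) (subst_args ?O) \<alpha>
          - (\<Sum>i\<in>UNIV. f l (axis i 1) * subst_args ?O i \<alpha>)) (\<Lambda> * R * \<rho>)"
        by (simp add: cz \<Lambda>_def mult_ac)
      have 2: "wbound (wt p 0 \<rho>) (\<lambda>\<alpha>. \<Sum>i\<in>UNIV. f l (axis i 1) * subst_args ?O i \<alpha>)
          (\<Sum>i\<in>UNIV. norm (f l (axis i 1)) * \<rho>)"
        by (intro wbound_sum wbound_scale small submult_nonneg[OF W]) auto
      have "Lop k p \<pi> A xs (\<lambda>\<alpha>. 0) \<alpha> = 0" for \<alpha>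
        using Lop_diff[of k p \<pi> A xs "\<lambda>\<alpha>. 0" "\<lambda>\<alpha>. 0" \<alpha>] by simp
      then have "wbound (wt p 0 \<rho>) (H ?O l) (\<Lambda> * R * \<rho> + (\<Sum>i\<in>UNIV. norm (f l (axis i 1)) * \<rho>))"
        using wbound_add[OF 1 2 submult_nonneg[OF W]] by (simp add: H_def[abs_def])
      moreover have "(\<Sum>i\<in>UNIV. norm (f l (axis i 1)) * \<rho>)
          \<le> (\<Sum>l\<in>UNIV. \<Sum>i\<in>UNIV. norm (f l (axis i 1))) * \<rho>"
        unfolding sum_distrib_right
        by (rule member_le_sum[of l UNIV "\<lambda>l. \<Sum>i\<in>UNIV. norm (f l (axis i 1)) * \<rho>"])
          (use \<rho> in \<open>auto intro!: sum_nonneg\<close>)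
      ultimately show ?thesis by (auto simp: \<Theta>_def distrib_right intro: wbound_mono)
    qed
    from resolvent[OF \<rho>(1) this] have "wbound (wt p k \<rho>) (G ?O l) (m * K * (\<Theta> * \<rho>))"
      by (simp add: G_def[abs_def])
    then show ?thesis by (rule wbound_mono) (use \<rho>' in \<open>simp add: mult.assoc\<close>)
  qed
  have pert: "\<forall>\<^sub>F \<rho> in at_right 0. \<forall>c B. wbound (wt p k \<rho>) c B \<longrightarrow>
      wbound (wt p 0 \<rho>) (\<lambda>\<alpha>. Lop k p \<pi> A xs c \<alpha> - q (\<alpha> $ p) * c \<alpha>) (\<epsilon> * B)"
    unfolding q_def by (rule wbound_Lop[where \<pi> = \<pi>, OF \<pi> A xs \<epsilon>(1)])
  moreover have small: "\<forall>\<^sub>F \<rho> in at_right (0::real). 0 < \<rho> \<and> \<rho> \<le> \<rho>1"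
    using \<rho>1 by (intro eventually_at_right_0I[of \<rho>1]) auto
  ultimately have contr: "\<forall>\<^sub>F \<rho> in at_right 0. contr \<rho>"
  proof eventually_elim
    case (elim \<rho>)
    then have \<rho>: "0 < \<rho>" "\<rho> \<le> \<rho>1" by auto
    have W: "submult (wt p 0 \<rho>)" using submult_wt[OF \<rho>(1)] .
    show ?case unfolding contr_def
    proof (intro allI impI)
      fix Y Y' :: "'m \<Rightarrow> nat^'d \<Rightarrow> complex" and \<delta> l
      assume Y: "\<forall>l. Y l 0 = 0" "\<forall>l. Y' l 0 = 0" "\<forall>l. wbound (wt p k \<rho>) (Y l) R"
        "\<forall>l. wbound (wt p k \<rho>) (Y' l) R" and d: "\<forall>l. wbound (wt p k \<rho>) (\<lambda>\<alpha>. Y l \<alpha> - Y' l \<alpha>) \<delta>"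
      have \<delta>: "0 \<le> \<delta>" using wbound_nonneg d by blast
      have dargs: "wbound (wt p 0 \<rho>) (\<lambda>\<alpha>. subst_args Y i \<alpha> - subst_args Y' i \<alpha>) \<delta>" for i
      proof (cases i)
        case (Inr l)
        then show ?thesis using d[rule_format, of l] \<rho>
          by (auto simp: subst_args_def intro: wbound_weight_mono wt_mono)
      qed (auto simp: subst_args_def \<delta> wbound_0)
      have "wbound (wt p 0 \<rho>) (\<lambda>\<alpha>. H Y l \<alpha> - H Y' l \<alpha>) ((\<Lambda> * R + \<epsilon>) * \<delta>)" for l
      proof -
        have "wbound (wt p 0 \<rho>) (\<lambda>\<alpha>. subst_series (f l) (subst_args Y) \<alpha> - subst_series (f l) (subst_args Y') \<alpha>
          - (\<Sum>i\<in>UNIV. f l (axis i 1) * (subst_args Y i \<alpha> - subst_args Y' i \<alpha>)))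
          (M * (16 * Kf\<^sup>2 * R) * 2 ^ CARD('d + 'm) * \<delta>)"
          using Y \<rho> by (intro wbound_subst_series_diff fb W R dargs argsR args0) auto
        \<comment> \<open>The coordinate slots agree in both arguments, so only the slots of the
          unknowns survive, and they reproduce \<open>J\<close>.\<close>
        moreover have "(\<Sum>i\<in>UNIV. f l (axis i 1) * (subst_args Y i \<alpha> - subst_args Y' i \<alpha>))
            = (\<Sum>l'\<in>UNIV. J $ l $ l' * (Y l' \<alpha> - Y' l' \<alpha>))" for \<alpha>
          unfolding sum_UNIV_Plus by (simp add: subst_args_def J)
        ultimately have 1: "wbound (wt p 0 \<rho>) (\<lambda>\<alpha>. subst_series (f l) (subst_args Y) \<alpha> - subst_series (f l) (subst_args Y') \<alpha>
          - (\<Sum>l'\<in>UNIV. J $ l $ l' * (Y l' \<alpha> - Y' l' \<alpha>))) (\<Lambda> * R * \<delta>)"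
          by (simp add: \<Lambda>_def mult_ac)
        have 2: "wbound (wt p 0 \<rho>) (\<lambda>\<alpha>. Lop k p \<pi> A xs (\<lambda>\<alpha>. Y l \<alpha> - Y' l \<alpha>) \<alpha>
            - q (\<alpha> $ p) * (Y l \<alpha> - Y' l \<alpha>)) (\<epsilon> * \<delta>)"
          using elim(1) d by blast
        have "wbound (wt p 0 \<rho>) (\<lambda>\<alpha>. H Y l \<alpha> - H Y' l \<alpha>) (\<Lambda> * R * \<delta> + \<epsilon> * \<delta>)"
          using wbound_diff[OF 1 2 submult_nonneg[OF W]]
          by (rule wbound_cong[rotated])
            (simp add: H_def Lop_diff sum_subtractf right_diff_distrib)
        then show ?thesis by (simp add: distrib_right)
      qed
      from resolvent[OF \<rho>(1) this]
      have "wbound (wt p k \<rho>) (\<lambda>\<alpha>. G Y l \<alpha> - G Y' l \<alpha>) (m * K * ((\<Lambda> * R + \<epsilon>) * \<delta>))"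
        by (simp add: G_def[abs_def] right_diff_distrib sum_subtractf)
      moreover have "m * K * ((\<Lambda> * R + \<epsilon>) * \<delta>) \<le> \<delta> / 2"
      proof -
        have "m * K * (\<Lambda> * R + \<epsilon>) \<le> 1 / 2" using R(3) \<epsilon>(2) by (simp add: distrib_left)
        from mult_right_mono[OF this \<delta>] show ?thesis by (simp add: mult.assoc)
      qed
      ultimately show "wbound (wt p k \<rho>) (\<lambda>\<alpha>. G Y l \<alpha> - G Y' l \<alpha>) (\<delta> / 2)" by (rule wbound_mono)
    qed
  qed
  have Gz: "G Y l 0 = 0" if "\<And>l. Y l 0 = 0" for Y l
  proof -
    have T0: "Top p \<pi> ws c 0 = 0" if "c 0 = 0" for c :: "nat^'d \<Rightarrow> complex" and ws
      using that by (induction ws) (auto simp: cmul_0 theta_def shiftd_def)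
    have "Lop k p \<pi> A xs (Y l) 0 = 0" for l
      using that by (simp add: Lop_def cmul_0 T0)
    then show ?thesis using that
      by (simp add: G_def H_def subst_series_0[of "subst_args Y", OF args0, OF that] f(2))
  qed
  show ?thesis
  proof (rule ex_ex1I)
    have "\<forall>\<^sub>F \<rho> in at_right 0. contr \<rho> \<and> 0 < \<rho> \<and> \<rho> \<le> \<rho>1"
      using contr small by eventually_elim auto
    then obtain \<rho> where \<rho>: "contr \<rho>" "0 < \<rho>" "\<rho> \<le> \<rho>1"
      using eventually_happens' trivial_limit_at_right_real by blast
    have "\<exists>Y. (\<forall>l. Y l 0 = 0 \<and> wbound (wt p k \<rho>) (Y l) R) \<and> G Y = Y"
      using \<rho> by (intro contraction_exists wt_pos zero Gz) (auto simp: contr_def)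
    then obtain Y where Y: "\<And>l. Y l 0 = 0" "\<And>l. wbound (wt p k \<rho>) (Y l) R" "G Y = Y" by blast
    have "geo (Y l)" for l using wbound_imp_geo[OF Y(2)] \<rho> by (simp add: \<rho>1_def)
    then show "\<exists>C. (\<forall>l. geo (C l) \<and> C l 0 = 0) \<and>
        (\<forall>l \<alpha>. Lop k p \<pi> A xs (C l) \<alpha> = subst_series (f l) (subst_args C) \<alpha>)"
      using Y fix_iff by blast
  next
    fix C C'
    assume "(\<forall>l. geo (C l) \<and> C l 0 = 0) \<and> (\<forall>l \<alpha>. Lop k p \<pi> A xs (C l) \<alpha> = subst_series (f l) (subst_args C) \<alpha>)"
      and "(\<forall>l. geo (C' l) \<and> C' l 0 = 0) \<and> (\<forall>l \<alpha>. Lop k p \<pi> A xs (C' l) \<alpha> = subst_series (f l) (subst_args C') \<alpha>)"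
    then have C: "\<And>l. geo (C l)" "\<And>l. C l 0 = 0" "G C = C"
      and C': "\<And>l. geo (C' l)" "\<And>l. C' l 0 = 0" "G C' = C'"
      using fix_iff by blast+
    \<comment> \<open>\<open>R\<close> does not depend on \<rho>, so decreasing \<rho> puts both
      given solutions into the same ball of contraction.\<close>
    have "\<forall>\<^sub>F \<rho> in at_right 0. \<forall>l\<in>UNIV. wbound (wt p k \<rho>) (C l) R"
      using C R by (intro eventually_ball_finite geo_small ballI) auto
    moreover have "\<forall>\<^sub>F \<rho> in at_right 0. \<forall>l\<in>UNIV. wbound (wt p k \<rho>) (C' l) R"
      using C' R by (intro eventually_ball_finite geo_small ballI) auto
    ultimately have "\<forall>\<^sub>F \<rho> in at_right 0. contr \<rho> \<and> 0 < \<rho> \<and>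
        (\<forall>l. wbound (wt p k \<rho>) (C l) R) \<and> (\<forall>l. wbound (wt p k \<rho>) (C' l) R)"
      using contr small by eventually_elim auto
    then obtain \<rho> where \<rho>: "contr \<rho>" "0 < \<rho>"
      "\<And>l. wbound (wt p k \<rho>) (C l) R" "\<And>l. wbound (wt p k \<rho>) (C' l) R"
      using eventually_happens' trivial_limit_at_right_real by blast
    show "C = C'"
    proof (rule contraction_unique[of "wt p k \<rho>"])
      fix \<delta> l assume "\<And>l. wbound (wt p k \<rho>) (\<lambda>\<alpha>. C l \<alpha> - C' l \<alpha>) \<delta>"
      then have "wbound (wt p k \<rho>) (\<lambda>\<alpha>. G C l \<alpha> - G C' l \<alpha>) (\<delta> / 2)"
        using \<rho> C(2) C'(2) unfolding contr_def by blast
      then show "wbound (wt p k \<rho>) (\<lambda>\<alpha>. C l \<alpha> - C' l \<alpha>) (\<delta> / 2)" by (simp add: C(3) C'(3))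
    qed (use \<rho> wt_pos in auto)
  qed
qed


subsection \<open>Sums of convergent power series\<close>

text \<open>The infinite sum has the default value 0 where it does not converge; most identities for
  \<open>ev\<close> are therefore stated near 0 or under absolute summability.\<close>

definition ev :: "(nat^'d::finite \<Rightarrow> complex) \<Rightarrow> complex^'d \<Rightarrow> complex" where
  "ev c x = (\<Sum>\<^sub>\<infinity>\<alpha>. c \<alpha> * monom_at x \<alpha>)"

lemma eventually_components_less:
  assumes "0 < r"
  shows "\<forall>\<^sub>F x :: complex^'d::finite in nhds 0. \<forall>i. norm (x $ i) < (r :: real)"
  unfolding eventually_nhds_metric
proof (intro exI conjI allI impI)
  fix x :: "complex^'d" and i assume "dist x 0 < r"
  then show "norm (x $ i) < r" using Finite_Cartesian_Product.norm_nth_le[of x i] by simp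
qed (rule assms)

lemma abs_summable_wbound:
  assumes c: "wbound W c B" and W: "\<And>\<alpha>. norm (monom_at x \<alpha>) \<le> W \<alpha>"
  shows "(\<lambda>\<alpha>. norm (c \<alpha> * monom_at x \<alpha>)) summable_on UNIV"
  unfolding abs_summable_iff_bdd_above
proof (rule bdd_aboveI2)
  fix S :: "(nat^'a) set" assume "S \<in> {F. F \<subseteq> UNIV \<and> finite F}"
  then have "(\<Sum>\<alpha>\<in>S. norm (c \<alpha>) * W \<alpha>) \<le> B" by (intro wboundD[OF c]) auto
  moreover have "(\<Sum>\<alpha>\<in>S. norm (c \<alpha> * monom_at x \<alpha>)) \<le> (\<Sum>\<alpha>\<in>S. norm (c \<alpha>) * W \<alpha>)"
    by (intro sum_mono) (auto simp: norm_mult intro!: mult_left_mono W)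
  ultimately show "(\<Sum>\<alpha>\<in>S. norm (c \<alpha> * monom_at x \<alpha>)) \<le> B" by linarith
qed

lemma wbound_power_weight:
  fixes c :: "nat^'d::finite \<Rightarrow> complex"
  assumes c: "\<And>\<alpha>. norm (c \<alpha>) \<le> M * K ^ mdeg \<alpha>" and "0 \<le> M" "0 \<le> K" "0 \<le> r" "K * r \<le> 1 / 2"
  shows "wbound (\<lambda>\<alpha>. r ^ mdeg \<alpha>) c (M * 2 ^ CARD('d))"
proof (rule wboundI)
  fix S :: "(nat^'d) set" assume S: "finite S"
  have "(\<Sum>\<alpha>\<in>S. norm (c \<alpha>) * r ^ mdeg \<alpha>) \<le> (\<Sum>\<alpha>\<in>S. M * (1 / 2) ^ mdeg \<alpha>)"
  proof (rule sum_mono)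
    fix \<alpha>
    have "norm (c \<alpha>) * r ^ mdeg \<alpha> \<le> M * K ^ mdeg \<alpha> * r ^ mdeg \<alpha>"
      using assms by (intro mult_right_mono c) auto
    also have "\<dots> = M * (K * r) ^ mdeg \<alpha>" by (simp add: power_mult_distrib)
    also have "\<dots> \<le> M * (1 / 2) ^ mdeg \<alpha>" using assms by (intro mult_left_mono power_mono) auto
    finally show "norm (c \<alpha>) * r ^ mdeg \<alpha> \<le> M * (1 / 2) ^ mdeg \<alpha>" .
  qed
  also have "\<dots> \<le> M * (1 / (1 - 1 / 2)) ^ CARD('d)"
    unfolding sum_distrib_left[symmetric] using assms S
    by (intro mult_left_mono sum_power_mdeg_le) auto
  finally show "(\<Sum>\<alpha>\<in>S. norm (c \<alpha>) * r ^ mdeg \<alpha>) \<le> M * 2 ^ CARD('d)" by simp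
qed

lemma geo_abs_summable:
  assumes "geo c"
  shows "\<exists>r>0. \<forall>x. (\<forall>i. norm (x $ i) \<le> r) \<longrightarrow> (\<lambda>\<alpha>. norm (c \<alpha> * monom_at x \<alpha>)) summable_on UNIV"
proof -
  obtain M K where MK: "M > 0" "K > 0" "\<And>\<alpha>. norm (c \<alpha>) \<le> M * K ^ mdeg \<alpha>"
    using assms unfolding geo_def by blast
  have "wbound (\<lambda>\<alpha>. (1 / (2 * K)) ^ mdeg \<alpha>) c (M * 2 ^ CARD('a))"
    using MK by (intro wbound_power_weight) auto
  then show ?thesis using MK
    by (intro exI[of _ "1 / (2 * K)"]) (auto intro!: abs_summable_wbound norm_monom_at_le)
qed

lemma eventually_abs_summable:
  assumes "geo c"
  shows "\<forall>\<^sub>F x in nhds 0. (\<lambda>\<alpha>. norm (c \<alpha> * monom_at x \<alpha>)) summable_on UNIV"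
proof -
  obtain r where r: "r > 0" "\<And>x. (\<forall>i. norm (x $ i) \<le> r) \<Longrightarrow> (\<lambda>\<alpha>. norm (c \<alpha> * monom_at x \<alpha>)) summable_on UNIV"
    using geo_abs_summable[OF assms] by blast
  show ?thesis
    by (rule eventually_mono[OF eventually_components_less[OF r(1)]]) (rule r(2), simp add: less_imp_le)
qed

lemma abs_summable_has_sum_ev:
  "(\<lambda>\<alpha>. norm (c \<alpha> * monom_at x \<alpha>)) summable_on UNIV \<Longrightarrow> ((\<lambda>\<alpha>. c \<alpha> * monom_at x \<alpha>) has_sum ev c x) UNIV"
  unfolding ev_def by (rule has_sum_infsum[OF abs_summable_summable])

lemma ev_0: "ev c 0 = c 0"
proof -
  have "ev c 0 = (\<Sum>\<^sub>\<infinity>\<alpha>\<in>{0}. c \<alpha>)"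
    unfolding ev_def by (rule infsum_cong_neutral) (auto simp: monom_at_zero)
  then show ?thesis by simp
qed

text \<open>The double series over all pairs of exponents converges absolutely; summed by rows it
  gives the product, summed along fibres of addition the Cauchy product.\<close>

lemma ev_cmul_pointwise:
  assumes c: "(\<lambda>\<alpha>. norm (c \<alpha> * monom_at x \<alpha>)) summable_on UNIV"
    and d: "(\<lambda>\<alpha>. norm (d \<alpha> * monom_at x \<alpha>)) summable_on UNIV"
  shows "ev (cmul c d) x = ev c x * ev d x"
proof -
  define C where "C \<alpha> = c \<alpha> * monom_at x \<alpha>" for \<alpha>
  define D where "D \<alpha> = d \<alpha> * monom_at x \<alpha>" for \<alpha>
  have C: "(C has_sum ev c x) UNIV" and D: "(D has_sum ev d x) UNIV"
    unfolding C_def D_def by (intro abs_summable_has_sum_ev c d)+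
  have "(\<lambda>p. norm (C (fst p) * D (snd p))) summable_on UNIV \<times> UNIV"
  proof (rule Infinite_Sum.abs_summable_on_Sigma_iff[THEN iffD2], intro conjI ballI)
    fix \<alpha>
    show "(\<lambda>\<beta>. norm (C (fst (\<alpha>, \<beta>)) * D (snd (\<alpha>, \<beta>)))) summable_on UNIV"
      using d by (simp add: D_def norm_mult summable_on_cmult_right)
    have "(\<lambda>\<alpha>. infsum (\<lambda>\<beta>. norm (D \<beta>)) UNIV * norm (C \<alpha>)) summable_on UNIV"
      using c unfolding C_def by (intro summable_on_cmult_right)
    then show "(\<lambda>\<alpha>. norm (\<Sum>\<^sub>\<infinity>\<beta>. norm (C (fst (\<alpha>, \<beta>)) * D (snd (\<alpha>, \<beta>))))) summable_on UNIV"
      by (simp add: norm_mult infsum_cmult_right' abs_mult infsum_nonneg mult.commute)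
  qed
  then have sm: "(\<lambda>p. C (fst p) * D (snd p)) summable_on UNIV \<times> UNIV"
    by (rule abs_summable_summable)
  have "((\<lambda>p. C (fst p) * D (snd p)) has_sum ev c x * ev d x) (UNIV \<times> UNIV)"
  proof (rule has_sum_SigmaI[OF _ _ sm])
    show "((\<lambda>\<alpha>. C \<alpha> * ev d x) has_sum ev c x * ev d x) UNIV"
      by (rule has_sum_cmult_left[OF C])
    show "((\<lambda>\<beta>. C (fst (\<alpha>, \<beta>)) * D (snd (\<alpha>, \<beta>))) has_sum C \<alpha> * ev d x) UNIV" for \<alpha>
      using has_sum_cmult_right[OF D] by simp
  qed
  moreover have "((\<lambda>q. C (fst (snd q)) * D (snd (snd q))) has_sum ev c x * ev d x)
      (SIGMA \<alpha>:UNIV. {p. fst p + snd p = \<alpha>})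
    \<longleftrightarrow> ((\<lambda>p. C (fst p) * D (snd p)) has_sum ev c x * ev d x) (UNIV \<times> UNIV)"
    by (rule has_sum_reindex_bij_witness[where i = "\<lambda>p. (fst p + snd p, p)" and j = snd]) auto
  ultimately have "((\<lambda>q. C (fst (snd q)) * D (snd (snd q))) has_sum ev c x * ev d x)
      (SIGMA \<alpha>:UNIV. {p. fst p + snd p = \<alpha>})" by blast
  then have "((\<lambda>\<alpha>. \<Sum>p | fst p + snd p = \<alpha>. C (fst p) * D (snd p)) has_sum ev c x * ev d x) UNIV"
    by (rule has_sum_SigmaD) (use finite_convolution in \<open>auto intro!: has_sum_finite\<close>)
  moreover have "(\<Sum>p | fst p + snd p = \<alpha>. C (fst p) * D (snd p)) = cmul c d \<alpha> * monom_at x \<alpha>" for \<alpha>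
    unfolding cmul_def sum_distrib_right
    by (rule sum.cong) (auto simp: C_def D_def monom_at_add)
  ultimately show ?thesis unfolding ev_def by (simp add: infsumI)
qed

lemma geo_cmul:
  assumes "geo c" "geo d"
  shows "geo (cmul c d)"
proof -
  let ?p = "undefined :: 'a"
  obtain B where B: "\<forall>\<^sub>F \<rho> in at_right 0. wbound (wt ?p 0 \<rho>) c B" using geo_bounded[OF assms(1)] by metis
  obtain B' where B': "\<forall>\<^sub>F \<rho> in at_right 0. wbound (wt ?p 0 \<rho>) d B'" using geo_bounded[OF assms(2)] by metis
  have "\<forall>\<^sub>F \<rho> in at_right (0::real). 0 < \<rho> \<and> \<rho> \<le> 1" by (rule eventually_at_right_0I[of 1]) auto
  with B B' have "\<forall>\<^sub>F \<rho> in at_right (0::real). geo (cmul c d)"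
  proof eventually_elim
    case (elim \<rho>)
    then show ?case using wbound_imp_geo[OF wbound_cmul[OF submult_wt]] by blast
  qed
  then show ?thesis by simp
qed

lemma ev_cmul:
  assumes "geo c" "geo d"
  shows "\<forall>\<^sub>F x in nhds 0. ev (cmul c d) x = ev c x * ev d x"
  using eventually_abs_summable[OF assms(1)] eventually_abs_summable[OF assms(2)]
  by eventually_elim (rule ev_cmul_pointwise)

lemma geo_add: "geo c \<Longrightarrow> geo d \<Longrightarrow> geo (\<lambda>\<alpha>. c \<alpha> + d \<alpha>)"
proof -
  assume "geo c" "geo d"
  then obtain M K M' K' where *: "M > 0" "K > 0" "\<And>\<alpha>. norm (c \<alpha>) \<le> M * K ^ mdeg \<alpha>"
    "M' > 0" "K' > 0" "\<And>\<alpha>. norm (d \<alpha>) \<le> M' * K' ^ mdeg \<alpha>"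
    unfolding geo_def by blast
  have "norm (c \<alpha> + d \<alpha>) \<le> (M + M') * (max K K') ^ mdeg \<alpha>" for \<alpha>
  proof -
    have "norm (c \<alpha> + d \<alpha>) \<le> M * K ^ mdeg \<alpha> + M' * K' ^ mdeg \<alpha>"
      using norm_triangle_ineq[of "c \<alpha>" "d \<alpha>"] *(3)[of \<alpha>] *(6)[of \<alpha>] by linarith
    also have "\<dots> \<le> M * (max K K') ^ mdeg \<alpha> + M' * (max K K') ^ mdeg \<alpha>"
      using * by (intro add_mono mult_left_mono power_mono) auto
    finally show ?thesis by (simp add: distrib_right)
  qed
  then show ?thesis unfolding geo_def using *(1,2,4,5)
    by (intro exI[of _ "M + M'"] conjI exI[of _ "max K K'"]) auto
qed

lemma ev_add:
  assumes "geo c" "geo d"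
  shows "\<forall>\<^sub>F x in nhds 0. ev (\<lambda>\<alpha>. c \<alpha> + d \<alpha>) x = ev c x + ev d x"
  using eventually_abs_summable[OF assms(1)] eventually_abs_summable[OF assms(2)]
proof eventually_elim
  case (elim x)
  show ?case
    using has_sum_add[OF abs_summable_has_sum_ev[OF elim(1)] abs_summable_has_sum_ev[OF elim(2)]]
    by (simp add: ev_def[of "\<lambda>\<alpha>. c \<alpha> + d \<alpha>"] distrib_right infsumI)
qed

lemma geo_const: "geo (\<lambda>\<alpha>. if \<alpha> = 0 then k else 0)"
  unfolding geo_def by (intro exI[of _ "norm k + 1"] conjI exI[of _ 1]) (auto simp: add_nonneg_pos)

lemma ev_const: "ev (\<lambda>\<alpha>. if \<alpha> = 0 then k else 0) x = k"
proof -
  have "ev (\<lambda>\<alpha>. if \<alpha> = 0 then k else 0) x = (\<Sum>\<^sub>\<infinity>\<alpha>\<in>{0}. k * monom_at x \<alpha>)"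
    unfolding ev_def by (rule infsum_cong_neutral) auto
  then show ?thesis by simp
qed

lemma ev_coordinate: "ev (\<lambda>\<alpha>. if \<alpha> = axis i 1 then 1 else 0) x = x $ i"
proof -
  have "ev (\<lambda>\<alpha>. if \<alpha> = axis i 1 then 1 else 0) x = (\<Sum>\<^sub>\<infinity>\<alpha>\<in>{axis i 1}. monom_at x \<alpha>)"
    unfolding ev_def by (rule infsum_cong_neutral) auto
  then show ?thesis using monom_at_axis by simp
qed

lemma geo_coordinate: "geo (\<lambda>\<alpha>. if \<alpha> = axis i 1 then 1 else 0)"
  unfolding geo_def by (intro exI[of _ 1] conjI) auto

lemma ev_scale: "ev (\<lambda>\<alpha>. k * c \<alpha>) x = k * ev c x"
  unfolding ev_def by (simp add: mult.assoc infsum_cmult_right')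

lemma geo_scale: "geo c \<Longrightarrow> geo (\<lambda>\<alpha>. k * c \<alpha>)"
proof -
  assume "geo c"
  then obtain M K where *: "M > 0" "K > 0" "\<And>\<alpha>. norm (c \<alpha>) \<le> M * K ^ mdeg \<alpha>"
    unfolding geo_def by blast
  have "norm (k * c \<alpha>) \<le> ((norm k + 1) * M) * K ^ mdeg \<alpha>" for \<alpha>
    unfolding norm_mult mult.assoc using * by (intro mult_mono) auto
  then show ?thesis unfolding geo_def using *
    by (intro exI[of _ "(norm k + 1) * M"] conjI exI[of _ K]) (auto simp: add_nonneg_pos)
qed

lemma geo_diff: "geo c \<Longrightarrow> geo d \<Longrightarrow> geo (\<lambda>\<alpha>. c \<alpha> - d \<alpha>)"
  using geo_add[OF _ geo_scale[of d "-1"]] by simp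

lemma ev_diff:
  assumes "geo c" "geo d"
  shows "\<forall>\<^sub>F x in nhds 0. ev (\<lambda>\<alpha>. c \<alpha> - d \<alpha>) x = ev c x - ev d x"
  using ev_add[OF assms(1) geo_scale[OF assms(2), of "-1"]] ev_scale[of "-1" d] by simp

lemma geo_ev_sum:
  assumes "finite I" "\<And>i. i \<in> I \<Longrightarrow> geo (c i)"
  shows "geo (\<lambda>\<alpha>. \<Sum>i\<in>I. c i \<alpha>) \<and> (\<forall>\<^sub>F x in nhds 0. ev (\<lambda>\<alpha>. \<Sum>i\<in>I. c i \<alpha>) x = (\<Sum>i\<in>I. ev (c i) x))"
  using assms
proof (induction I rule: finite_induct)
  case empty
  show ?case by (simp add: geo_const[of 0, simplified] ev_const[of 0, simplified])
next
  case (insert i I)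
  then have IH: "geo (\<lambda>\<alpha>. \<Sum>i\<in>I. c i \<alpha>)"
    "\<forall>\<^sub>F x in nhds 0. ev (\<lambda>\<alpha>. \<Sum>i\<in>I. c i \<alpha>) x = (\<Sum>i\<in>I. ev (c i) x)" and i: "geo (c i)" by auto
  have "\<forall>\<^sub>F x in nhds 0. ev (\<lambda>\<alpha>. c i \<alpha> + (\<Sum>i\<in>I. c i \<alpha>)) x = ev (c i) x + (\<Sum>i\<in>I. ev (c i) x)"
    using IH(2) ev_add[OF i IH(1)] by eventually_elim simp
  then show ?case using insert.hyps geo_add[OF i IH(1)] by simp
qed


subsection \<open>Substitution and evaluation\<close>

lemma ev_mpow:
  assumes W: "submult W" "\<And>\<alpha>. norm (monom_at x \<alpha>) \<le> W \<alpha>" and Z: "\<And>i. wbound W (Z i) R"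
  shows "ev (mpow Z ws) x = prod_list (map (\<lambda>i. ev (Z i) x) ws)"
proof (induction ws)
  case Nil
  show ?case using ev_const[of 1 x] by (simp add: mpow_Nil)
next
  case (Cons i ws)
  have "ev (mpow Z (i # ws)) x = ev (Z i) x * ev (mpow Z ws) x"
    unfolding mpow_Cons by (rule ev_cmul_pointwise[OF abs_summable_wbound[OF Z W(2)]
          abs_summable_wbound[OF wbound_mpow[OF W(1) Z] W(2)]])
  with Cons show ?case by simp
qed

text \<open>Fubini for the double series over \<alpha> and \<nu>. The estimate \<open>fin\<close>
  serves twice: it bounds the norm of the substituted series and provides the absolute convergence
  for the interchange.\<close>

lemma ev_subst_series:
  fixes Z :: "'i::finite \<Rightarrow> nat^'d::finite \<Rightarrow> complex"
  assumes f: "geo f" and Z: "\<And>i. geo (Z i)" "\<And>i. Z i 0 = 0"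
  shows "geo (subst_series f Z) \<and> (\<forall>\<^sub>F x in nhds 0. ev (subst_series f Z) x = ev f (\<chi> i. ev (Z i) x))"
proof -
  let ?p = "undefined :: 'd"
  obtain M K where MK: "M > 0" "K > 0" "\<And>\<nu>. norm (f \<nu>) \<le> M * K ^ mdeg \<nu>"
    using f unfolding geo_def by blast
  define R where "R = 1 / (2 * K)"
  have R: "0 < R" "K * R = 1 / 2" using MK by (auto simp: R_def)
  have "\<forall>\<^sub>F \<rho> in at_right 0. \<forall>i\<in>UNIV. wbound (wt ?p 0 \<rho>) (Z i) R"
    using Z R by (intro eventually_ball_finite geo_small ballI) auto
  moreover have "\<forall>\<^sub>F \<rho> in at_right (0::real). 0 < \<rho> \<and> \<rho> \<le> 1" by (rule eventually_at_right_0I[of 1]) auto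
  ultimately have "\<forall>\<^sub>F \<rho> in at_right (0::real). 0 < \<rho> \<and> \<rho> \<le> 1 \<and> (\<forall>i. wbound (wt ?p 0 \<rho>) (Z i) R)"
    by eventually_elim auto
  then obtain \<rho> where \<rho>: "0 < \<rho>" "\<rho> \<le> 1" and ZR: "\<And>i. wbound (wt ?p 0 \<rho>) (Z i) R"
    using eventually_happens' trivial_limit_at_right_real by blast
  define W where "W = wt ?p 0 \<rho>"
  have W: "submult W" unfolding W_def using submult_wt \<rho> by blast
  define P where "P \<nu> = mpow Z (letters letter_order \<nu>)" for \<nu>
  have P: "wbound W (P \<nu>) (R ^ mdeg \<nu>)" for \<nu>
    using wbound_mpow[of W Z R "letters letter_order \<nu>", OF W ZR[folded W_def]]
    by (simp add: P_def length_letters[OF letter_order])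
  have P0: "P \<nu> \<alpha> = 0" if "mdeg \<alpha> < mdeg \<nu>" for \<nu> \<alpha>
    using that by (simp add: P_def mpow_eq_0 Z length_letters[OF letter_order])
  have fin: "(\<Sum>\<nu>\<in>S. \<Sum>\<alpha>\<in>S'. norm (f \<nu>) * (norm (P \<nu> \<alpha>) * W \<alpha>)) \<le> M * 2 ^ CARD('i)"
    if S: "finite S" "finite S'" for S S'
  proof -
    have "(\<Sum>\<nu>\<in>S. \<Sum>\<alpha>\<in>S'. norm (f \<nu>) * (norm (P \<nu> \<alpha>) * W \<alpha>)) \<le> (\<Sum>\<nu>\<in>S. norm (f \<nu>) * R ^ mdeg \<nu>)"
      unfolding sum_distrib_left[symmetric] by (intro sum_mono mult_left_mono wboundD[OF P] S) auto
    also have "\<dots> \<le> M * 2 ^ CARD('i)"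
      using MK R S by (intro wboundD[OF wbound_power_weight]) auto
    finally show ?thesis .
  qed
  have "wbound W (subst_series f Z) (M * 2 ^ CARD('i))"
  proof (rule wboundI)
    fix S :: "(nat^'d) set" assume S: "finite S"
    define n where "n = Max (insert 0 (mdeg ` S))"
    have n: "mdeg \<alpha> \<le> n" if "\<alpha> \<in> S" for \<alpha>
      using S that by (auto simp: n_def intro!: Max_ge)
    have "(\<Sum>\<alpha>\<in>S. norm (subst_series f Z \<alpha>) * W \<alpha>)
        \<le> (\<Sum>\<alpha>\<in>S. \<Sum>\<nu> | mdeg \<nu> \<le> n. norm (f \<nu>) * (norm (P \<nu> \<alpha>) * W \<alpha>))"
    proof (rule sum_mono)
      fix \<alpha> assume "\<alpha> \<in> S"
      have "norm (subst_series f Z \<alpha>) \<le> (\<Sum>\<nu> | mdeg \<nu> \<le> mdeg \<alpha>. norm (f \<nu> * P \<nu> \<alpha>))"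
        unfolding subst_series_def P_def by (rule norm_sum)
      also have "\<dots> \<le> (\<Sum>\<nu> | mdeg \<nu> \<le> n. norm (f \<nu> * P \<nu> \<alpha>))"
        using n[OF \<open>\<alpha> \<in> S\<close>] finite_mdeg_le by (intro sum_mono2) auto
      finally have le: "norm (subst_series f Z \<alpha>) \<le> (\<Sum>\<nu> | mdeg \<nu> \<le> n. norm (f \<nu> * P \<nu> \<alpha>))" .
      from mult_right_mono[OF le submult_nonneg[OF W, of \<alpha>]]
      show "norm (subst_series f Z \<alpha>) * W \<alpha> \<le> (\<Sum>\<nu> | mdeg \<nu> \<le> n. norm (f \<nu>) * (norm (P \<nu> \<alpha>) * W \<alpha>))"
        by (simp add: sum_distrib_right norm_mult mult.assoc)
    qed
    also have "\<dots> = (\<Sum>\<nu> | mdeg \<nu> \<le> n. \<Sum>\<alpha>\<in>S. norm (f \<nu>) * (norm (P \<nu> \<alpha>) * W \<alpha>))"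
      by (rule sum.swap)
    also have "\<dots> \<le> M * 2 ^ CARD('i)" using S finite_mdeg_le by (intro fin) auto
    finally show "(\<Sum>\<alpha>\<in>S. norm (subst_series f Z \<alpha>) * W \<alpha>) \<le> M * 2 ^ CARD('i)" .
  qed
  then have geo: "geo (subst_series f Z)" unfolding W_def using wbound_imp_geo \<rho> by blast
  \<comment> \<open>The radius is that of \<open>wt_lower_bound\<close>, where monomials are
    dominated by the weight \<open>W\<close>.\<close>
  have "ev (subst_series f Z) x = ev f (\<chi> i. ev (Z i) x)" if x: "\<forall>i. norm (x $ i) < \<rho>\<^sup>2 / 2" for x
  proof -
    have monom: "norm (monom_at x \<alpha>) \<le> W \<alpha>" for \<alpha>
    proof -
      have "norm (monom_at x \<alpha>) \<le> (\<rho>\<^sup>2 / 2) ^ mdeg \<alpha>"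
        using x by (intro norm_monom_at_le) (simp add: less_imp_le)
      then show ?thesis unfolding W_def using wt_lower_bound[OF \<rho>, of \<alpha> ?p 0] by linarith
    qed
    define F where "F \<alpha> \<nu> = f \<nu> * (P \<nu> \<alpha> * monom_at x \<alpha>)" for \<alpha> \<nu>
    have "(\<lambda>q. norm (F (fst q) (snd q))) summable_on UNIV \<times> UNIV"
      unfolding abs_summable_iff_bdd_above
    proof (rule bdd_aboveI2)
      fix S :: "((nat^'d) \<times> (nat^'i)) set" assume "S \<in> {F. F \<subseteq> UNIV \<times> UNIV \<and> finite F}"
      then have S: "finite S" by simp
      have "(\<Sum>q\<in>S. norm (F (fst q) (snd q)))
          \<le> (\<Sum>q\<in>fst ` S \<times> snd ` S. norm (F (fst q) (snd q)))"
        using S by (intro sum_mono2) (auto simp: image_iff, force+)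
      also have "\<dots> = (\<Sum>\<nu>\<in>snd ` S. \<Sum>\<alpha>\<in>fst ` S. norm (F \<alpha> \<nu>))"
        by (subst sum.swap) (simp add: sum.cartesian_product case_prod_unfold)
      also have "\<dots> \<le> (\<Sum>\<nu>\<in>snd ` S. \<Sum>\<alpha>\<in>fst ` S. norm (f \<nu>) * (norm (P \<nu> \<alpha>) * W \<alpha>))"
        by (intro sum_mono) (auto simp: F_def norm_mult intro!: mult_left_mono monom)
      also have "\<dots> \<le> M * 2 ^ CARD('i)" using S by (intro fin) auto
      finally show "(\<Sum>q\<in>S. norm (F (fst q) (snd q))) \<le> M * 2 ^ CARD('i)" .
    qed
    then have swap: "(\<Sum>\<^sub>\<infinity>\<alpha>. \<Sum>\<^sub>\<infinity>\<nu>. F \<alpha> \<nu>) = (\<Sum>\<^sub>\<infinity>\<nu>. \<Sum>\<^sub>\<infinity>\<alpha>. F \<alpha> \<nu>)"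
      using abs_summable_summable[of "\<lambda>q. F (fst q) (snd q)"]
      by (intro infsum_swap_banach) (simp add: case_prod_unfold)
    have "(\<Sum>\<^sub>\<infinity>\<nu>. F \<alpha> \<nu>) = subst_series f Z \<alpha> * monom_at x \<alpha>" for \<alpha>
    proof -
      have "(\<Sum>\<^sub>\<infinity>\<nu>. F \<alpha> \<nu>) = (\<Sum>\<^sub>\<infinity>\<nu>\<in>{\<nu>. mdeg \<nu> \<le> mdeg \<alpha>}. F \<alpha> \<nu>)"
        by (rule infsum_cong_neutral) (auto simp: F_def P0)
      then show ?thesis
        by (simp add: finite_mdeg_le subst_series_def F_def P_def sum_distrib_right mult.assoc)
    qed
    moreover have "(\<Sum>\<^sub>\<infinity>\<alpha>. F \<alpha> \<nu>) = f \<nu> * monom_at (\<chi> i. ev (Z i) x) \<nu>" for \<nu>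
      unfolding F_def infsum_cmult_right' ev_def[symmetric]
      unfolding P_def
      by (subst ev_mpow[OF W monom ZR[folded W_def]])
        (simp add: prod_list_letters[OF letter_order] monom_at_def)
    ultimately show ?thesis using swap by (simp add: ev_def)
  qed
  then have "\<forall>\<^sub>F x in nhds 0. ev (subst_series f Z) x = ev f (\<chi> i. ev (Z i) x)"
    using eventually_components_less[of "\<rho>\<^sup>2 / 2"] \<rho> by (auto elim!: eventually_mono)
  with geo show ?thesis by simp
qed


subsection \<open>Differentiation of power series\<close>

definition pd :: "'d \<Rightarrow> (nat^'d::finite \<Rightarrow> complex) \<Rightarrow> nat^'d \<Rightarrow> complex" where
  "pd i c \<alpha> = (of_nat (\<alpha> $ i) + 1) * c (\<alpha> + axis i 1)"

lemma geo_pd: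
  assumes "geo c"
  shows "geo (pd i c)"
proof -
  obtain M K where MK: "M > 0" "K > 0" "\<And>\<alpha>. norm (c \<alpha>) \<le> M * K ^ mdeg \<alpha>"
    using assms unfolding geo_def by blast
  have "norm (pd i c \<alpha>) \<le> (M * K) * (2 * K) ^ mdeg \<alpha>" for \<alpha>
  proof -
    have "norm (of_nat (\<alpha> $ i) + 1 :: complex) = 1 + real (\<alpha> $ i)"
      using norm_of_nat[of "Suc (\<alpha> $ i)", where ?'a = complex] by (simp add: add.commute)
    also have "\<dots> \<le> 2 ^ mdeg \<alpha>"
      using real_le_two_power[of "\<alpha> $ i"] power_increasing[OF component_le_mdeg[of \<alpha> i], of "2::real"]
      by linarith
    finally have "norm (pd i c \<alpha>) \<le> 2 ^ mdeg \<alpha> * (M * K ^ mdeg (\<alpha> + axis i 1))"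
      unfolding pd_def norm_mult by (intro mult_mono MK(3)) auto
    then show ?thesis by (simp add: power_mult_distrib mult_ac)
  qed
  then show ?thesis unfolding geo_def using MK
    by (intro exI[of _ "M * K"] conjI exI[of _ "2 * K"]) auto
qed

lemma infinite_multiindices: "infinite (UNIV :: (nat^'d::finite) set)"
proof
  assume "finite (UNIV :: (nat^'d) set)"
  then have "finite (mdeg ` range (axis (undefined :: 'd)))"
    by (meson finite_imageI finite_subset top_greatest)
  moreover have "mdeg ` range (axis (undefined :: 'd)) = UNIV"
    by (auto simp: image_iff)
  ultimately show False by simp
qed

lemma has_derivative_monom_at:
  "((\<lambda>x. monom_at x \<alpha>) has_derivative
      (\<lambda>h. \<Sum>i\<in>UNIV. h $ i * (of_nat (\<alpha> $ i) * monom_at x (\<alpha> - axis i 1)))) (at x)"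
proof -
  have comp: "((\<lambda>x. (x $ i) ^ (\<alpha> $ i)) has_derivative
      (\<lambda>h. h $ i * (of_nat (\<alpha> $ i) * (x $ i) ^ (\<alpha> $ i - 1)))) (at x)" for i
    by (auto intro!: derivative_eq_intros bounded_linear.has_derivative[OF bounded_linear_vec_nth] simp: mult_ac)
  have eq: "(of_nat (\<alpha> $ i) * (x $ i) ^ (\<alpha> $ i - 1)) * (\<Prod>j\<in>UNIV - {i}. (x $ j) ^ (\<alpha> $ j))
      = of_nat (\<alpha> $ i) * monom_at x (\<alpha> - axis i 1)" for i
  proof -
    have "monom_at x (\<alpha> - axis i 1) = (x $ i) ^ (\<alpha> $ i - 1) * (\<Prod>j\<in>UNIV - {i}. (x $ j) ^ (\<alpha> $ j))"
      unfolding monom_at_def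
      by (subst prod.remove[of _ i]) (auto simp: axis_def intro!: arg_cong2[of _ _ _ _ "(*)"] prod.cong)
    then show ?thesis by simp
  qed
  have "((\<lambda>x. monom_at x \<alpha>) has_derivative
      (\<lambda>h. \<Sum>i\<in>UNIV. h $ i * (of_nat (\<alpha> $ i) * (x $ i) ^ (\<alpha> $ i - 1)) * (\<Prod>j\<in>UNIV - {i}. (x $ j) ^ (\<alpha> $ j)))) (at x)"
    unfolding monom_at_def by (rule has_derivative_prod[OF comp])
  then show ?thesis by (simp only: mult.assoc eq[unfolded mult.assoc])
qed

lemma has_sum_finite_sum:
  fixes f :: "'i \<Rightarrow> 'a \<Rightarrow> complex"
  assumes "finite I" "\<And>i. i \<in> I \<Longrightarrow> (f i has_sum S i) A"
  shows "((\<lambda>x. \<Sum>i\<in>I. f i x) has_sum (\<Sum>i\<in>I. S i)) A"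
  using assms by (induction I rule: finite_induct) (auto intro: has_sum_add)

lemma has_sum_pd:
  assumes "(\<lambda>\<alpha>. norm (pd i c \<alpha> * monom_at x \<alpha>)) summable_on UNIV"
  shows "((\<lambda>\<alpha>. c \<alpha> * (of_nat (\<alpha> $ i) * monom_at x (\<alpha> - axis i 1))) has_sum ev (pd i c) x) UNIV"
proof -
  define g where "g \<alpha> = c \<alpha> * (of_nat (\<alpha> $ i) * monom_at x (\<alpha> - axis i 1))" for \<alpha>
  have "pd i c \<beta> * monom_at x \<beta> = g (\<beta> + axis i 1)" for \<beta>
  proof -
    have "\<beta> + axis i 1 - axis i 1 = \<beta>" by (simp add: vec_eq_iff)
    then show ?thesis by (simp add: g_def pd_def axis_def[of i 1] mult_ac)
  qed
  then have "((g \<circ> (\<lambda>\<beta>. \<beta> + axis i 1)) has_sum ev (pd i c) x) UNIV"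
    using abs_summable_has_sum_ev[OF assms] by (simp add: o_def)
  then have "(g has_sum ev (pd i c) x) (range (\<lambda>\<beta>. \<beta> + axis i 1))"
    by (subst has_sum_reindex) (auto intro: injI)
  moreover have "g \<alpha> = 0" if "\<alpha> \<notin> range (\<lambda>\<beta>. \<beta> + axis i 1)" for \<alpha>
  proof -
    have "\<alpha> $ i = 0"
      using that axis_add_diff[of \<alpha> i] by (metis add.commute not_less_eq_eq One_nat_def le0 le_zero_eq range_eqI)
    then show ?thesis by (simp add: g_def)
  qed
  moreover have "(g has_sum ev (pd i c) x) UNIV \<longleftrightarrow> (g has_sum ev (pd i c) x) (range (\<lambda>\<beta>. \<beta> + axis i 1))"
    by (rule has_sum_cong_neutral) (use calculation(2) in auto)
  ultimately have "(g has_sum ev (pd i c) x) UNIV" by blast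
  then show ?thesis by (simp add: g_def[abs_def])
qed

text \<open>Termwise differentiation on a convex polydisc, justified by a summable majorant of the
  differentials that is uniform in the point.\<close>

lemma ev_has_derivative:
  fixes c :: "nat^'d::finite \<Rightarrow> complex"
  assumes "geo c"
  shows "\<forall>\<^sub>F x in nhds 0. (ev c has_derivative (\<lambda>h. \<Sum>i\<in>UNIV. h $ i * ev (pd i c) x)) (at x)"
proof -
  obtain M K where MK: "M > 0" "K > 0" "\<And>\<alpha>. norm (c \<alpha>) \<le> M * K ^ mdeg \<alpha>"
    using assms unfolding geo_def by blast
  have "\<forall>i. \<exists>r>0. \<forall>x. (\<forall>j. norm (x $ j) \<le> r) \<longrightarrow> (\<lambda>\<alpha>. norm (pd i c \<alpha> * monom_at x \<alpha>)) summable_on UNIV"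
    using geo_abs_summable[OF geo_pd[OF assms]] by blast
  then obtain ri where ri: "\<And>i. ri i > 0"
    "\<And>i x. (\<forall>j. norm (x $ j) \<le> ri i) \<Longrightarrow> (\<lambda>\<alpha>. norm (pd i c \<alpha> * monom_at x \<alpha>)) summable_on UNIV"
    by metis
  obtain r0 where r0: "r0 > 0" "\<And>x. (\<forall>i. norm (x $ i) \<le> r0) \<Longrightarrow> (\<lambda>\<alpha>. norm (c \<alpha> * monom_at x \<alpha>)) summable_on UNIV"
    using geo_abs_summable[OF assms] by blast
  \<comment> \<open>The first entry gives \<open>2 * K * r \<le> 1 / 2\<close>, the 2 absorbing the
    exponent brought down by differentiation; the others keep the series and all its formal
    derivatives summable.\<close>
  define r where "r = Min (insert (1 / (4 * K)) (insert r0 (range ri)))"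
  have r: "r > 0" "r \<le> r0" "\<And>i. r \<le> ri i" "2 * K * r \<le> 1 / 2"
  proof -
    show "r > 0" unfolding r_def using MK r0 ri by (subst Min_gr_iff) auto
    show "r \<le> r0" unfolding r_def by (rule Min_le) auto
    show "r \<le> ri i" for i unfolding r_def by (rule Min_le) auto
    have "r \<le> 1 / (4 * K)" unfolding r_def by (rule Min_le) auto
    then have "2 * K * r \<le> 2 * K * (1 / (4 * K))" using MK by (intro mult_left_mono) auto
    then show "2 * K * r \<le> 1 / 2" using MK by simp
  qed
  define S where "S = {x :: complex^'d. \<forall>i. norm (x $ i) < r}"
  have openS: "open S"
    unfolding S_def Collect_all_eq by (intro open_INT ballI open_Collect_less continuous_intros) auto
  have convS: "convex S"
  proof -
    have "S = (\<Inter>i. (\<lambda>x. x $ i) -` ball 0 r)" by (auto simp: S_def)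
    then show ?thesis
      by (auto intro!: convex_INT convex_linear_vimage bounded_linear.linear[OF bounded_linear_vec_nth])
  qed
  obtain e :: "nat \<Rightarrow> nat^'d" where e: "bij e"
    using bij_betw_from_nat_into[OF countableI_type infinite_multiindices] by blast
  define f where "f n x = c (e n) * monom_at x (e n)" for n x
  define f' where "f' n x h = c (e n) * (\<Sum>i\<in>UNIV. h $ i * (of_nat (e n $ i) * monom_at x (e n - axis i 1)))" for n x and h :: "complex^'d"
  define g' where "g' x h = (\<Sum>i\<in>UNIV. h $ i * ev (pd i c) x)" for x and h :: "complex^'d"
  \<comment> \<open>The majorant: one term per coordinate, and a division by \<open>r\<close>
    because differentiation lowers the degree by one.\<close>
  define E where "E n = M * (real CARD('d) / r) * (1 / 2) ^ mdeg (e n)" for n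
  have "wbound (\<lambda>\<alpha>. (1 / 2) ^ mdeg \<alpha>) (\<lambda>\<alpha>::nat^'d. 1) (1 * 2 ^ CARD('d))"
    by (rule wbound_power_weight[of _ 1 1]) auto
  then have "(\<lambda>\<alpha>::nat^'d. (1 / 2 :: real) ^ mdeg \<alpha>) summable_on UNIV"
    by (intro nonneg_bdd_above_summable_on bdd_aboveI2) (auto simp: wbound_def)
  then have "((\<lambda>\<alpha>::nat^'d. (1 / 2 :: real) ^ mdeg \<alpha>) \<circ> e) summable_on UNIV"
    using summable_on_reindex_bij_betw[OF e, of "\<lambda>\<alpha>. (1 / 2 :: real) ^ mdeg \<alpha>"] by (simp add: o_def)
  then have sumE: "summable E"
    unfolding E_def by (intro summable_mult summable_on_imp_summable) (simp add: o_def)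
  have E0: "0 \<le> E n" for n unfolding E_def using MK r by auto
  have f'E: "norm (f' n x h) \<le> E n * norm h" if x: "x \<in> S" for n x h
  proof -
    let ?\<alpha> = "e n"
    have term_le: "norm (h $ i * (of_nat (?\<alpha> $ i) * monom_at x (?\<alpha> - axis i 1)))
        \<le> norm h * ((2 * r) ^ mdeg ?\<alpha> / r)" for i
    proof (cases "?\<alpha> $ i")
      case 0
      then show ?thesis using r by simp
    next
      case (Suc k)
      then have "axis i 1 + (?\<alpha> - axis i 1) = ?\<alpha>" by (intro axis_add_diff) auto
      then have m: "mdeg ?\<alpha> = Suc (mdeg (?\<alpha> - axis i 1))" by (metis mdeg_add mdeg_axis plus_1_eq_Suc)
      have "norm (monom_at x (?\<alpha> - axis i 1)) \<le> r ^ mdeg (?\<alpha> - axis i 1)"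
        using x by (intro norm_monom_at_le) (simp add: S_def less_imp_le)
      also have "\<dots> = r ^ mdeg ?\<alpha> / r" using r by (simp add: m)
      finally have 1: "norm (monom_at x (?\<alpha> - axis i 1)) \<le> r ^ mdeg ?\<alpha> / r" .
      have 2: "real (?\<alpha> $ i) \<le> 2 ^ mdeg ?\<alpha>"
        using real_le_two_power[of "?\<alpha> $ i"] power_increasing[OF component_le_mdeg[of ?\<alpha> i], of "2::real"]
        by linarith
      have "norm (h $ i) * (real (?\<alpha> $ i) * norm (monom_at x (?\<alpha> - axis i 1)))
          \<le> norm h * (2 ^ mdeg ?\<alpha> * (r ^ mdeg ?\<alpha> / r))"
        using 1 2 r by (intro mult_mono Finite_Cartesian_Product.norm_nth_le) auto
      then show ?thesis by (simp add: norm_mult power_mult_distrib)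
    qed
    have "norm (\<Sum>i\<in>UNIV. h $ i * (of_nat (?\<alpha> $ i) * monom_at x (?\<alpha> - axis i 1)))
        \<le> (\<Sum>i\<in>(UNIV :: 'd set). norm h * ((2 * r) ^ mdeg ?\<alpha> / r))"
      by (intro sum_norm_le term_le)
    then have "norm (f' n x h) \<le> (M * K ^ mdeg ?\<alpha>) * (real CARD('d) * (norm h * ((2 * r) ^ mdeg ?\<alpha> / r)))"
      unfolding f'_def norm_mult using MK by (intro mult_mono) auto
    also have "\<dots> = M * (real CARD('d) / r) * (2 * K * r) ^ mdeg ?\<alpha> * norm h"
      by (simp add: power_mult_distrib)
    also have "\<dots> \<le> M * (real CARD('d) / r) * (1 / 2) ^ mdeg ?\<alpha> * norm h"
      using MK r by (intro mult_right_mono mult_left_mono power_mono) auto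
    finally show ?thesis by (simp add: E_def)
  qed
  have f's: "(\<lambda>n. f' n x h) sums g' x h" if x: "x \<in> S" for x h
  proof -
    have "((\<lambda>\<alpha>. c \<alpha> * (of_nat (\<alpha> $ i) * monom_at x (\<alpha> - axis i 1))) has_sum ev (pd i c) x) UNIV" for i
    proof (intro has_sum_pd ri(2) allI)
      show "norm (x $ j) \<le> ri i" for j
        using x r(3)[of i] less_le_trans less_imp_le unfolding S_def by blast
    qed
    then have "((\<lambda>\<alpha>. \<Sum>i\<in>UNIV. h $ i * (c \<alpha> * (of_nat (\<alpha> $ i) * monom_at x (\<alpha> - axis i 1)))) has_sum g' x h) UNIV"
      unfolding g'_def by (intro has_sum_finite_sum has_sum_cmult_right) auto
    then have "((\<lambda>n. \<Sum>i\<in>UNIV. h $ i * (c (e n) * (of_nat (e n $ i) * monom_at x (e n - axis i 1)))) has_sum g' x h) UNIV"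
      using has_sum_reindex_bij_betw[OF e, of "\<lambda>\<alpha>. \<Sum>i\<in>UNIV. h $ i * (c \<alpha> * (of_nat (\<alpha> $ i) * monom_at x (\<alpha> - axis i 1)))"] by simp
    then have "((\<lambda>n. f' n x h) has_sum g' x h) UNIV"
      by (simp add: f'_def sum_distrib_left mult_ac)
    then show ?thesis by (rule has_sum_imp_sums)
  qed
  have fs: "(\<lambda>n. f n x) sums ev c x" if x: "x \<in> S" for x
  proof -
    have "((\<lambda>\<alpha>. c \<alpha> * monom_at x \<alpha>) has_sum ev c x) UNIV"
    proof (intro abs_summable_has_sum_ev r0(2) allI)
      show "norm (x $ i) \<le> r0" for i
        using x r(2) less_le_trans less_imp_le unfolding S_def by blast
    qed
    then have "((\<lambda>n. f n x) has_sum ev c x) UNIV"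
      using has_sum_reindex_bij_betw[OF e, of "\<lambda>\<alpha>. c \<alpha> * monom_at x \<alpha>"] by (simp add: f_def)
    then show ?thesis by (rule has_sum_imp_sums)
  qed
  have zero: "0 \<in> S" using r by (simp add: S_def)
  have "\<exists>g. \<forall>x\<in>S. (\<lambda>n. f n x) sums g x \<and> (g has_derivative g' x) (at x within S)"
  proof (rule has_derivative_series[where f = f, OF convS _ _ zero fs[OF zero]])
    fix n x assume "x \<in> S"
    show "(f n has_derivative f' n x) (at x within S)"
      unfolding f_def f'_def
      by (rule has_derivative_mult_right[OF has_derivative_at_withinI[OF has_derivative_monom_at]])
  next
    fix \<epsilon> :: real assume "\<epsilon> > 0"
    obtain N where N: "\<And>n. n \<ge> N \<Longrightarrow> norm (\<Sum>i. E (i + n)) < \<epsilon>"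
      using suminf_exist_split[OF \<open>\<epsilon> > 0\<close> sumE] by blast
    show "\<forall>\<^sub>F n in sequentially. \<forall>x\<in>S. \<forall>h. norm (sum (\<lambda>i. f' i x h) {..<n} - g' x h) \<le> \<epsilon> * norm h"
      unfolding eventually_sequentially
    proof (intro exI[of _ N] allI impI ballI)
      fix n x and h :: "complex^'d" assume n: "N \<le> n" and x: "x \<in> S"
      have s: "summable (\<lambda>i. f' i x h)" using f's[OF x] by (rule sums_summable)
      have "g' x h = (\<Sum>i. f' i x h)" using f's[OF x] by (rule sums_unique)
      also have "\<dots> = (\<Sum>i. f' (i + n) x h) + sum (\<lambda>i. f' i x h) {..<n}"
        by (rule suminf_split_initial_segment[OF s])
      finally have "norm (sum (\<lambda>i. f' i x h) {..<n} - g' x h) = norm (\<Sum>i. f' (i + n) x h)"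
        by (simp add: norm_minus_commute)
      also have "\<dots> \<le> (\<Sum>i. E (i + n) * norm h)"
        using sumE f'E[OF x] by (intro norm_suminf_le summable_mult2) (auto simp: summable_iff_shift)
      also have "\<dots> = (\<Sum>i. E (i + n)) * norm h"
        using sumE by (intro suminf_mult2[symmetric]) (simp add: summable_iff_shift)
      also have "\<dots> \<le> \<epsilon> * norm h"
        using N[OF n] by (intro mult_right_mono) auto
      finally show "norm (sum (\<lambda>i. f' i x h) {..<n} - g' x h) \<le> \<epsilon> * norm h" .
    qed
  qed
  then obtain g where g: "\<And>x. x \<in> S \<Longrightarrow> (\<lambda>n. f n x) sums g x"
    "\<And>x. x \<in> S \<Longrightarrow> (g has_derivative g' x) (at x within S)" by blast
  have "(ev c has_derivative g' x) (at x)" if x: "x \<in> S" for x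
  proof (rule has_derivative_transform_within_open[OF _ openS x])
    show "(g has_derivative g' x) (at x)" using g(2)[OF x] unfolding at_within_open[OF x openS] .
    show "g y = ev c y" if "y \<in> S" for y using g(1)[OF that] fs[OF that] by (rule sums_unique2)
  qed
  then show ?thesis
    using eventually_components_less[OF r(1)] by (auto simp: S_def g'_def[abs_def] elim!: eventually_mono)
qed


subsection \<open>Holomorphic functions of several variables are analytic\<close>

text \<open>The n-th Taylor coefficient in v is the limit, as v tends to 0, of the remainder of
  order n divided by v^n; by induction these quotients are holomorphic in u. The common bound
  \<open>M\<close> and Cauchy's inequality make the convergence uniform in u, so separate holomorphy
  suffices and joint continuity is not invoked.\<close>

lemma taylor_coeff_holomorphic:
  fixes h :: "complex \<Rightarrow> complex \<Rightarrow> complex"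
  assumes r: "0 < r" and hu: "\<And>v. v \<in> ball 0 r \<Longrightarrow> (\<lambda>u. h u v) holomorphic_on ball 0 r"
    and hv: "\<And>u. u \<in> ball 0 r \<Longrightarrow> h u holomorphic_on ball 0 r"
    and M: "\<And>u v. u \<in> ball 0 r \<Longrightarrow> v \<in> ball 0 r \<Longrightarrow> norm (h u v) \<le> M"
  shows "(\<lambda>u. (deriv ^^ n) (h u) 0 / fact n) holomorphic_on ball 0 r"
proof (induction n rule: less_induct)
  case (less n)
  define c where "c n u = (deriv ^^ n) (h u) 0 / fact n" for n u
  define s where "s = r / 2"
  have s: "0 < s" "s < r" using r by (auto simp: s_def)
  have M0: "0 \<le> M" using order_trans[OF norm_ge_zero M[of 0 0]] r by simp
  have c: "norm (c n u) \<le> M / s ^ n" if "u \<in> ball 0 r" for n u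
  proof -
    have "norm ((deriv ^^ n) (h u) 0) \<le> fact n * M / s ^ n"
    proof (rule Cauchy_inequality)
      show "h u holomorphic_on ball 0 s"
        by (rule holomorphic_on_subset[OF hv[OF that]]) (use s in auto)
      show "continuous_on (cball 0 s) (h u)"
        by (rule continuous_on_subset[OF holomorphic_on_imp_continuous_on[OF hv[OF that]]]) (use s in auto)
      show "norm (h u x) \<le> M" if "norm (0 - x) = s" for x
        using M[OF \<open>u \<in> ball 0 r\<close>, of x] that s by simp
    qed (rule s)
    then show ?thesis by (simp add: c_def norm_divide field_simps)
  qed
  \<comment> \<open>The shift by 2 keeps the ratio of \<open>v m\<close> to \<open>s\<close> at most
    1/2, so the geometric tail costs at most a factor 2.\<close>
  define v where "v m = s / (real m + 2)" for m
  have v: "0 < v m" "v m < s" "v m / s = 1 / (real m + 2)" for m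
    using s by (auto simp: v_def divide_simps)
  define f where "f m u = (h u (v m) - (\<Sum>i<n. c i u * of_real (v m) ^ i)) / of_real (v m) ^ n" for m u
  have rem: "norm (f m u - c n u) \<le> 2 * M / s ^ n * (1 / (real m + 2))" if u: "u \<in> ball 0 r" for m u
  proof -
    let ?v = "complex_of_real (v m)"
    define q where "q = v m / s"
    have q: "0 < q" "q \<le> 1 / 2" using v(1,3)[of m] s by (auto simp: q_def)
    have nv: "norm ?v = v m" using v(1)[of m] by simp
    have "(\<lambda>i. c i u * ?v ^ i) sums h u ?v"
      using holomorphic_power_series[OF hv[OF u], of ?v] v[of m] s by (simp add: c_def)
    then have sm: "summable (\<lambda>i. c i u * ?v ^ i)" and eq: "h u ?v = (\<Sum>i. c i u * ?v ^ i)"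
      by (auto simp: sums_iff)
    have "h u ?v - (\<Sum>i<Suc n. c i u * ?v ^ i) = (\<Sum>i. c (i + Suc n) u * ?v ^ (i + Suc n))"
      using suminf_split_initial_segment[OF sm, of "Suc n"] eq by simp
    also have "norm \<dots> \<le> (\<Sum>i. M * q ^ Suc n * q ^ i)"
    proof (rule norm_suminf_le)
      fix i
      have "norm (c (i + Suc n) u * ?v ^ (i + Suc n)) \<le> M / s ^ (i + Suc n) * v m ^ (i + Suc n)"
        unfolding norm_mult norm_power nv by (intro mult_right_mono c[OF u]) (use v(1)[of m] in auto)
      also have "\<dots> = M * q ^ Suc n * q ^ i" by (simp add: q_def power_divide power_add mult_ac)
      finally show "norm (c (i + Suc n) u * ?v ^ (i + Suc n)) \<le> M * q ^ Suc n * q ^ i" .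
    next
      show "summable (\<lambda>i. M * q ^ Suc n * q ^ i)"
        using q by (intro summable_mult summable_geometric) auto
    qed
    also have "\<dots> = M * q ^ Suc n * (1 / (1 - q))"
      using q by (subst suminf_mult) (auto simp: suminf_geometric intro: summable_geometric)
    also have "\<dots> \<le> M * q ^ Suc n * 2"
      using q M0 by (intro mult_left_mono) (auto simp: divide_simps)
    finally have "norm (h u ?v - (\<Sum>i<Suc n. c i u * ?v ^ i)) \<le> M * q ^ Suc n * 2" .
    moreover have "f m u - c n u = (h u ?v - (\<Sum>i<Suc n. c i u * ?v ^ i)) / ?v ^ n"
      using v(1)[of m] by (simp add: f_def field_simps)
    ultimately have "norm (f m u - c n u) \<le> M * q ^ Suc n * 2 / v m ^ n"
      unfolding norm_divide norm_power nv using v(1)[of m] by (simp add: norm_divide norm_power divide_right_mono)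
    also have "\<dots> = 2 * M / s ^ n * q" using v(1)[of m] s by (simp add: q_def power_divide mult_ac)
    finally show ?thesis by (simp only: v(3) q_def)
  qed
  have "c n holomorphic_on ball 0 r"
  proof (rule holomorphic_uniform_sequence[where f = f])
    fix m
    have "of_real (v m) \<in> ball (0 :: complex) r" using v[of m] s by simp
    then show "f m holomorphic_on ball 0 r"
      unfolding f_def using less.IH v(1)[of m] by (intro holomorphic_intros hu) (auto simp: c_def)
  next
    fix x :: complex assume "x \<in> ball 0 r"
    then obtain d where d: "0 < d" "cball x d \<subseteq> ball 0 r"
      using open_contains_cball[of "ball (0::complex) r"] open_ball by blast
    have "uniform_limit (cball x d) f (c n) sequentially"
    proof (rule uniform_limitI)
      fix e :: real assume "0 < e"
      have "(\<lambda>m. 2 * M / s ^ n * (1 / (real m + 2))) \<longlonglongrightarrow> 2 * M / s ^ n * 0"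
        by (intro tendsto_mult tendsto_const) real_asymp
      then have "\<forall>\<^sub>F m in sequentially. 2 * M / s ^ n * (1 / (real m + 2)) < e"
        using \<open>0 < e\<close> by (intro order_tendstoD(2)[of _ "2 * M / s ^ n * 0"]) auto
      then show "\<forall>\<^sub>F m in sequentially. \<forall>u\<in>cball x d. dist (f m u) (c n u) < e"
      proof eventually_elim
        case (elim m)
        show ?case
        proof
          fix u assume "u \<in> cball x d"
          with d(2) have "u \<in> ball 0 r" by blast
          from le_less_trans[OF rem[OF this] elim] show "dist (f m u) (c n u) < e"
            by (simp add: dist_norm)
        qed
      qed
    qed
    with d show "\<exists>d>0. cball x d \<subseteq> ball 0 r \<and> uniform_limit (cball x d) f (c n) sequentially" by blast
  qed simp
  then show ?case by (simp add: c_def[abs_def])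
qed

section \<open>Iterated one-variable Taylor expansion on polydiscs\<close>

definition upd :: "complex^'d::finite \<Rightarrow> 'd \<Rightarrow> complex \<Rightarrow> complex^'d" where
  "upd x i t = (\<chi> j. if j = i then t else x $ j)"

lemma upd_nth: "upd x i t $ j = (if j = i then t else x $ j)"
  by (simp add: upd_def)

lemma upd_same [simp]: "upd (upd x i t) i t' = upd x i t'"
  by (simp add: vec_eq_iff upd_nth)

lemma upd_triv [simp]: "upd x i (x $ i) = x"
  by (simp add: vec_eq_iff upd_nth)

lemma upd_commute: "i \<noteq> j \<Longrightarrow> upd (upd x i t) j t' = upd (upd x j t') i t"
  by (auto simp: vec_eq_iff upd_nth)

definition polydisc :: "real \<Rightarrow> (complex^'d::finite) set" where
  "polydisc r = {x. \<forall>j. norm (x $ j) < r}"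

lemma polydisc_upd: "x \<in> polydisc r \<Longrightarrow> norm t < r \<Longrightarrow> upd x i t \<in> polydisc r"
  by (simp add: polydisc_def upd_nth)

text \<open>The invariant of the iteration: it is inherited by Taylor coefficients in any one
  variable on the same polydisc, with \<open>M\<close> replaced by \<open>M / s ^ n\<close>.\<close>

definition sep_bdd :: "real \<Rightarrow> real \<Rightarrow> (complex^'d::finite \<Rightarrow> complex) \<Rightarrow> bool" where
  "sep_bdd r M f \<longleftrightarrow> (\<forall>x\<in>polydisc r. norm (f x) \<le> M) \<and>
     (\<forall>x\<in>polydisc r. \<forall>i. (\<lambda>t. f (upd x i t)) holomorphic_on ball 0 r)"

definition taylor_coeff :: "'d \<Rightarrow> nat \<Rightarrow> (complex^'d::finite \<Rightarrow> complex) \<Rightarrow> complex^'d \<Rightarrow> complex" where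
  "taylor_coeff i n f x = (deriv ^^ n) (\<lambda>t. f (upd x i t)) 0 / fact n"

lemma taylor_coeff_bound:
  assumes f: "sep_bdd r M f" and s: "0 < s" "s < r" and x: "x \<in> polydisc r"
  shows "norm (taylor_coeff i n f x) \<le> M / s ^ n"
proof -
  let ?g = "\<lambda>t. f (upd x i t)"
  have hol: "?g holomorphic_on ball 0 r" using f x by (auto simp: sep_bdd_def)
  have "norm ((deriv ^^ n) ?g 0) \<le> fact n * M / s ^ n"
  proof (rule Cauchy_inequality)
    show "?g holomorphic_on ball 0 s" by (rule holomorphic_on_subset[OF hol]) (use s in auto)
    show "continuous_on (cball 0 s) ?g"
      by (rule continuous_on_subset[OF holomorphic_on_imp_continuous_on[OF hol]]) (use s in auto)
    show "norm (?g t) \<le> M" if "norm (0 - t) = s" for t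
      using f polydisc_upd[OF x, of t i] that s by (auto simp: sep_bdd_def)
  qed (rule s)
  then show ?thesis by (simp add: taylor_coeff_def norm_divide field_simps)
qed

lemma sep_bdd_taylor_coeff:
  assumes f: "sep_bdd r M f" and s: "0 < s" "s < r"
  shows "sep_bdd r (M / s ^ n) (taylor_coeff i n f)"
  unfolding sep_bdd_def
proof (intro conjI ballI allI)
  show "norm (taylor_coeff i n f x) \<le> M / s ^ n" if "x \<in> polydisc r" for x
    using taylor_coeff_bound[OF f s that] .
next
  fix x :: "complex^'a" and j assume x: "x \<in> polydisc r"
  show "(\<lambda>t. taylor_coeff i n f (upd x j t)) holomorphic_on ball 0 r"
  proof (cases "j = i")
    case True
    then show ?thesis by (simp add: taylor_coeff_def)
  next
    case False
    have "(\<lambda>u. (deriv ^^ n) (\<lambda>v. f (upd (upd x j u) i v)) 0 / fact n) holomorphic_on ball 0 r"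
    proof (rule taylor_coeff_holomorphic)
      show "0 < r" using s by simp
      show "(\<lambda>v. f (upd (upd x j u) i v)) holomorphic_on ball 0 r" if "u \<in> ball 0 r" for u
        using f polydisc_upd[OF x, of u j] that by (auto simp: sep_bdd_def)
      show "(\<lambda>u. f (upd (upd x j u) i v)) holomorphic_on ball 0 r" if "v \<in> ball 0 r" for v
        using f polydisc_upd[OF x, of v i] that by (auto simp: sep_bdd_def upd_commute[OF False])
      show "norm (f (upd (upd x j u) i v)) \<le> M" if "u \<in> ball 0 r" "v \<in> ball 0 r" for u v
        using f polydisc_upd[OF polydisc_upd[OF x, of u j], of v i] that by (auto simp: sep_bdd_def)
    qed
    then show ?thesis by (simp add: taylor_coeff_def)
  qed
qed

lemma taylor_coeff_upd:
  assumes "j = i \<or> (\<forall>x t. f (upd x j t) = f x)"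
  shows "taylor_coeff i n f (upd x j t) = taylor_coeff i n f x"
  using assms
proof (cases "j = i")
  case False
  then show ?thesis using assms by (simp add: taylor_coeff_def upd_commute[OF False])
qed (simp add: taylor_coeff_def)

lemma taylor_coeff_has_sum:
  assumes f: "sep_bdd r M f" and x: "x \<in> polydisc r"
  shows "((\<lambda>n. taylor_coeff i n f x * (x $ i) ^ n) has_sum f x) UNIV"
proof -
  have xi: "norm (x $ i) < r" using x by (simp add: polydisc_def)
  then obtain s where s: "norm (x $ i) < s" "s < r" using dense by blast
  have s0: "0 < s" using s norm_ge_zero[of "x $ i"] by linarith
  have "(\<lambda>t. f (upd x i t)) holomorphic_on ball 0 r" using f x by (auto simp: sep_bdd_def)
  from holomorphic_power_series[OF this, of "x $ i"]
  have sums: "(\<lambda>n. taylor_coeff i n f x * (x $ i) ^ n) sums f x"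
    using xi by (simp add: taylor_coeff_def)
  have "summable (\<lambda>n. norm (taylor_coeff i n f x * (x $ i) ^ n))"
  proof (rule summable_comparison_test')
    show "summable (\<lambda>n. M * (norm (x $ i) / s) ^ n)"
      using s s0 by (intro summable_mult summable_geometric) auto
    fix n :: nat
    have "norm (taylor_coeff i n f x * (x $ i) ^ n) \<le> M / s ^ n * norm (x $ i) ^ n"
      unfolding norm_mult norm_power
      by (intro mult_right_mono taylor_coeff_bound[OF f s0 s(2) x]) auto
    then show "norm (norm (taylor_coeff i n f x * (x $ i) ^ n)) \<le> M * (norm (x $ i) / s) ^ n"
      by (simp add: power_divide)
  qed
  from norm_summable_imp_has_sum[OF this sums] show ?thesis .
qed

lemma summable_power_mdeg:
  assumes "0 \<le> q" "q < 1"
  shows "(\<lambda>\<alpha>::nat^'d::finite. (q :: real) ^ mdeg \<alpha>) summable_on A"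
proof (rule nonneg_bdd_above_summable_on)
  show "bdd_above (sum (\<lambda>\<alpha>. q ^ mdeg \<alpha>) ` {F. F \<subseteq> A \<and> finite F})"
    by (rule bdd_aboveI2[of _ _ "(1 / (1 - q)) ^ CARD('d)"]) (auto intro!: sum_power_mdeg_le assms)
qed (use assms in simp)

text \<open>\<open>S\<close> holds the variables already expanded. The coefficients are still
  functions, but constant in these variables; Cauchy's inequality at the fixed radius
  \<open>s\<close> multiplies up to \<open>M / s ^ mdeg \<alpha>\<close>.\<close>

lemma partial_expansion:
  fixes f :: "complex^'d::finite \<Rightarrow> complex"
  assumes f: "sep_bdd r M f" and M: "0 \<le> M" and s: "0 < s" "s < r" and S: "finite S"
  shows "\<exists>c. (\<forall>\<alpha>. sep_bdd r (M / s ^ mdeg \<alpha>) (c \<alpha>)) \<and>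
    (\<forall>\<alpha>. \<forall>i\<in>S. \<forall>x t. c \<alpha> (upd x i t) = c \<alpha> x) \<and>
    (\<forall>x\<in>polydisc s. ((\<lambda>\<alpha>. c \<alpha> x * monom_at x \<alpha>) has_sum f x) {\<alpha>. \<forall>j. j \<notin> S \<longrightarrow> \<alpha> $ j = 0})"
  using S
proof (induction S rule: finite_induct)
  case empty
  define c where "c \<alpha> = (\<lambda>x. if \<alpha> = 0 then f x else 0)" for \<alpha> :: "nat^'d"
  have "sep_bdd r (M / s ^ mdeg \<alpha>) (c \<alpha>)" for \<alpha>
    using f M s by (cases "\<alpha> = 0") (auto simp: c_def sep_bdd_def)
  moreover have "{\<alpha> :: nat^'d. \<forall>j. j \<notin> {} \<longrightarrow> \<alpha> $ j = 0} = {0}" by (auto simp: vec_eq_iff)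
  moreover have "((\<lambda>\<alpha>. c \<alpha> x * monom_at x \<alpha>) has_sum f x) {0}" for x
    using has_sum_finite[of "{0}" "\<lambda>\<alpha>. c \<alpha> x * monom_at x \<alpha>"] by (simp add: c_def)
  ultimately show ?case by (intro exI[of _ c]) simp
next
  case (insert i S)
  then obtain c where c: "\<And>\<alpha>. sep_bdd r (M / s ^ mdeg \<alpha>) (c \<alpha>)"
    "\<And>\<alpha> i x t. i \<in> S \<Longrightarrow> c \<alpha> (upd x i t) = c \<alpha> x"
    "\<And>x. x \<in> polydisc s \<Longrightarrow> ((\<lambda>\<alpha>. c \<alpha> x * monom_at x \<alpha>) has_sum f x) {\<alpha>. \<forall>j. j \<notin> S \<longrightarrow> \<alpha> $ j = 0}"
    by blast
  define rest where "rest \<alpha> = (\<chi> j. if j = i then 0 else \<alpha> $ j)" for \<alpha> :: "nat^'d"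
  have rest: "rest \<alpha> + axis i (\<alpha> $ i) = \<alpha>" for \<alpha>
    by (simp add: rest_def vec_eq_iff axis_def)
  have mdeg_rest: "mdeg \<alpha> = mdeg (rest \<alpha>) + \<alpha> $ i" for \<alpha>
    using mdeg_add[of "rest \<alpha>" "axis i (\<alpha> $ i)"] by (simp add: rest)
  define c' where "c' \<alpha> = taylor_coeff i (\<alpha> $ i) (c (rest \<alpha>))" for \<alpha>
  have sep: "sep_bdd r (M / s ^ mdeg \<alpha>) (c' \<alpha>)" for \<alpha>
    using sep_bdd_taylor_coeff[OF c(1) s, of "rest \<alpha>" "\<alpha> $ i" i]
    by (simp add: c'_def mdeg_rest[of \<alpha>] power_add)
  have indep: "c' \<alpha> (upd x j t) = c' \<alpha> x" if "j \<in> insert i S" for \<alpha> x j t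
    unfolding c'_def using that c(2) by (intro taylor_coeff_upd) auto
  let ?T = "{\<alpha> :: nat^'d. \<forall>j. j \<notin> S \<longrightarrow> \<alpha> $ j = 0}"
  let ?T' = "{\<alpha> :: nat^'d. \<forall>j. j \<notin> insert i S \<longrightarrow> \<alpha> $ j = 0}"
  have "((\<lambda>\<alpha>. c' \<alpha> x * monom_at x \<alpha>) has_sum f x) ?T'" if x: "x \<in> polydisc s" for x
  proof -
    have xr: "x \<in> polydisc r" using x s by (auto simp: polydisc_def intro: less_trans)
    \<comment> \<open>\<open>q\<close> is strictly less than \<open>s\<close>, so the powers of
      \<open>q / s\<close> majorise the new series absolutely, which permits regrouping over the
      pairs (\<open>rest \<alpha>\<close>, \<open>\<alpha> $ i\<close>).\<close>
    define q where "q = Max (range (\<lambda>j. norm (x $ j)))"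
    have q: "norm (x $ j) \<le> q" for j unfolding q_def by (rule Max_ge) auto
    have q1: "0 \<le> q / s" "q / s < 1"
    proof -
      have "0 \<le> q" using q[of undefined] norm_ge_zero order_trans by blast
      then show "0 \<le> q / s" using s by simp
      have "q < s" unfolding q_def using x by (subst Max_less_iff) (auto simp: polydisc_def)
      then show "q / s < 1" using s by simp
    qed
    define F where "F \<alpha> = c' \<alpha> x * monom_at x \<alpha>" for \<alpha>
    have "(\<lambda>\<alpha>. norm (F \<alpha>)) summable_on ?T'"
    proof (rule Infinite_Sum.abs_summable_on_comparison_test)
      show "(\<lambda>\<alpha>. norm (M * (q / s) ^ mdeg \<alpha>)) summable_on ?T'"
        using summable_on_cmult_right[OF summable_power_mdeg[OF q1], of M ?T'] M q1 by simp
      fix \<alpha>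
      have "norm (F \<alpha>) \<le> M / s ^ mdeg \<alpha> * q ^ mdeg \<alpha>"
        unfolding F_def norm_mult using sep[of \<alpha>] xr s M
        by (intro mult_mono norm_monom_at_le q) (auto simp: sep_bdd_def)
      also have "\<dots> = M * (q / s) ^ mdeg \<alpha>" by (simp add: power_divide)
      also have "\<dots> \<le> norm (M * (q / s) ^ mdeg \<alpha>)" by simp
      finally show "norm (F \<alpha>) \<le> norm (M * (q / s) ^ mdeg \<alpha>)" .
    qed
    then have sm: "F summable_on ?T'" by (rule abs_summable_summable)
    define G where "G p = F (fst p + axis i (snd p))" for p
    have iS: "i \<notin> S" by (rule insert.hyps)
    have i0: "\<beta> $ i = 0" if "\<beta> \<in> ?T" for \<beta> using that iS by simp
    have rT: "rest (\<beta> + axis i n) = \<beta>" if "\<beta> \<in> ?T" for \<beta> n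
      using i0[OF that] by (auto simp: rest_def vec_eq_iff axis_def)
    have iT: "(\<beta> + axis i n) $ i = n" if "\<beta> \<in> ?T" for \<beta> n
      using i0[OF that] by (simp add: axis_def)
    have wit: "rest \<alpha> \<in> ?T" if "\<alpha> \<in> ?T'" for \<alpha> using that by (auto simp: rest_def)
    have wit': "\<beta> + axis i n \<in> ?T'" if "\<beta> \<in> ?T" for \<beta> n using that by (auto simp: axis_def)
    have "G summable_on ?T \<times> UNIV \<longleftrightarrow> F summable_on ?T'"
      by (rule summable_on_reindex_bij_witness[where j = "\<lambda>p. fst p + axis i (snd p)" and i = "\<lambda>\<alpha>. (rest \<alpha>, \<alpha> $ i)"])
        (use rT iT wit wit' in \<open>auto simp: G_def rest\<close>)
    then have smG: "G summable_on ?T \<times> UNIV" using sm by simp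
    have "(G has_sum f x) (?T \<times> UNIV)"
    proof (rule has_sum_SigmaI[OF _ c(3)[OF x] smG])
      fix \<beta> assume \<beta>: "\<beta> \<in> ?T"
      have "monom_at x (axis i n) = (x $ i) ^ n" for n
      proof -
        have "monom_at x (axis i n) = (\<Prod>j\<in>UNIV. if j = i then (x $ j) ^ n else 1)"
          unfolding monom_at_def by (rule prod.cong) (auto simp: axis_def)
        then show ?thesis by simp
      qed
      then have "G (\<beta>, n) = taylor_coeff i n (c \<beta>) x * (x $ i) ^ n * monom_at x \<beta>" for n
        using rT[OF \<beta>] iT[OF \<beta>] by (simp add: G_def F_def c'_def monom_at_add)
      then show "((\<lambda>n. G (\<beta>, n)) has_sum c \<beta> x * monom_at x \<beta>) UNIV"
        using has_sum_cmult_left[OF taylor_coeff_has_sum[OF c(1) xr]] by simp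
    qed
    moreover have "(G has_sum f x) (?T \<times> UNIV) \<longleftrightarrow> (F has_sum f x) ?T'"
      by (rule has_sum_reindex_bij_witness[where j = "\<lambda>p. fst p + axis i (snd p)" and i = "\<lambda>\<alpha>. (rest \<alpha>, \<alpha> $ i)"])
        (use rT iT wit wit' in \<open>auto simp: G_def rest\<close>)
    ultimately show ?thesis by (simp add: F_def[abs_def])
  qed
  then show ?case using sep indep by blast
qed

lemma sep_bdd_analytic:
  fixes f :: "complex^'d::finite \<Rightarrow> complex"
  assumes f: "sep_bdd r M f" and M: "0 \<le> M" and s: "0 < s" "s < r"
  shows "\<exists>c. geo c \<and> (\<forall>x\<in>polydisc s. f x = ev c x)"
proof -
  obtain c where c: "\<And>\<alpha>. sep_bdd r (M / s ^ mdeg \<alpha>) (c \<alpha>)"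
    "\<And>\<alpha> i x t. c \<alpha> (upd x i t) = c \<alpha> x"
    "\<And>x. x \<in> polydisc s \<Longrightarrow> ((\<lambda>\<alpha>. c \<alpha> x * monom_at x \<alpha>) has_sum f x) UNIV"
    using partial_expansion[OF f M s finite[of UNIV]] by simp blast
  \<comment> \<open>A function insensitive to each single coordinate is constant: the coordinates
    are replaced by 0 one after another.\<close>
  have const: "c \<alpha> x = c \<alpha> 0" for \<alpha> x
  proof -
    have "c \<alpha> (\<chi> j. if j \<in> A then x $ j else 0) = c \<alpha> 0" if "finite A" for A
      using that
    proof (induction A rule: finite_induct)
      case empty
      have "(\<chi> j. if j \<in> {} then x $ j else 0) = 0" by (simp add: vec_eq_iff)
      then show ?case by simp
    next
      case (insert i A)
      have "(\<chi> j. if j \<in> insert i A then x $ j else 0) = upd (\<chi> j. if j \<in> A then x $ j else 0) i (x $ i)"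
        by (auto simp: vec_eq_iff upd_nth)
      then show ?case using insert.IH by (simp add: c(2))
    qed
    from this[of UNIV] show ?thesis by simp
  qed
  have "norm (c \<alpha> 0) \<le> (M + 1) * (1 / s) ^ mdeg \<alpha>" for \<alpha>
  proof -
    have "norm (c \<alpha> 0) \<le> M / s ^ mdeg \<alpha>"
      using c(1)[of \<alpha>] s by (auto simp: sep_bdd_def polydisc_def)
    also have "\<dots> \<le> (M + 1) / s ^ mdeg \<alpha>" using s by (intro divide_right_mono) auto
    finally show ?thesis by (simp add: power_divide)
  qed
  then have "geo (\<lambda>\<alpha>. c \<alpha> 0)"
    unfolding geo_def using M s by (intro exI[of _ "M + 1"] conjI exI[of _ "1 / s"]) auto
  moreover have "f x = ev (\<lambda>\<alpha>. c \<alpha> 0) x" if "x \<in> polydisc s" for x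
    using c(3)[OF that] unfolding ev_def const[of _ x] by (rule infsumI[symmetric])
  ultimately show ?thesis by blast
qed

section \<open>From holomorphic germs to convergent power series\<close>

abbreviation hol :: "(complex^'d::finite \<Rightarrow> complex) \<Rightarrow> bool" where
  "hol f \<equiv> holomorphic_germ (*s) (*) f 0"

lemma linear_axis: "bounded_linear (axis i :: complex \<Rightarrow> complex^'d::finite)"
  unfolding linear_conv_bounded_linear[symmetric]
  by (rule linearI) (auto simp: vec_eq_iff axis_def)

lemma axis_scale: "axis i t = t *s axis i (1 :: complex)"
  by (simp add: vec_eq_iff axis_def)

lemma has_field_derivative_axis:
  assumes f: "(f has_derivative D) (at (x + axis i t :: complex^'d::finite))" and D: "\<And>c v. D (c *s v) = c * D v"
  shows "((\<lambda>t. f (x + axis i t)) has_field_derivative D (axis i 1)) (at t)"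
proof -
  have "((\<lambda>t. x + axis i t) has_derivative axis i) (at t)"
    by (auto intro!: derivative_eq_intros bounded_linear.has_derivative[OF linear_axis])
  from has_derivative_compose[OF this f]
  have "((\<lambda>t. f (x + axis i t)) has_derivative (\<lambda>h. D (axis i h))) (at t)" .
  moreover have "(\<lambda>h. D (axis i h)) = (*) (D (axis i 1))"
  proof
    show "D (axis i h) = D (axis i 1) * h" for h
      using D[of h "axis i 1"] axis_scale[of i h] by (simp add: mult.commute)
  qed
  ultimately show ?thesis unfolding has_field_derivative_def by simp
qed

lemma polydisc_subset_ball:
  assumes "0 < e"
  shows "polydisc (e / real CARD('d)) \<subseteq> ball (0 :: complex^'d::finite) e"
proof
  fix x :: "complex^'d" assume x: "x \<in> polydisc (e / real CARD('d))"
  have "norm x \<le> (\<Sum>j\<in>UNIV. norm (x $ j))" unfolding norm_vec_def by (rule L2_set_le_sum) auto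
  also have "\<dots> < (\<Sum>j\<in>(UNIV :: 'd set). e / real CARD('d))"
    using x by (intro sum_strict_mono) (auto simp: polydisc_def)
  finally show "x \<in> ball 0 e" by simp
qed

text \<open>Continuity at 0 bounds the function on a small polydisc, and restriction to coordinate
  lines gives separate holomorphy.\<close>

lemma hol_imp_analytic:
  fixes f :: "complex^'d::finite \<Rightarrow> complex"
  assumes "hol f"
  shows "\<exists>c. geo c \<and> (\<forall>\<^sub>F x in nhds 0. f x = ev c x)"
proof -
  obtain U where U: "open U" "0 \<in> U"
    and D: "\<And>z. z \<in> U \<Longrightarrow> \<exists>D. (f has_derivative D) (at z) \<and> (\<forall>c v. D (c *s v) = c * D v)"
    using assms unfolding holomorphic_germ_def by blast
  define M where "M = norm (f 0) + 1"
  have "isCont f 0" using D[OF U(2)] has_derivative_continuous by blast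
  then have "(f \<longlongrightarrow> f 0) (nhds 0)" by (simp add: isCont_def tendsto_at_iff_tendsto_nhds)
  then have "\<forall>\<^sub>F x in nhds 0. norm (f x) < M"
    by (intro order_tendstoD(2)[OF tendsto_norm]) (auto simp: M_def)
  moreover have "\<forall>\<^sub>F x in nhds 0. x \<in> U" using U by (simp add: eventually_nhds_in_open)
  ultimately have "\<forall>\<^sub>F x in nhds 0. norm (f x) < M \<and> x \<in> U" by eventually_elim simp
  then obtain e where e: "0 < e" "\<And>x. dist x 0 < e \<Longrightarrow> norm (f x) < M \<and> x \<in> U"
    unfolding eventually_nhds_metric by blast
  define r where "r = e / real CARD('d)"
  have r: "0 < r" using e by (simp add: r_def)
  have poly: "norm (f x) < M" "x \<in> U" if "x \<in> polydisc r" for x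
    using polydisc_subset_ball[OF e(1)] that e(2)[of x] by (auto simp: r_def)
  have "sep_bdd r M f"
    unfolding sep_bdd_def
  proof (intro conjI ballI allI)
    show "norm (f x) \<le> M" if "x \<in> polydisc r" for x using poly(1)[OF that] by simp
    show "(\<lambda>t. f (upd x i t)) holomorphic_on ball 0 r" if x: "x \<in> polydisc r" for x i
      unfolding holomorphic_on_def
    proof
      fix t assume "t \<in> ball (0::complex) r"
      then have "upd x i t \<in> U" using poly(2) polydisc_upd[OF x] by simp
      have upd: "upd x i s = upd x i 0 + axis i s" for s by (simp add: vec_eq_iff upd_nth axis_def)
      obtain D' where "(f has_derivative D') (at (upd x i 0 + axis i t))" "\<And>c v. D' (c *s v) = c * D' v"
        using D[OF \<open>upd x i t \<in> U\<close>] unfolding upd[of t] by blast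
      from has_field_derivative_axis[OF this]
      have "((\<lambda>t. f (upd x i t)) has_field_derivative D' (axis i 1)) (at t)" unfolding upd[symmetric] .
      then show "(\<lambda>t. f (upd x i t)) field_differentiable at t within ball 0 r"
        using field_differentiable_at_within field_differentiable_def by blast
    qed
  qed
  moreover have "0 \<le> M" by (simp add: M_def)
  ultimately obtain c where c: "geo c" "\<And>x. x \<in> polydisc (r / 2) \<Longrightarrow> f x = ev c x"
    using sep_bdd_analytic[of r M f "r / 2"] r by auto
  then show ?thesis using eventually_components_less[of "r / 2"] r
    by (intro exI[of _ c] conjI) (auto simp: polydisc_def elim!: eventually_mono)
qed


subsection \<open>Calculus of holomorphic germs\<close>

lemma hol_eventually:
  "hol f \<longleftrightarrow> (\<forall>\<^sub>F x in nhds 0. \<exists>D. (f has_derivative D) (at x) \<and> (\<forall>c v. D (c *s v) = c * D v))"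
  unfolding holomorphic_germ_def eventually_nhds by blast

lemma hol_cong:
  assumes "hol f" "\<forall>\<^sub>F x in nhds 0. f x = g x"
  shows "hol g"
  unfolding hol_eventually
  using assms(1)[unfolded hol_eventually] eventually_eventually[THEN iffD2, OF assms(2)]
proof eventually_elim
  case (elim x)
  then obtain D where D: "(f has_derivative D) (at x)" "\<forall>c v. D (c *s v) = c * D v" by blast
  obtain S where S: "open S" "x \<in> S" "\<And>y. y \<in> S \<Longrightarrow> f y = g y"
    using elim(2) unfolding eventually_nhds by blast
  have "(g has_derivative D) (at x)"
    by (rule has_derivative_transform_within_open[OF D(1) S(1,2) S(3)])
  with D(2) show ?case by blast
qed

lemma hol_ev: "geo c \<Longrightarrow> hol (ev c)"
  unfolding hol_eventually
proof (rule eventually_mono[OF ev_has_derivative])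
  fix x assume "(ev c has_derivative (\<lambda>h. \<Sum>i\<in>UNIV. h $ i * ev (pd i c) x)) (at x)"
  then show "\<exists>D. (ev c has_derivative D) (at x) \<and> (\<forall>k v. D (k *s v) = k * D v)"
    by (intro exI conjI) (auto simp: sum_distrib_left mult.assoc)
qed

lemma axis_0: "axis i 0 = (0 :: 'a::zero^'n::finite)"
  by (simp add: vec_eq_iff axis_def)

lemma partial_deriv_eq:
  assumes "(f has_derivative D) (at x)" "\<And>c v. D (c *s v) = c * D v"
  shows "partial_deriv i f x = D (axis i 1)"
proof -
  have "(f has_derivative D) (at (x + axis i 0))" using assms(1) by (simp add: axis_0)
  from has_field_derivative_axis[OF this assms(2)] show ?thesis
    unfolding partial_deriv_def by (rule DERIV_imp_deriv)
qed

lemma partial_deriv_ev: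
  assumes "geo c"
  shows "\<forall>\<^sub>F x in nhds 0. partial_deriv i (ev c) x = ev (pd i c) x"
  using ev_has_derivative[OF assms]
proof eventually_elim
  case (elim x)
  have "partial_deriv i (ev c) x = (\<Sum>j\<in>UNIV. axis i 1 $ j * ev (pd j c) x)"
    by (rule partial_deriv_eq[OF elim]) (simp add: sum_distrib_left mult.assoc)
  also have "\<dots> = (\<Sum>j\<in>UNIV. if j = i then ev (pd j c) x else 0)"
    by (rule sum.cong) (auto simp: axis_def)
  finally show ?case by simp
qed

lemma partial_deriv_cong_at:
  assumes "\<forall>\<^sub>F y in nhds x. f y = g y"
  shows "partial_deriv i f x = partial_deriv i g x"
  unfolding partial_deriv_def
proof (rule deriv_cong_ev)
  have "((\<lambda>t. x + axis i t) \<longlongrightarrow> x + axis i 0) (nhds 0)"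
    by (intro tendsto_intros bounded_linear.tendsto[OF linear_axis] filterlim_ident)
  then have "filterlim (\<lambda>t. x + axis i t) (nhds x) (nhds 0)" by (simp add: axis_0)
  then show "\<forall>\<^sub>F t in nhds 0. f (x + axis i t) = g (x + axis i t)"
    by (rule eventually_compose_filterlim[OF assms])
qed simp

text \<open>A derivative at x depends on the germ at x, so equality near 0 is first spread to a
  neighbourhood of each nearby point.\<close>

lemma partial_deriv_cong:
  assumes "\<forall>\<^sub>F x in nhds 0. f x = g x"
  shows "\<forall>\<^sub>F x in nhds 0. partial_deriv i f x = partial_deriv i g x"
  using eventually_eventually[THEN iffD2, OF assms]
  by eventually_elim (rule partial_deriv_cong_at)

text \<open>Differentiability of the derivative is obtained through the power series, whose formal
  derivative converges again.\<close>

lemma hol_partial_deriv: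
  assumes "hol f"
  shows "hol (partial_deriv i f)"
proof -
  obtain c where c: "geo c" "\<forall>\<^sub>F x in nhds 0. f x = ev c x" using hol_imp_analytic[OF assms] by blast
  have "\<forall>\<^sub>F x in nhds 0. ev (pd i c) x = partial_deriv i f x"
    using partial_deriv_cong[OF c(2), of i] partial_deriv_ev[OF c(1), of i] by eventually_elim simp
  with hol_ev[OF geo_pd[OF c(1)]] show ?thesis by (rule hol_cong)
qed

lemma hol_add:
  assumes "hol f" "hol g"
  shows "hol (\<lambda>x. f x + g x)"
  unfolding hol_eventually
  using assms[unfolded hol_eventually]
proof eventually_elim
  case (elim x)
  then obtain D E where D: "(f has_derivative D) (at x)" "\<And>c v. D (c *s v) = c * D v"
    and E: "(g has_derivative E) (at x)" "\<And>c v. E (c *s v) = c * E v" by blast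
  show ?case
  proof (intro exI conjI allI)
    show "((\<lambda>x. f x + g x) has_derivative (\<lambda>h. D h + E h)) (at x)"
      by (rule has_derivative_add[OF D(1) E(1)])
  qed (simp add: D(2) E(2) algebra_simps)
qed

lemma hol_mult:
  assumes "hol f" "hol g"
  shows "hol (\<lambda>x. f x * g x)"
  unfolding hol_eventually
  using assms[unfolded hol_eventually]
proof eventually_elim
  case (elim x)
  then obtain D E where D: "(f has_derivative D) (at x)" "\<And>c v. D (c *s v) = c * D v"
    and E: "(g has_derivative E) (at x)" "\<And>c v. E (c *s v) = c * E v" by blast
  show ?case
  proof (intro exI conjI allI)
    show "((\<lambda>x. f x * g x) has_derivative (\<lambda>h. f x * E h + D h * g x)) (at x)"
      by (rule has_derivative_mult[OF D(1) E(1)])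
  qed (simp add: D(2) E(2) algebra_simps)
qed

text \<open>Induction on the degree: differentiate once, and read off the constant term at 0 in the
  end.\<close>

lemma ev_eq_0_imp:
  fixes c :: "nat^'d::finite \<Rightarrow> complex"
  assumes "geo c" "\<forall>\<^sub>F x in nhds 0. ev c x = 0"
  shows "c \<alpha> = 0"
  using assms
proof (induction "mdeg \<alpha>" arbitrary: c \<alpha>)
  case 0
  then show ?case using eventually_nhds_x_imp_x[OF 0(3)] by (simp add: ev_0)
next
  case (Suc n)
  then have "\<alpha> \<noteq> 0" using mdeg_eq_0_iff[of \<alpha>] by linarith
  then obtain i where i: "\<alpha> $ i \<noteq> 0" by (metis vec_eq_iff zero_index)
  then have \<alpha>: "axis i 1 + (\<alpha> - axis i 1) = \<alpha>" by (intro axis_add_diff) auto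
  then have "mdeg \<alpha> = 1 + mdeg (\<alpha> - axis i 1)" by (metis mdeg_add mdeg_axis)
  then have n: "n = mdeg (\<alpha> - axis i 1)" using Suc.hyps(2) by simp
  have z: "\<forall>\<^sub>F x in nhds 0. ev c x = (\<lambda>_. 0) x" using Suc.prems(2) by simp
  have "\<forall>\<^sub>F x in nhds 0. ev (pd i c) x = 0"
    using partial_deriv_cong[OF z, of i] partial_deriv_ev[OF Suc.prems(1), of i]
    by eventually_elim (simp add: partial_deriv_def)
  from Suc.hyps(1)[OF n geo_pd[OF Suc.prems(1)] this]
  have "pd i c (\<alpha> - axis i 1) = 0" .
  moreover have "pd i c (\<alpha> - axis i 1) = of_nat (\<alpha> $ i) * c \<alpha>"
    using \<alpha> i by (simp add: pd_def add.commute axis_def[of i 1] of_nat_diff)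
  ultimately show ?case using i by simp
qed

lemma ev_cancel:
  assumes "geo c" "geo d" "\<forall>\<^sub>F x in nhds 0. ev c x = ev d x"
  shows "c = d"
proof
  fix \<alpha>
  have "\<forall>\<^sub>F x in nhds 0. ev (\<lambda>\<alpha>. c \<alpha> - d \<alpha>) x = 0"
    using ev_diff[OF assms(1,2)] assms(3) by eventually_elim simp
  from ev_eq_0_imp[OF geo_diff[OF assms(1,2)] this, of \<alpha>] show "c \<alpha> = d \<alpha>" by simp
qed

lemma holomorphic_germ_compose:
  assumes f: "holomorphic_germ s t f p" and g: "holomorphic_germ t u g (f p)"
  shows "holomorphic_germ s u (\<lambda>x. g (f x)) p"
proof -
  obtain U where U: "open U" "p \<in> U" "\<And>z. z \<in> U \<Longrightarrow> \<exists>D. (f has_derivative D) (at z) \<and> (\<forall>c v. D (s c v) = t c (D v))"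
    using f unfolding holomorphic_germ_def by blast
  obtain V where V: "open V" "f p \<in> V" "\<And>z. z \<in> V \<Longrightarrow> \<exists>D. (g has_derivative D) (at z) \<and> (\<forall>c v. D (t c v) = u c (D v))"
    using g unfolding holomorphic_germ_def by blast
  have "continuous_on U f"
  proof (intro continuous_at_imp_continuous_on ballI)
    show "isCont f z" if "z \<in> U" for z using U(3)[OF that] has_derivative_continuous by blast
  qed
  then have op: "open (U \<inter> f -` V)" using U(1) V(1) by (simp add: continuous_on_open_vimage Int_commute)
  have "\<exists>D. ((\<lambda>x. g (f x)) has_derivative D) (at z) \<and> (\<forall>c v. D (s c v) = u c (D v))"
    if z: "z \<in> U \<inter> f -` V" for z
  proof -
    obtain D where D: "(f has_derivative D) (at z)" "\<And>c v. D (s c v) = t c (D v)" using U(3) z by blast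
    obtain E where E: "(g has_derivative E) (at (f z))" "\<And>c v. E (t c v) = u c (E v)" using V(3) z by blast
    show ?thesis using has_derivative_compose[OF D(1) E(1)] D(2) E(2)
      by (intro exI[of _ "\<lambda>h. E (D h)"]) auto
  qed
  then show ?thesis unfolding holomorphic_germ_def using op U(2) V(2)
    by (intro exI[of _ "U \<inter> f -` V"]) auto
qed

lemma holomorphic_germ_linear:
  assumes "bounded_linear f" "\<And>c v. f (s c v) = t c (f v)"
  shows "holomorphic_germ s t f p"
  unfolding holomorphic_germ_def
proof (intro exI[of _ UNIV] conjI ballI exI[of _ f] allI)
  show "(f has_derivative f) (at z)" for z by (rule bounded_linear_imp_has_derivative[OF assms(1)])
qed (auto simp: assms(2))

lemma holomorphic_germ_isCont: "holomorphic_germ s t f p \<Longrightarrow> isCont f p"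
  unfolding holomorphic_germ_def using has_derivative_continuous by blast

lemma holomorphic_germ_tendsto: "holomorphic_germ s t f p \<Longrightarrow> (f \<longlongrightarrow> f p) (nhds p)"
  using holomorphic_germ_isCont by (simp add: isCont_def tendsto_at_iff_tendsto_nhds)

lemma hol_component:
  assumes "holomorphic_germ s (*s) f p"
  shows "holomorphic_germ s (*) (\<lambda>x. f x $ l) p"
  by (rule holomorphic_germ_compose[OF assms]) (auto intro!: holomorphic_germ_linear bounded_linear_vec_nth)


subsection \<open>The straightened operator acting on functions\<close>

lemma cmul_coordinate:
  fixes \<alpha> :: "nat^'d::finite"
  shows "cmul (\<lambda>\<alpha>. if \<alpha> = axis i 1 then 1 else 0) d \<alpha> = (if 1 \<le> \<alpha> $ i then d (\<alpha> - axis i 1) else 0)"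
proof (cases "1 \<le> \<alpha> $ i")
  case True
  have "cmul (\<lambda>\<alpha>. if \<alpha> = axis i 1 then 1 else 0) d \<alpha> = (\<Sum>p\<in>{(axis i 1 :: nat^'d, \<alpha> - axis i 1)}. d (snd p))"
    unfolding cmul_def
  proof (rule sum.mono_neutral_cong_right)
    show "\<forall>p\<in>{p. fst p + snd p = \<alpha>} - {(axis i 1, \<alpha> - axis i 1)}.
        (if fst p = axis i 1 then 1 else 0) * d (snd p) = 0"
      by (auto simp: vec_eq_iff) (metis diff_add_inverse)
  qed (use axis_add_diff[OF True] finite_convolution in auto)
  then show ?thesis using True by simp
next
  case False
  have "fst p \<noteq> axis i 1" if "fst p + snd p = \<alpha>" for p
  proof
    assume "fst p = axis i 1"
    then have "\<alpha> $ i = 1 + snd p $ i" using that by (auto simp: axis_def)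
    then show False using False by simp
  qed
  then show ?thesis using False by (auto simp: cmul_def intro!: sum.neutral)
qed

lemma theta_eq: "theta p j c = (\<lambda>\<alpha>. cmul (\<lambda>\<alpha>. if \<alpha> = axis p 1 then 1 else 0) (pd p c) \<alpha> - of_nat j * c \<alpha>)"
proof
  fix \<alpha>
  have "cmul (\<lambda>\<alpha>. if \<alpha> = axis p 1 then 1 else 0) (pd p c) \<alpha> = of_nat (\<alpha> $ p) * c \<alpha>"
  proof (cases "1 \<le> \<alpha> $ p")
    case True
    then show ?thesis unfolding cmul_coordinate pd_def
      using axis_add_diff[OF True] by (simp add: add.commute axis_def[of p 1] of_nat_diff)
  next
    case False
    then have "\<alpha> $ p = 0" by simp
    then show ?thesis unfolding cmul_coordinate by simp
  qed
  then show "theta p j c \<alpha> = cmul (\<lambda>\<alpha>. if \<alpha> = axis p 1 then 1 else 0) (pd p c) \<alpha> - of_nat j * c \<alpha>"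
    by (simp add: theta_def left_diff_distrib)
qed

lemma shiftd_eq:
  assumes "i \<noteq> p"
  shows "shiftd p i c = cmul (\<lambda>\<alpha>. if \<alpha> = axis p 1 then 1 else 0) (pd i c)"
proof
  show "shiftd p i c \<alpha> = cmul (\<lambda>\<alpha>. if \<alpha> = axis p 1 then 1 else 0) (pd i c) \<alpha>" for \<alpha>
    unfolding cmul_coordinate shiftd_def pd_def using assms by (simp add: axis_def)
qed

lemma geo_theta: "geo c \<Longrightarrow> geo (theta p j c)"
  unfolding theta_eq by (intro geo_diff geo_cmul geo_coordinate geo_pd geo_scale)

lemma ev_theta:
  assumes "geo c"
  shows "\<forall>\<^sub>F x in nhds 0. ev (theta p j c) x = x $ p * ev (pd p c) x - of_nat j * ev c x"
  using ev_diff[OF geo_cmul[OF geo_coordinate[of p] geo_pd[OF assms, of p]] geo_scale[OF assms, of "of_nat j"]]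
    ev_cmul[OF geo_coordinate[of p] geo_pd[OF assms, of p]]
proof eventually_elim
  case (elim x)
  then show ?case unfolding theta_eq by (simp only: ev_coordinate ev_scale)
qed

text \<open>The vector field that \<partial>_i becomes in the new coordinates, acting on functions;
  \<open>q i\<close> is the function whose series is \<open>\<pi> i\<close>.\<close>

definition Dop ::
    "'d \<Rightarrow> ('d \<Rightarrow> complex^'d::finite \<Rightarrow> complex) \<Rightarrow> 'd \<Rightarrow> (complex^'d \<Rightarrow> complex) \<Rightarrow> complex^'d \<Rightarrow> complex" where
  "Dop p q i g u = q i u * partial_deriv p g u + (if i = p then 0 else partial_deriv i g u)"

lemma Dop_cong:
  assumes "\<forall>\<^sub>F u in nhds 0. g u = h u"
  shows "\<forall>\<^sub>F u in nhds 0. Dop p q i g u = Dop p q i h u"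
  using partial_deriv_cong[OF assms, of p] partial_deriv_cong[OF assms, of i]
  by eventually_elim (simp add: Dop_def)

lemma foldr_Dop_cong:
  assumes "\<forall>\<^sub>F u in nhds 0. g u = h u"
  shows "\<forall>\<^sub>F u in nhds 0. foldr (Dop p q) ws g u = foldr (Dop p q) ws h u"
  by (induction ws) (auto intro: assms Dop_cong)

lemma hol_Dop:
  assumes "hol (q i)" "hol g"
  shows "hol (Dop p q i g)"
proof (cases "i = p")
  case True
  then show ?thesis using hol_mult[OF assms(1) hol_partial_deriv[OF assms(2), of p]]
    by (simp add: Dop_def[abs_def])
next
  case False
  then show ?thesis
    using hol_add[OF hol_mult[OF assms(1) hol_partial_deriv[OF assms(2), of p]] hol_partial_deriv[OF assms(2), of i]]
    by (simp add: Dop_def[abs_def])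
qed

lemma hol_foldr_Dop:
  assumes "\<And>i. hol (q i)" "hol g"
  shows "hol (foldr (Dop p q) ws g)"
  by (induction ws) (auto intro: assms hol_Dop)

lemma partial_deriv_power_mult:
  assumes "hol g"
  shows "\<forall>\<^sub>F u in nhds 0. partial_deriv i (\<lambda>u. (u $ p) ^ j * g u) u
    = (if i = p then of_nat j * (u $ p) ^ (j - 1) * g u else 0) + (u $ p) ^ j * partial_deriv i g u"
  using assms[unfolded hol_eventually]
proof eventually_elim
  case (elim u)
  then obtain D where D: "(g has_derivative D) (at u)" "\<And>c v. D (c *s v) = c * D v" by blast
  define E where "E h = (u $ p) ^ j * D h + of_nat j * h $ p * (u $ p) ^ (j - 1) * g u" for h
  have "((\<lambda>u. (u $ p) ^ j * g u) has_derivative E) (at u)"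
    unfolding E_def
    by (intro has_derivative_mult D) (auto intro!: derivative_eq_intros bounded_linear.has_derivative[OF bounded_linear_vec_nth])
  moreover have "E (c *s v) = c * E v" for c v by (simp add: E_def D(2) algebra_simps)
  ultimately have "partial_deriv i (\<lambda>u. (u $ p) ^ j * g u) u = E (axis i 1)" by (rule partial_deriv_eq)
  then show ?case using partial_deriv_eq[OF D, of i] by (simp add: E_def axis_def[of i 1])
qed

text \<open>Differentiating t^j g in the direction of t produces j t^j g besides t^(j+1)
  \<partial>_t g, and the shift -j in \<open>theta\<close> cancels it; tangential derivatives do not
  touch t. So a letter turns t^j g into t^(j+1) D_i g.\<close>

lemma ev_Top:
  assumes c: "geo c" and \<pi>: "\<And>i. geo (\<pi> i)" and q: "\<And>i. hol (q i)"
    and \<pi>q: "\<And>i. \<forall>\<^sub>F u in nhds 0. ev (\<pi> i) u = q i u"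
  shows "geo (Top p \<pi> ws c) \<and>
    (\<forall>\<^sub>F u in nhds 0. ev (Top p \<pi> ws c) u = (u $ p) ^ length ws * foldr (Dop p q) ws (ev c) u)"
proof (induction ws)
  case Nil
  then show ?case using c by simp
next
  case (Cons i ws)
  define j where "j = length ws"
  define H where "H = Top p \<pi> ws c"
  define g where "g = foldr (Dop p q) ws (ev c)"
  have H: "geo H" and evH: "\<forall>\<^sub>F u in nhds 0. ev H u = (u $ p) ^ j * g u"
    using Cons by (auto simp: H_def g_def j_def)
  have g: "hol g" unfolding g_def by (intro hol_foldr_Dop q hol_ev c)
  have pdH: "\<forall>\<^sub>F u in nhds 0. ev (pd i H) u
      = (if i = p then of_nat j * (u $ p) ^ (j - 1) * g u else 0) + (u $ p) ^ j * partial_deriv i g u" for i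
    using partial_deriv_ev[OF H, of i] partial_deriv_cong[OF evH, of i] partial_deriv_power_mult[OF g, of i p j]
    by eventually_elim simp
  define X where "X = (\<lambda>\<alpha>. if i = p then 0 else shiftd p i H \<alpha>)"
  have X: "geo X" "\<forall>\<^sub>F u in nhds 0. ev X u = (if i = p then 0 else u $ p * ev (pd i H) u)"
  proof -
    have "geo X \<and> (\<forall>\<^sub>F u in nhds 0. ev X u = (if i = p then 0 else u $ p * ev (pd i H) u))"
    proof (cases "i = p")
      case True
      then show ?thesis by (simp add: X_def geo_const[of 0, simplified] ev_const[of 0, simplified])
    next
      case False
      then have "X = cmul (\<lambda>\<alpha>. if \<alpha> = axis p 1 then 1 else 0) (pd i H)"
        by (simp add: X_def shiftd_eq)
      then show ?thesis
        using geo_cmul[OF geo_coordinate[of p] geo_pd[OF H, of i]] ev_cmul[OF geo_coordinate[of p] geo_pd[OF H, of i]] False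
        by (simp only: ev_coordinate if_False simp_thms)
    qed
    then show "geo X" "\<forall>\<^sub>F u in nhds 0. ev X u = (if i = p then 0 else u $ p * ev (pd i H) u)" by auto
  qed
  have Top: "Top p \<pi> (i # ws) c = (\<lambda>\<alpha>. cmul (\<pi> i) (theta p j H) \<alpha> + X \<alpha>)"
    unfolding X_def H_def j_def by simp
  have "geo (cmul (\<pi> i) (theta p j H))" by (intro geo_cmul \<pi> geo_theta H)
  note add = geo_add[OF this X(1)] ev_add[OF this X(1)]
  have "\<forall>\<^sub>F u in nhds 0. ev (Top p \<pi> (i # ws) c) u = (u $ p) ^ Suc j * Dop p q i g u"
    using add(2) ev_cmul[OF \<pi>[of i] geo_theta[OF H, of p j]] ev_theta[OF H, of p j] X(2) evH pdH[of p] pdH[of i] \<pi>q[of i]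
  proof eventually_elim
    case (elim u)
    \<comment> \<open>The case j = 0, where \<open>j - 1\<close> is truncated, is saved by the
      factor \<open>of_nat j\<close>.\<close>
    have "u $ p * (of_nat j * (u $ p) ^ (j - 1) * g u) = of_nat j * ((u $ p) ^ j * g u)"
      by (cases j) auto
    then have "ev (theta p j H) u = (u $ p) ^ Suc j * partial_deriv p g u"
      using elim(3,5,6) by (simp add: distrib_left mult_ac)
    moreover have "ev X u = (if i = p then 0 else (u $ p) ^ Suc j * partial_deriv i g u)"
      using elim(4,7) by simp
    ultimately show ?case unfolding Top using elim(1,2,8) by (simp add: Dop_def distrib_left mult_ac)
  qed
  then show ?case unfolding Top using add(1) by (simp add: g_def j_def Top)
qed


subsection \<open>Straightening the hypersurface\<close>

text \<open>The coordinate change that replaces \<open>x $ p\<close> by \<open>P x\<close>, written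
  as the identity plus a multiple of a basis vector so that its differential is immediate.\<close>

definition flatten :: "'d \<Rightarrow> (complex^'d::finite \<Rightarrow> complex) \<Rightarrow> complex^'d \<Rightarrow> complex^'d" where
  "flatten p P x = x + axis p (P x - x $ p)"

lemma flatten_nth: "flatten p P x $ i = (if i = p then P x else x $ i)"
  by (simp add: flatten_def axis_def)

lemma has_derivative_flatten:
  assumes "(P has_derivative D) (at x)"
  shows "(flatten p P has_derivative (\<lambda>h. h + axis p (D h - h $ p))) (at x)"
  unfolding flatten_def
  by (intro has_derivative_add has_derivative_ident bounded_linear.has_derivative[OF linear_axis]
      has_derivative_diff assms bounded_linear.has_derivative[OF bounded_linear_vec_nth])

lemma holomorphic_flatten:
  assumes "hol P"
  shows "holomorphic_germ (*s) (*s) (flatten p P) 0"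
proof -
  obtain U where U: "open U" "0 \<in> U"
    and D: "\<And>z. z \<in> U \<Longrightarrow> \<exists>D. (P has_derivative D) (at z) \<and> (\<forall>c v. D (c *s v) = c * D v)"
    using assms unfolding holomorphic_germ_def by blast
  have "\<exists>D. (flatten p P has_derivative D) (at z) \<and> (\<forall>c v. D (c *s v) = c *s D v)" if z: "z \<in> U" for z
  proof -
    obtain D where D: "(P has_derivative D) (at z)" "\<And>c v. D (c *s v) = c * D v" using D[OF z] by blast
    have "c *s v + axis p (D (c *s v) - (c *s v) $ p) = c *s (v + axis p (D v - v $ p))" for c v
      by (simp add: vec_eq_iff axis_def D(2) algebra_simps)
    with has_derivative_flatten[OF D(1)] show ?thesis by blast
  qed
  then show ?thesis unfolding holomorphic_germ_def using U by blast
qed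

text \<open>The inverse function theorem is applied over the reals; the power series of
  \<open>P\<close> supplies the continuous dependence of the differential. The inverse is
  holomorphic because the inverse of a complex-linear bijection is complex-linear.\<close>

lemma flatten_inverse:
  fixes P :: "complex^'d::finite \<Rightarrow> complex"
  assumes P: "hol P" "P 0 = 0" and nz: "partial_deriv p P 0 \<noteq> 0"
  obtains \<Psi> where "holomorphic_germ (*s) (*s) \<Psi> 0" "\<Psi> 0 = 0"
    "\<forall>\<^sub>F u in nhds 0. flatten p P (\<Psi> u) = u" "\<forall>\<^sub>F x in nhds 0. \<Psi> (flatten p P x) = x"
proof -
  obtain c where c: "geo c" "\<forall>\<^sub>F x in nhds 0. P x = ev c x" using hol_imp_analytic[OF P(1)] by blast
  define D where "D x h = (\<Sum>i\<in>UNIV. h $ i * ev (pd i c) x)" for x and h :: "complex^'d"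
  have D_scale: "D x (k *s v) = k * D x v" for x k v
    by (simp add: D_def sum_distrib_left mult.assoc)
  have D_add: "D x (v + w) = D x v + D x w" for x v w
    by (simp add: D_def sum.distrib distrib_right)
  have D_axis: "D x (axis i t) = t * ev (pd i c) x" for x i t
  proof -
    have "D x (axis i t) = (\<Sum>j\<in>UNIV. if j = i then t * ev (pd j c) x else 0)"
      unfolding D_def by (rule sum.cong) (auto simp: axis_def)
    then show ?thesis by simp
  qed
  have "\<forall>\<^sub>F x in nhds 0. (ev c has_derivative D x) (at x)"
    unfolding D_def using ev_has_derivative[OF c(1)] .
  moreover have "\<forall>\<^sub>F x in nhds 0. \<forall>\<^sub>F y in nhds x. P y = ev c y"
    using eventually_eventually[THEN iffD2, OF c(2)] .
  moreover have "\<forall>\<^sub>F x in nhds 0. \<forall>i\<in>UNIV. isCont (ev (pd i c)) x"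
  proof (intro eventually_ball_finite ballI)
    show "\<forall>\<^sub>F x in nhds 0. isCont (ev (pd i c)) x" for i
      using ev_has_derivative[OF geo_pd[OF c(1), of i]]
      by eventually_elim (rule has_derivative_continuous)
  qed simp
  ultimately have "\<forall>\<^sub>F x in nhds 0. (P has_derivative D x) (at x) \<and> (\<forall>i. isCont (ev (pd i c)) x)"
  proof eventually_elim
    case (elim x)
    obtain S where S: "open S" "x \<in> S" "\<And>y. y \<in> S \<Longrightarrow> P y = ev c y"
      using elim(2) unfolding eventually_nhds by blast
    have "(P has_derivative D x) (at x)"
      by (rule has_derivative_transform_within_open[OF elim(1) S(1,2)]) (simp add: S(3))
    then show ?case using elim(3) by simp
  qed
  then obtain U where U: "open U" "0 \<in> U"
    and DU: "\<And>x. x \<in> U \<Longrightarrow> (P has_derivative D x) (at x)"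
    and CU: "\<And>x i. x \<in> U \<Longrightarrow> isCont (ev (pd i c)) x"
    unfolding eventually_nhds by blast
  define L where "L x h = h + axis p (D x h - h $ p)" for x h
  have derL: "(flatten p P has_derivative L x) (at x)" if "x \<in> U" for x
    unfolding L_def by (rule has_derivative_flatten[OF DU[OF that]])
  have blD: "bounded_linear (D x)" for x
    unfolding D_def
    by (intro bounded_linear_sum bounded_linear_mult_const bounded_linear_vec_nth)
  have blL: "bounded_linear (L x)" for x
    unfolding L_def
    by (intro bounded_linear_add bounded_linear_ident bounded_linear_compose[OF linear_axis]
        bounded_linear_sub blD bounded_linear_vec_nth)
  have L_scale: "L x (k *s v) = k *s L x v" for x k v
    by (simp add: L_def vec_eq_iff axis_def D_scale algebra_simps)
  define f' where "f' x = Blinfun (L x)" for x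
  have f': "blinfun_apply (f' x) = L x" for x
    unfolding f'_def by (rule bounded_linear_Blinfun_apply[OF blL])
  have contf: "continuous_on U f'"
    unfolding continuous_on_def
  proof
    fix x assume x: "x \<in> U"
    show "(f' \<longlongrightarrow> f' x) (at x within U)"
    \<comment> \<open>In finite dimension, convergence of linear maps on each vector suffices for
      convergence in operator norm.\<close>
    proof (rule tendsto_componentwise1)
      fix h :: "complex^'d"
      have "((\<lambda>y. ev (pd i c) y) \<longlongrightarrow> ev (pd i c) x) (at x within U)" for i
        using CU[OF x, of i] continuous_at_imp_continuous_at_within continuous_within by blast
      then have "((\<lambda>y. L y h) \<longlongrightarrow> L x h) (at x within U)"
        unfolding L_def D_def by (intro tendsto_intros bounded_linear.tendsto[OF linear_axis])
      then show "((\<lambda>y. blinfun_apply (f' y) h) \<longlongrightarrow> blinfun_apply (f' x) h) (at x within U)"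
        by (simp add: f')
    qed
  qed
  define d where "d = ev (pd p c) 0"
  have d: "d \<noteq> 0"
  proof -
    have "partial_deriv p P 0 = D 0 (axis p 1)"
      by (rule partial_deriv_eq[OF DU[OF U(2)] D_scale])
    then show ?thesis using nz by (simp add: d_def D_axis)
  qed
  \<comment> \<open>Solves k = L 0 h for h. All entries but the p-th agree, and k_p = D 0 h; hence D
    0 k - d k_p, which involves only the other entries, equals k_p - d h_p.\<close>
  define I where "I k = k + axis p ((k $ p - (D 0 k - d * k $ p)) / d - k $ p)" for k :: "complex^'d"
  have blI: "bounded_linear I"
    unfolding I_def divide_inverse
    by (intro bounded_linear_add bounded_linear_ident bounded_linear_compose[OF linear_axis]
        bounded_linear_sub blD bounded_linear_vec_nth bounded_linear_mult_const bounded_linear_const_mult)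
  have IL: "I (L 0 h) = h" for h
  proof -
    define k where "k = L 0 h"
    have kp: "k $ p = D 0 h" by (simp add: k_def L_def axis_def)
    have Dk: "D 0 k = D 0 h + d * (D 0 h - h $ p)"
      by (simp add: k_def L_def D_add D_axis d_def mult.commute)
    have "(k $ p - (D 0 k - d * k $ p)) / d = h $ p"
      using d by (simp add: kp Dk algebra_simps)
    then show ?thesis
      unfolding k_def[symmetric] I_def kp by (simp add: k_def L_def vec_eq_iff axis_def)
  qed
  have invf: "Blinfun I o\<^sub>L f' 0 = id_blinfun"
    by (rule blinfun_eqI) (simp add: f' bounded_linear_Blinfun_apply[OF blI] IL)
  have \<Phi>0: "flatten p P 0 = 0" by (simp add: vec_eq_iff flatten_nth P(2))
  obtain U' V g g' where g: "open U'" "U' \<subseteq> U" "0 \<in> U'" "open V" "flatten p P 0 \<in> V"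
    "homeomorphism U' V (flatten p P) g" "\<And>y. y \<in> V \<Longrightarrow> (g has_derivative g' y) (at y)"
    "\<And>y. y \<in> V \<Longrightarrow> g' y = inv (blinfun_apply (f' (g y)))" "\<And>y. y \<in> V \<Longrightarrow> bij (blinfun_apply (f' (g y)))"
    using inverse_function_theorem[OF U(1) _ contf U(2) invf] derL f' by metis
  have g'_scale: "g' y (k *s v) = k *s g' y v" if y: "y \<in> V" for y k v
  proof -
    have bij: "bij (L (g y))" and eq: "g' y = inv (L (g y))" using g(8,9)[OF y] by (simp_all add: f')
    have "L (g y) (k *s g' y v) = k *s v"
      using bij by (simp add: L_scale eq bij_is_surj surj_f_inv_f)
    then have "inv (L (g y)) (k *s v) = k *s g' y v" using bij by (metis bij_inv_eq_iff)
    then show ?thesis by (simp add: eq)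
  qed
  have V0: "0 \<in> V" using g(5) \<Phi>0 by simp
  have "holomorphic_germ (*s) (*s) g 0"
    unfolding holomorphic_germ_def using g(4,7) V0 g'_scale by blast
  moreover have "g 0 = 0" using homeomorphism_apply1[OF g(6,3)] \<Phi>0 by simp
  moreover have "\<forall>\<^sub>F u in nhds 0. flatten p P (g u) = u"
    using eventually_nhds_in_open[OF g(4) V0] by eventually_elim (rule homeomorphism_apply2[OF g(6)])
  moreover have "\<forall>\<^sub>F x in nhds 0. g (flatten p P x) = x"
    using eventually_nhds_in_open[OF g(1,3)] by eventually_elim (rule homeomorphism_apply1[OF g(6)])
  ultimately show ?thesis using that by blast
qed

lemma hol_compose:
  assumes "hol f" "holomorphic_germ (*s) (*s) \<Psi> 0" "\<Psi> 0 = 0"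
  shows "hol (\<lambda>u. f (\<Psi> u))"
  using holomorphic_germ_compose[OF assms(2), of "(*)" f] assms by simp

lemma germ_filterlim:
  assumes "holomorphic_germ s t \<Psi> 0" "\<Psi> 0 = 0"
  shows "filterlim \<Psi> (nhds 0) (nhds 0)"
  using holomorphic_germ_tendsto[OF assms(1)] assms(2) by simp

text \<open>The chain rule is applied to f = G o \<open>flatten\<close> with G = f o \<Psi>, and
  only afterwards is \<Psi> inserted. So the derivative of \<Psi> itself never has to be
  computed.\<close>

lemma partial_deriv_straighten:
  fixes P :: "complex^'d::finite \<Rightarrow> complex"
  assumes P: "hol P" "P 0 = 0"
    and \<Psi>: "holomorphic_germ (*s) (*s) \<Psi> 0" "\<Psi> 0 = 0"
      "\<forall>\<^sub>F u in nhds 0. flatten p P (\<Psi> u) = u" "\<forall>\<^sub>F x in nhds 0. \<Psi> (flatten p P x) = x"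
    and f: "hol f"
  shows "\<forall>\<^sub>F u in nhds 0. partial_deriv i f (\<Psi> u)
    = Dop p (\<lambda>i u. partial_deriv i P (\<Psi> u)) i (\<lambda>u. f (\<Psi> u)) u"
proof -
  let ?\<Phi> = "flatten p P"
  define G where "G = (\<lambda>u. f (\<Psi> u))"
  have G: "hol G" unfolding G_def by (rule hol_compose[OF f \<Psi>(1,2)])
  have \<Phi>0: "?\<Phi> 0 = 0" by (simp add: vec_eq_iff flatten_nth P(2))
  have lim\<Phi>: "filterlim ?\<Phi> (nhds 0) (nhds 0)" by (rule germ_filterlim[OF holomorphic_flatten[OF P(1)] \<Phi>0])
  have lim\<Psi>: "filterlim \<Psi> (nhds 0) (nhds 0)" by (rule germ_filterlim[OF \<Psi>(1,2)])
  have "\<forall>\<^sub>F x in nhds 0. f x = G (?\<Phi> x)"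
    using \<Psi>(4) by eventually_elim (simp add: G_def)
  note * = partial_deriv_cong[OF this, of i]
  have "\<forall>\<^sub>F x in nhds 0. partial_deriv i f x
      = partial_deriv i P x * partial_deriv p G (?\<Phi> x) + (if i = p then 0 else partial_deriv i G (?\<Phi> x))"
    using * P(1)[unfolded hol_eventually] eventually_compose_filterlim[OF G[unfolded hol_eventually] lim\<Phi>]
  proof eventually_elim
    case (elim x)
    obtain DP where DP: "(P has_derivative DP) (at x)" "\<And>c v. DP (c *s v) = c * DP v" using elim(2) by blast
    obtain DG where DG: "(G has_derivative DG) (at (?\<Phi> x))" "\<And>c v. DG (c *s v) = c * DG v" using elim(3) by blast
    define E where "E h = DG (h + axis p (DP h - h $ p))" for h
    have DGadd: "DG (v + w) = DG v + DG w" for v w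
      using has_derivative_bounded_linear[OF DG(1)] by (simp add: linear_simps)
    have DGaxis: "DG (axis p t) = t * DG (axis p 1)" for t
      using DG(2)[of t "axis p 1"] axis_scale[of p t] by simp
    have "((\<lambda>x. G (?\<Phi> x)) has_derivative E) (at x)"
      unfolding E_def by (rule has_derivative_compose[OF has_derivative_flatten[OF DP(1)] DG(1)])
    moreover have "E (c *s v) = c * E v" for c v
    proof -
      have E: "E w = DG w + (DP w - w $ p) * DG (axis p 1)" for w
        unfolding E_def DGadd by (subst DGaxis) simp
      show ?thesis unfolding E by (simp add: DP(2) DG(2) algebra_simps)
    qed
    ultimately have "partial_deriv i (\<lambda>x. G (?\<Phi> x)) x = E (axis i 1)" by (rule partial_deriv_eq)
    also have "\<dots> = DG (axis i 1) + (DP (axis i 1) - axis i 1 $ p) * DG (axis p 1)"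
      unfolding E_def DGadd by (subst DGaxis) simp
    also have "axis i (1 :: complex) $ p = (if i = p then 1 else 0)" by (simp add: axis_def)
    finally show ?case
      using elim(1) partial_deriv_eq[OF DP, of i] partial_deriv_eq[OF DG]
      by (auto simp: algebra_simps)
  qed
  from eventually_compose_filterlim[OF this lim\<Psi>] \<Psi>(3)
  have "\<forall>\<^sub>F u in nhds 0. partial_deriv i f (\<Psi> u)
      = partial_deriv i P (\<Psi> u) * partial_deriv p G u + (if i = p then 0 else partial_deriv i G u)"
    by eventually_elim simp
  then show ?thesis unfolding Dop_def G_def .
qed

lemma foldr_partial_deriv_straighten:
  fixes P :: "complex^'d::finite \<Rightarrow> complex"
  assumes P: "hol P" "P 0 = 0"
    and \<Psi>: "holomorphic_germ (*s) (*s) \<Psi> 0" "\<Psi> 0 = 0"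
      "\<forall>\<^sub>F u in nhds 0. flatten p P (\<Psi> u) = u" "\<forall>\<^sub>F x in nhds 0. \<Psi> (flatten p P x) = x"
    and f: "hol f"
  shows "hol (foldr partial_deriv ws f) \<and> (\<forall>\<^sub>F u in nhds 0. foldr partial_deriv ws f (\<Psi> u)
    = foldr (Dop p (\<lambda>i u. partial_deriv i P (\<Psi> u))) ws (\<lambda>u. f (\<Psi> u)) u)"
proof (induction ws)
  case Nil
  show ?case using f by simp
next
  case (Cons i ws)
  define G where "G = foldr partial_deriv ws f"
  define q where "q = (\<lambda>i u. partial_deriv i P (\<Psi> u))"
  have G: "hol G" and IH: "\<forall>\<^sub>F u in nhds 0. G (\<Psi> u) = foldr (Dop p q) ws (\<lambda>u. f (\<Psi> u)) u"
    using Cons by (auto simp: G_def q_def)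
  have "\<forall>\<^sub>F u in nhds 0. partial_deriv i G (\<Psi> u) = Dop p q i (foldr (Dop p q) ws (\<lambda>u. f (\<Psi> u))) u"
    using partial_deriv_straighten[OF P \<Psi> G, of i] Dop_cong[OF IH, of p q i]
    by eventually_elim (simp add: q_def)
  then show ?case using hol_partial_deriv[OF G] by (simp add: G_def q_def)
qed

lemma partial_derivs_eq_foldr:
  "partial_derivs \<alpha> f = foldr partial_deriv (letters (sorted_list_of_set UNIV) \<alpha>) f"
proof -
  have "foldr (\<lambda>i. partial_deriv i ^^ (\<alpha> $ i)) xs f = foldr partial_deriv (letters xs \<alpha>) f" for xs
  proof (induction xs)
    case (Cons i xs)
    have "foldr partial_deriv (replicate n i) g = (partial_deriv i ^^ n) g" for n g
      by (induction n) auto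
    then show ?case using Cons by (simp add: letters_def)
  qed (simp add: letters_def)
  then show ?thesis by (simp add: partial_derivs_def)
qed


subsection \<open>Vector-valued power series\<close>

lemma has_sum_vec:
  fixes f :: "'a \<Rightarrow> complex^'m::finite"
  assumes "\<And>l. ((\<lambda>\<alpha>. f \<alpha> $ l) has_sum s $ l) A"
  shows "(f has_sum s) A"
  unfolding has_sum_def using assms by (intro vec_tendstoI) (simp add: has_sum_def)

lemma ps_has_sum:
  fixes c :: "nat^'d::finite \<Rightarrow> complex^'m::finite"
  assumes "\<And>l. (\<lambda>\<alpha>. norm (c \<alpha> $ l * monom_at x \<alpha>)) summable_on UNIV"
  shows "((\<lambda>\<alpha>. monom_at x \<alpha> *s c \<alpha>) has_sum (\<chi> l. ev (\<lambda>\<alpha>. c \<alpha> $ l) x)) UNIV"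
  using abs_summable_has_sum_ev[OF assms] by (intro has_sum_vec) (simp add: mult.commute)

lemma geo_imp_ps_convergent:
  fixes c :: "nat^'d::finite \<Rightarrow> complex^'m::finite"
  assumes "\<And>l. geo (\<lambda>\<alpha>. c \<alpha> $ l)"
  shows "ps_convergent c" "\<forall>\<^sub>F x in nhds 0. \<forall>l. ps_sum c x $ l = ev (\<lambda>\<alpha>. c \<alpha> $ l) x"
proof -
  have "\<forall>\<^sub>F x in nhds 0. \<forall>l\<in>UNIV. (\<lambda>\<alpha>. norm (c \<alpha> $ l * monom_at x \<alpha>)) summable_on UNIV"
    using assms by (intro eventually_ball_finite ballI eventually_abs_summable) auto
  then have ev: "\<forall>\<^sub>F x in nhds 0. ((\<lambda>\<alpha>. monom_at x \<alpha> *s c \<alpha>) has_sum (\<chi> l. ev (\<lambda>\<alpha>. c \<alpha> $ l) x)) UNIV"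
    by eventually_elim (rule ps_has_sum, simp)
  then obtain e where e: "e > 0"
    "\<And>x. dist x 0 < e \<Longrightarrow> ((\<lambda>\<alpha>. monom_at x \<alpha> *s c \<alpha>) has_sum (\<chi> l. ev (\<lambda>\<alpha>. c \<alpha> $ l) x)) UNIV"
    unfolding eventually_nhds_metric by blast
  show "ps_convergent c"
    unfolding ps_convergent_def
  proof (intro exI[of _ e] conjI ballI)
    fix x :: "complex^'d" assume "x \<in> ball 0 e"
    then have "dist x 0 < e" by (simp add: dist_commute)
    from e(2)[OF this] show "(\<lambda>\<alpha>. monom_at x \<alpha> *s c \<alpha>) summable_on UNIV"
      by (rule has_sum_imp_summable)
  qed (rule e)
  show "\<forall>\<^sub>F x in nhds 0. \<forall>l. ps_sum c x $ l = ev (\<lambda>\<alpha>. c \<alpha> $ l) x"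
    using ev by eventually_elim (simp add: ps_sum_def infsumI)
qed

text \<open>Summability at one point with all coordinates equal to a small t > 0 suffices: there
  each monomial has modulus \<open>t ^ mdeg \<alpha>\<close>, and the terms of an absolutely
  convergent series are bounded.\<close>

lemma ps_convergent_imp_geo:
  fixes c :: "nat^'d::finite \<Rightarrow> complex^'m::finite"
  assumes "ps_convergent c"
  shows "geo (\<lambda>\<alpha>. c \<alpha> $ l)"
proof -
  obtain r where r: "r > 0" "\<And>x. x \<in> ball 0 r \<Longrightarrow> (\<lambda>\<alpha>. monom_at x \<alpha> *s c \<alpha>) summable_on UNIV"
    using assms unfolding ps_convergent_def by blast
  define t where "t = r / real CARD('d) / 2"
  have half: "0 < z / 2 \<and> z / 2 < z" if "0 < z" for z :: real using that by simp
  have t: "0 < t \<and> t < r / real CARD('d)" unfolding t_def by (rule half) (use r in simp)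
  define x :: "complex^'d" where "x = (\<chi> i. of_real t)"
  have "x \<in> polydisc (r / real CARD('d))" using t by (simp add: polydisc_def x_def)
  then have "x \<in> ball 0 r" using polydisc_subset_ball[OF r(1)] by blast
  then have "(\<lambda>\<alpha>. (monom_at x \<alpha> *s c \<alpha>) $ l) summable_on UNIV"
    by (intro summable_on_bounded_linear[OF bounded_linear_vec_nth] r)
  then have "(\<lambda>\<alpha>. norm (monom_at x \<alpha> * c \<alpha> $ l)) summable_on UNIV"
    by (simp add: summable_on_iff_abs_summable_on_complex)
  then obtain B where B: "\<And>F. finite F \<Longrightarrow> (\<Sum>\<alpha>\<in>F. norm (monom_at x \<alpha> * c \<alpha> $ l)) \<le> B"
    unfolding abs_summable_iff_bdd_above bdd_above_def by auto
  have mx: "norm (monom_at x \<alpha>) = t ^ mdeg \<alpha>" for \<alpha>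
    using t by (simp add: monom_at_def x_def mdeg_def power_sum[symmetric] norm_power)
  have "norm (c \<alpha> $ l) \<le> (\<bar>B\<bar> + 1) * (1 / t) ^ mdeg \<alpha>" for \<alpha>
  proof -
    have "t ^ mdeg \<alpha> * norm (c \<alpha> $ l) \<le> \<bar>B\<bar> + 1"
      using B[of "{\<alpha>}"] by (simp add: norm_mult mx)
    then show ?thesis using t by (simp add: power_divide field_simps)
  qed
  then show ?thesis unfolding geo_def using t
    by (intro exI[of _ "\<bar>B\<bar> + 1"] conjI exI[of _ "1 / t"]) auto
qed


subsection \<open>Equivalence of the system with its straightened formal version\<close>

lemma ev_Lop:
  assumes c: "geo c" and \<pi>: "\<And>i. geo (\<pi> i)" and q: "\<And>i. hol (q i)"
    and \<pi>q: "\<And>i. \<forall>\<^sub>F u in nhds 0. ev (\<pi> i) u = q i u"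
    and A: "\<And>j \<mu>. 1 \<le> j \<Longrightarrow> j \<le> k \<Longrightarrow> mdeg \<mu> = j \<Longrightarrow> geo (A j \<mu>)"
    and xs: "distinct xs" "set xs = UNIV"
  shows "geo (Lop k p \<pi> A xs c)"
    and "\<forall>\<^sub>F u in nhds 0. ev (Lop k p \<pi> A xs c) u
      = (\<Sum>j=1..k. \<Sum>\<mu> | mdeg \<mu> = j. ev (A j \<mu>) u * ((u $ p) ^ j * foldr (Dop p q) (letters xs \<mu>) (ev c) u))"
proof -
  define t where "t j \<mu> = cmul (A j \<mu>) (Top p \<pi> (letters xs \<mu>) c)" for j \<mu>
  have Top: "geo (Top p \<pi> ws c)"
    "\<forall>\<^sub>F u in nhds 0. ev (Top p \<pi> ws c) u = (u $ p) ^ length ws * foldr (Dop p q) ws (ev c) u" for ws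
    using ev_Top[of c \<pi> q p ws, OF c \<pi> q \<pi>q] by auto
  have t: "geo (t j \<mu>)" if "1 \<le> j" "j \<le> k" "mdeg \<mu> = j" for j \<mu>
    unfolding t_def by (intro geo_cmul A Top that)
  have ev_t: "\<forall>\<^sub>F u in nhds 0. ev (t j \<mu>) u = ev (A j \<mu>) u * ((u $ p) ^ j * foldr (Dop p q) (letters xs \<mu>) (ev c) u)"
    if "1 \<le> j" "j \<le> k" "mdeg \<mu> = j" for j \<mu>
    using ev_cmul[OF A[OF that] Top(1)[of "letters xs \<mu>"]] Top(2)[of "letters xs \<mu>"]
    by eventually_elim (simp add: t_def length_letters[OF xs] that(3))
  have inner: "geo (\<lambda>\<alpha>. \<Sum>\<mu> | mdeg \<mu> = j. t j \<mu> \<alpha>) \<and>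
      (\<forall>\<^sub>F u in nhds 0. ev (\<lambda>\<alpha>. \<Sum>\<mu> | mdeg \<mu> = j. t j \<mu> \<alpha>) u = (\<Sum>\<mu> | mdeg \<mu> = j. ev (t j \<mu>) u))"
    if "j \<in> {1..k}" for j
    using that t by (intro geo_ev_sum finite_mdeg) auto
  have outer: "geo (\<lambda>\<alpha>. \<Sum>j=1..k. \<Sum>\<mu> | mdeg \<mu> = j. t j \<mu> \<alpha>) \<and>
      (\<forall>\<^sub>F u in nhds 0. ev (\<lambda>\<alpha>. \<Sum>j=1..k. \<Sum>\<mu> | mdeg \<mu> = j. t j \<mu> \<alpha>) u
        = (\<Sum>j=1..k. ev (\<lambda>\<alpha>. \<Sum>\<mu> | mdeg \<mu> = j. t j \<mu> \<alpha>) u))"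
    using inner by (intro geo_ev_sum) auto
  have eq: "Lop k p \<pi> A xs c = (\<lambda>\<alpha>. \<Sum>j=1..k. \<Sum>\<mu> | mdeg \<mu> = j. t j \<mu> \<alpha>)"
    by (simp add: Lop_def t_def fun_eq_iff)
  show "geo (Lop k p \<pi> A xs c)" unfolding eq using outer by blast
  have 1: "\<forall>\<^sub>F u in nhds 0. \<forall>j\<in>{1..k}. ev (\<lambda>\<alpha>. \<Sum>\<mu> | mdeg \<mu> = j. t j \<mu> \<alpha>) u = (\<Sum>\<mu> | mdeg \<mu> = j. ev (t j \<mu>) u)"
    using inner by (intro eventually_ball_finite) auto
  have 2: "\<forall>\<^sub>F u in nhds 0. \<forall>j\<in>{1..k}. \<forall>\<mu>\<in>{\<mu>. mdeg \<mu> = j}.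
      ev (t j \<mu>) u = ev (A j \<mu>) u * ((u $ p) ^ j * foldr (Dop p q) (letters xs \<mu>) (ev c) u)"
    using ev_t by (intro eventually_ball_finite ballI finite_mdeg) auto
  show "\<forall>\<^sub>F u in nhds 0. ev (Lop k p \<pi> A xs c) u
      = (\<Sum>j=1..k. \<Sum>\<mu> | mdeg \<mu> = j. ev (A j \<mu>) u * ((u $ p) ^ j * foldr (Dop p q) (letters xs \<mu>) (ev c) u))"
    unfolding eq using outer[THEN conjunct2] 1 2
    by eventually_elim simp
qed

lemma eventually_all_finite_iff:
  "(\<forall>\<^sub>F x in F. \<forall>l. Q l x) \<longleftrightarrow> (\<forall>l :: 'm::finite. \<forall>\<^sub>F x in F. Q l x)"
  using eventually_ball_finite_distrib[of "UNIV :: 'm set" "\<lambda>x l. Q l x" F] by simp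

theorem theorem1p2:
  fixes k :: nat
    and P :: "complex^'d::{finite,linorder} \<Rightarrow> complex"
    and a :: "nat \<Rightarrow> nat^'d::{finite,linorder} \<Rightarrow> complex^'d::{finite,linorder} \<Rightarrow> complex"
    and F :: "(complex^'d::{finite,linorder}) \<times> (complex^'m::finite) \<Rightarrow> complex^'m"
  assumes k: "k \<ge> 1"
    and P: "holomorphic_germ (*s) (*) P 0" "P 0 = 0"
    and a: "\<And>j \<alpha>. 1 \<le> j \<Longrightarrow> j \<le> k \<Longrightarrow> mdeg \<alpha> = j \<Longrightarrow> holomorphic_germ (*s) (*) (a j \<alpha>) 0"
    and F: "holomorphic_germ scale_pair (*s) F (0, 0)" "F (0, 0) = 0"
    and DF: "invertible (jacobian_snd F 0 0)"
    and Lk: "diff_op_star k (a k) P 0 \<noteq> 0"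
    and nonres: "\<And>n :: nat. invertible
        (mat (\<Sum>j=1..k. (\<Prod>i<j. of_nat n - of_nat i) * diff_op_star j (a j) P 0)
          - jacobian_snd F 0 0)"
  shows "\<exists>!c :: nat^'d::{finite,linorder} \<Rightarrow> complex^'m.
           ps_convergent c \<and> ps_sum c 0 = 0 \<and> solves_system k P a F (ps_sum c)"
proof -
  define xs where "xs = sorted_list_of_set (UNIV :: 'd set)"
  have xs: "distinct xs" "set xs = UNIV" by (simp_all add: xs_def)
  \<comment> \<open>If the gradient vanished, so would every monomial of degree k \<ge> 1 in
    it.\<close>
  obtain p where p: "partial_deriv p P 0 \<noteq> 0"
  proof (rule ccontr)
    assume "\<not> thesis"
    then have z: "(\<chi> i. partial_deriv i P 0) = 0" using that by (auto simp: vec_eq_iff)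
    have "diff_op_star k (a k) P 0 = 0"
      unfolding diff_op_star_def z monom_at_zero using k by (intro sum.neutral) auto
    with Lk show False by simp
  qed
  obtain \<Psi> where \<Psi>: "holomorphic_germ (*s) (*s) \<Psi> 0" "\<Psi> 0 = 0"
    "\<forall>\<^sub>F u in nhds 0. flatten p P (\<Psi> u) = u" "\<forall>\<^sub>F x in nhds 0. \<Psi> (flatten p P x) = x"
    by (rule flatten_inverse[OF P p])
  have \<Phi>0: "flatten p P 0 = 0" by (simp add: vec_eq_iff flatten_nth P(2))
  have lim\<Psi>: "filterlim \<Psi> (nhds 0) (nhds 0)" by (rule germ_filterlim[OF \<Psi>(1,2)])
  have lim\<Phi>: "filterlim (flatten p P) (nhds 0) (nhds 0)"
    by (rule germ_filterlim[OF holomorphic_flatten[OF P(1)] \<Phi>0])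
  define q where "q = (\<lambda>i u. partial_deriv i P (\<Psi> u))"
  have q: "hol (q i)" for i
    unfolding q_def by (intro hol_compose[OF hol_partial_deriv[OF P(1)] \<Psi>(1,2)])
  have "\<forall>i. \<exists>c. geo c \<and> (\<forall>\<^sub>F u in nhds 0. q i u = ev c u)" using hol_imp_analytic[OF q] by blast
  then obtain \<pi> where \<pi>: "\<And>i. geo (\<pi> i)" "\<And>i. \<forall>\<^sub>F u in nhds 0. q i u = ev (\<pi> i) u" by metis
  have \<pi>0: "\<pi> i 0 = partial_deriv i P 0" for i
    using eventually_nhds_x_imp_x[OF \<pi>(2)[of i]] by (simp add: q_def \<Psi>(2) ev_0)
  \<comment> \<open>The implication stands under the existential so that a total choice function
    exists; for other j and \<mu> its values are arbitrary.\<close>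
  have "\<forall>j \<mu>. \<exists>c. 1 \<le> j \<and> j \<le> k \<and> mdeg \<mu> = j \<longrightarrow>
      geo c \<and> (\<forall>\<^sub>F u in nhds 0. a j \<mu> (\<Psi> u) = ev c u)"
    using hol_imp_analytic[OF hol_compose[OF a \<Psi>(1,2)]] by blast
  then obtain A where "\<forall>j \<mu>. 1 \<le> j \<and> j \<le> k \<and> mdeg \<mu> = j \<longrightarrow>
      geo (A j \<mu>) \<and> (\<forall>\<^sub>F u in nhds 0. a j \<mu> (\<Psi> u) = ev (A j \<mu>) u)" by metis
  then have A: "\<And>j \<mu>. 1 \<le> j \<Longrightarrow> j \<le> k \<Longrightarrow> mdeg \<mu> = j \<Longrightarrow> geo (A j \<mu>)"
    "\<And>j \<mu>. 1 \<le> j \<Longrightarrow> j \<le> k \<Longrightarrow> mdeg \<mu> = j \<Longrightarrow> \<forall>\<^sub>F u in nhds 0. a j \<mu> (\<Psi> u) = ev (A j \<mu>) u" by auto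
  have A0: "A j \<mu> 0 = a j \<mu> 0" if "1 \<le> j" "j \<le> k" "mdeg \<mu> = j" for j \<mu>
    using eventually_nhds_x_imp_x[OF A(2)[OF that]] by (simp add: \<Psi>(2) ev_0)
  \<comment> \<open>Only the independent variables are straightened. Merging both groups into one
    vector makes the scalar expansion theorem applicable to F.\<close>
  define Fs where "Fs z = F (\<Psi> (\<chi> i. z $ Inl i), \<chi> l. z $ Inr l)" for z :: "complex^('d + 'm)"
  have Fs: "holomorphic_germ (*s) (*s) Fs 0"
  proof -
    have bl1: "bounded_linear (\<lambda>z :: complex^('d + 'm). \<chi> i. z $ Inl i)"
      unfolding linear_conv_bounded_linear[symmetric] by (rule linearI) (auto simp: vec_eq_iff)
    have bl2: "bounded_linear (\<lambda>z :: complex^('d + 'm). \<chi> l. z $ Inr l)"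
      unfolding linear_conv_bounded_linear[symmetric] by (rule linearI) (auto simp: vec_eq_iff)
    have z1: "(\<chi> i. (0 :: complex^('d + 'm)) $ Inl i) = 0" by (simp add: vec_eq_iff)
    have z2: "(\<chi> l. (0 :: complex^('d + 'm)) $ Inr l) = 0" by (simp add: vec_eq_iff)
    have \<Psi>1: "holomorphic_germ (*s) (*s) (\<lambda>z :: complex^('d + 'm). \<Psi> (\<chi> i. z $ Inl i)) 0"
    proof (rule holomorphic_germ_compose[where f = "\<lambda>z :: complex^('d + 'm). \<chi> i. z $ Inl i" and g = \<Psi>])
      show "holomorphic_germ (*s) (*s) (\<lambda>z :: complex^('d + 'm). \<chi> i. z $ Inl i) 0"
        by (rule holomorphic_germ_linear[OF bl1]) (simp add: vec_eq_iff)
      show "holomorphic_germ (*s) (*s) \<Psi> (\<chi> i. (0 :: complex^('d + 'm)) $ Inl i)"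
        unfolding z1 by (rule \<Psi>)
    qed
    have "holomorphic_germ (*s) scale_pair (\<lambda>z :: complex^('d + 'm). (\<Psi> (\<chi> i. z $ Inl i), \<chi> l. z $ Inr l)) 0"
    proof -
      obtain U where U: "open U" "0 \<in> U" "\<And>z. z \<in> U \<Longrightarrow>
          \<exists>D. ((\<lambda>z :: complex^('d + 'm). \<Psi> (\<chi> i. z $ Inl i)) has_derivative D) (at z) \<and> (\<forall>c v. D (c *s v) = c *s D v)"
        using \<Psi>1 unfolding holomorphic_germ_def by blast
      have "\<exists>D. ((\<lambda>z :: complex^('d + 'm). (\<Psi> (\<chi> i. z $ Inl i), \<chi> l. z $ Inr l)) has_derivative D) (at z) \<and>
          (\<forall>c v. D (c *s v) = scale_pair c (D v))" if z: "z \<in> U" for z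
      proof -
        obtain D where D: "((\<lambda>z :: complex^('d + 'm). \<Psi> (\<chi> i. z $ Inl i)) has_derivative D) (at z)"
          "\<And>c v. D (c *s v) = c *s D v" using U(3)[OF z] by blast
        show ?thesis
        proof (intro exI conjI allI)
          show "((\<lambda>z :: complex^('d + 'm). (\<Psi> (\<chi> i. z $ Inl i), \<chi> l. z $ Inr l)) has_derivative
              (\<lambda>h. (D h, \<chi> l. h $ Inr l))) (at z)"
            by (intro has_derivative_Pair D bounded_linear_imp_has_derivative bl2)
          show "(D (c *s v), \<chi> l. (c *s v) $ Inr l) = scale_pair c (D v, \<chi> l. v $ Inr l)" for c v
            by (simp add: scale_pair_def D(2) vec_eq_iff)
        qed
      qed
      then show ?thesis unfolding holomorphic_germ_def using U(1,2) by blast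
    qed
    then have "holomorphic_germ (*s) (*s) (\<lambda>z :: complex^('d + 'm). F (\<Psi> (\<chi> i. z $ Inl i), \<chi> l. z $ Inr l)) 0"
      by (rule holomorphic_germ_compose[where g = F]) (simp add: z1[simplified] z2[simplified] \<Psi>(2) F(1))
    then show ?thesis by (simp add: Fs_def[abs_def])
  qed
  have "\<forall>l. \<exists>c. geo c \<and> (\<forall>\<^sub>F z in nhds 0. Fs z $ l = ev c z)"
    using hol_imp_analytic[OF hol_component[OF Fs]] by blast
  then obtain f where f: "\<And>l. geo (f l)" "\<And>l. \<forall>\<^sub>F z in nhds 0. Fs z $ l = ev (f l) z" by metis
  have z1: "(\<chi> i. (0 :: complex^('d + 'm)) $ Inl i) = 0" by (simp add: vec_eq_iff)
  have z2: "(\<chi> l. (0 :: complex^('d + 'm)) $ Inr l) = 0" by (simp add: vec_eq_iff)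
  have f0: "f l 0 = 0" for l
    using eventually_nhds_x_imp_x[OF f(2)[of l]] F(2)
    by (simp add: Fs_def z1[simplified] z2[simplified] \<Psi>(2) ev_0)
  define J where "J = jacobian_snd F 0 0"
  have J: "J $ l $ l' = f l (axis (Inr l') 1)" for l l'
  proof -
    have 1: "(\<chi> i. (axis (Inr l') t :: complex^('d + 'm)) $ Inl i) = 0"
      and 2: "(\<chi> l. (axis (Inr l') t :: complex^('d + 'm)) $ Inr l) = axis l' t" for t
      by (simp_all add: vec_eq_iff axis_def)
    have "J $ l $ l' = partial_deriv (Inr l') (\<lambda>z. Fs z $ l) 0"
      by (simp add: J_def jacobian_snd_def partial_deriv_def Fs_def 1 2 \<Psi>(2))
    also have "\<dots> = partial_deriv (Inr l') (ev (f l)) 0"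
      by (rule partial_deriv_cong_at[OF f(2)])
    also have "\<dots> = ev (pd (Inr l') (f l)) 0"
      by (rule eventually_nhds_x_imp_x[OF partial_deriv_ev[OF f(1)]])
    also have "\<dots> = f l (axis (Inr l') 1)" by (simp add: ev_0 pd_def)
    finally show ?thesis .
  qed
  have lead: "lead \<pi> (letters xs \<mu>) = monom_at (\<chi> i. partial_deriv i P 0) \<mu>" for \<mu>
    unfolding lead_def prod_list_letters[OF xs] by (simp add: monom_at_def \<pi>0)
  have star: "(\<Sum>\<mu> | mdeg \<mu> = j. A j \<mu> 0 * lead \<pi> (letters xs \<mu>)) = diff_op_star j (a j) P 0"
    if "1 \<le> j" "j \<le> k" for j
    unfolding diff_op_star_def lead using A0 that by (intro sum.cong) auto
  have symb: "symb k \<pi> A xs n = (\<Sum>j=1..k. (\<Prod>i<j. of_nat n - of_nat i) * diff_op_star j (a j) P 0)" for n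
    unfolding symb_def ff_def using star by (intro sum.cong) auto
  define formal where "formal C \<longleftrightarrow>
    (\<forall>l \<alpha>. Lop k p \<pi> A xs (C l) \<alpha> = subst_series (f l) (subst_args C) \<alpha>)" for C
  have unique: "\<exists>!C. (\<forall>l. geo (C l) \<and> C l 0 = 0) \<and> formal C"
    unfolding formal_def
  proof (rule formal_unique_solution[of f J \<pi> k A xs p, OF f(1) f0 J \<pi>(1) A(1) xs k])
    show "invertible (mat (symb k \<pi> A xs n) - J)" for n
      unfolding symb J_def by (rule nonres)
    show "(\<Sum>\<mu> | mdeg \<mu> = k. A k \<mu> 0 * lead \<pi> (letters xs \<mu>)) \<noteq> 0"
      using star[of k] k Lk by simp
  qed auto
  \<comment> \<open>The bridge used in both directions: \<open>C\<close> is the expansion of y o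
    \<Psi>, and the equation near x = 0 corresponds to an identity of coefficients in u.\<close>
  have equiv: "solves_system k P a F y \<longleftrightarrow> formal C"
    if y: "\<And>l. hol (\<lambda>x. y x $ l)" and C: "\<And>l. geo (C l)" "\<And>l. C l 0 = 0"
      and yC: "\<And>l. \<forall>\<^sub>F u in nhds 0. y (\<Psi> u) $ l = ev (C l) u"
    for y :: "complex^'d::{finite,linorder} \<Rightarrow> complex^'m" and C
  proof -
    have \<pi>q: "\<forall>\<^sub>F u in nhds 0. ev (\<pi> i) u = q i u" for i
      using \<pi>(2)[of i] by eventually_elim simp
    have args: "geo (subst_args C i)" "subst_args C i 0 = 0" for i
    proof -
      have "(0 :: nat^'d::{finite,linorder}) \<noteq> axis i 1" for i by (metis mdeg_0 mdeg_axis zero_neq_one)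
      then show "subst_args C i 0 = 0" using C(2) by (auto simp: subst_args_def split: sum.splits)
      show "geo (subst_args C i)"
        using geo_coordinate C(1) by (auto simp: subst_args_def split: sum.splits)
    qed
    define E where "E x \<longleftrightarrow> (\<Sum>j=1..k. P x ^ j *s diff_op j (a j) y x) = F (x, y x)" for x
    have "solves_system k P a F y \<longleftrightarrow> (\<forall>\<^sub>F u in nhds 0. E (\<Psi> u))"
    proof
      assume "solves_system k P a F y"
      then show "\<forall>\<^sub>F u in nhds 0. E (\<Psi> u)"
        unfolding solves_system_def E_def by (rule eventually_compose_filterlim[OF _ lim\<Psi>])
    next
      assume "\<forall>\<^sub>F u in nhds 0. E (\<Psi> u)"
      from eventually_compose_filterlim[OF this lim\<Phi>] \<Psi>(4)
      have "\<forall>\<^sub>F x in nhds 0. E x" by eventually_elim simp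
      then show "solves_system k P a F y" unfolding solves_system_def E_def .
    qed
    also have "\<dots> \<longleftrightarrow> (\<forall>\<^sub>F u in nhds 0. \<forall>l. ev (Lop k p \<pi> A xs (C l)) u = ev (subst_series (f l) (subst_args C)) u)"
    proof (rule eventually_cong)
      have evargs: "(\<chi> i. ev (subst_args C i) u) = (\<chi> i. case i of Inl i \<Rightarrow> u $ i | Inr l \<Rightarrow> ev (C l) u)" for u
        using ev_coordinate by (auto simp: vec_eq_iff subst_args_def split: sum.splits)
      have "((\<lambda>u. \<chi> i. ev (subst_args C i) u) \<longlongrightarrow> 0) (nhds 0)"
        using holomorphic_germ_tendsto[OF hol_ev[OF args(1)]] args(2) by (intro vec_tendstoI) (simp add: ev_0)
      then have limargs: "filterlim (\<lambda>u. \<chi> i. ev (subst_args C i) u) (nhds 0) (nhds 0)" .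
      have R: "\<forall>\<^sub>F u in nhds 0. \<forall>l. F (\<Psi> u, y (\<Psi> u)) $ l = ev (subst_series (f l) (subst_args C)) u"
        unfolding eventually_all_finite_iff
      proof
        fix l
        have yC': "\<forall>\<^sub>F u in nhds 0. \<forall>l. y (\<Psi> u) $ l = ev (C l) u"
          unfolding eventually_all_finite_iff using yC by blast
        show "\<forall>\<^sub>F u in nhds 0. F (\<Psi> u, y (\<Psi> u)) $ l = ev (subst_series (f l) (subst_args C)) u"
          using ev_subst_series[where Z = "subst_args C", OF f(1)[of l] args, THEN conjunct2]
            eventually_compose_filterlim[OF f(2)[of l] limargs] yC'
        proof eventually_elim
          case (elim u)
          have "(\<chi> l. ev (C l) u) = y (\<Psi> u)" using elim(3) by (simp add: vec_eq_iff)
          then have "Fs (\<chi> i. ev (subst_args C i) u) = F (\<Psi> u, y (\<Psi> u))"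
            unfolding evargs Fs_def by simp
          then show ?case using elim(1,2) by simp
        qed
      qed
      have L: "\<forall>\<^sub>F u in nhds 0. \<forall>l. (\<Sum>j=1..k. P (\<Psi> u) ^ j *s diff_op j (a j) y (\<Psi> u)) $ l
          = ev (Lop k p \<pi> A xs (C l)) u"
        unfolding eventually_all_finite_iff
      proof
        fix l
        have pd: "\<forall>\<^sub>F u in nhds 0. partial_derivs \<mu> (\<lambda>x. y x $ l) (\<Psi> u)
            = foldr (Dop p q) (letters xs \<mu>) (ev (C l)) u" for \<mu>
          using foldr_partial_deriv_straighten[OF P \<Psi> y[of l], of "letters xs \<mu>", THEN conjunct2]
            foldr_Dop_cong[OF yC[of l], of p q "letters xs \<mu>"]
          by eventually_elim (simp add: partial_derivs_eq_foldr xs_def[symmetric] q_def)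
        have all: "\<forall>\<^sub>F u in nhds 0. \<forall>j\<in>{1..k}. \<forall>\<mu>\<in>{\<mu>. mdeg \<mu> = j}.
            a j \<mu> (\<Psi> u) = ev (A j \<mu>) u \<and> partial_derivs \<mu> (\<lambda>x. y x $ l) (\<Psi> u)
            = foldr (Dop p q) (letters xs \<mu>) (ev (C l)) u"
          using A(2) pd by (intro eventually_ball_finite ballI finite_mdeg eventually_conj) auto
        have lop: "\<forall>\<^sub>F u in nhds 0. ev (Lop k p \<pi> A xs (C l)) u
            = (\<Sum>j=1..k. \<Sum>\<mu> | mdeg \<mu> = j. ev (A j \<mu>) u * ((u $ p) ^ j * foldr (Dop p q) (letters xs \<mu>) (ev (C l)) u))"
          by (rule ev_Lop(2)[of "C l" \<pi> q k A xs p, OF C(1) \<pi>(1) q \<pi>q A(1) xs])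
        show "\<forall>\<^sub>F u in nhds 0. (\<Sum>j=1..k. P (\<Psi> u) ^ j *s diff_op j (a j) y (\<Psi> u)) $ l
            = ev (Lop k p \<pi> A xs (C l)) u"
          using all lop \<Psi>(3)
        proof eventually_elim
          case (elim u)
          \<comment> \<open>The purpose of the coordinate change: P has become the coordinate
            t.\<close>
          have "P (\<Psi> u) = u $ p" using elim(3) flatten_nth[of p P "\<Psi> u" p] by simp
          then have "(\<Sum>j=1..k. P (\<Psi> u) ^ j *s diff_op j (a j) y (\<Psi> u)) $ l
              = (\<Sum>j=1..k. \<Sum>\<mu> | mdeg \<mu> = j. (u $ p) ^ j * (a j \<mu> (\<Psi> u) * partial_derivs \<mu> (\<lambda>x. y x $ l) (\<Psi> u)))"
            by (simp add: diff_op_def sum_component sum_distrib_left)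
          also have "\<dots> = (\<Sum>j=1..k. \<Sum>\<mu> | mdeg \<mu> = j. ev (A j \<mu>) u * ((u $ p) ^ j * foldr (Dop p q) (letters xs \<mu>) (ev (C l)) u))"
            using elim(1) by (intro sum.cong refl) (simp add: mult_ac)
          finally show ?case using elim(2) by simp
        qed
      qed
      show "\<forall>\<^sub>F u in nhds 0. E (\<Psi> u) \<longleftrightarrow>
          (\<forall>l. ev (Lop k p \<pi> A xs (C l)) u = ev (subst_series (f l) (subst_args C)) u)"
        using L R by eventually_elim (simp add: E_def vec_eq_iff)
    qed
    also have "\<dots> \<longleftrightarrow> formal C"
    proof -
      have gL: "geo (Lop k p \<pi> A xs (C l))" for l
        by (rule ev_Lop(1)[of "C l" \<pi> q k A xs p, OF C(1) \<pi>(1) q \<pi>q A(1) xs])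
      have gR: "geo (subst_series (f l) (subst_args C))" for l
        using ev_subst_series[where Z = "subst_args C", OF f(1)[of l] args] by blast
      have "(\<forall>\<^sub>F u in nhds 0. ev (Lop k p \<pi> A xs (C l)) u = ev (subst_series (f l) (subst_args C)) u)
          \<longleftrightarrow> Lop k p \<pi> A xs (C l) = subst_series (f l) (subst_args C)" for l
        using ev_cancel[OF gL[of l] gR[of l]] by auto
      then show ?thesis by (simp add: eventually_all_finite_iff formal_def fun_eq_iff)
    qed
    finally show ?thesis .
  qed
  show ?thesis
  proof (rule ex_ex1I)
    obtain C where C: "\<And>l. geo (C l)" "\<And>l. C l 0 = 0" "formal C" using unique by blast
    \<comment> \<open>The formal solution is carried back by composition with \<open>flatten\<close>
      and expanded anew in the original coordinates.\<close>
    have "hol (\<lambda>x. ev (C l) (flatten p P x))" for l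
      by (rule hol_compose[OF hol_ev[OF C(1)] holomorphic_flatten[OF P(1)] \<Phi>0])
    then have "\<forall>l. \<exists>c. geo c \<and> (\<forall>\<^sub>F x in nhds 0. ev (C l) (flatten p P x) = ev c x)"
      using hol_imp_analytic by blast
    then obtain d where d: "\<And>l. geo (d l)" "\<And>l. \<forall>\<^sub>F x in nhds 0. ev (C l) (flatten p P x) = ev (d l) x" by metis
    define c where "c \<alpha> = (\<chi> l. d l \<alpha>)" for \<alpha>
    have gc: "geo (\<lambda>\<alpha>. c \<alpha> $ l)" for l using d by (simp add: c_def)
    note conv = geo_imp_ps_convergent[of c, OF gc]
    have ps: "\<forall>\<^sub>F x in nhds 0. ps_sum c x $ l = ev (d l) x" for l
      using conv(2) by eventually_elim (simp add: c_def)
    have "ps_sum c 0 = 0"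
    proof -
      have "ps_sum c 0 $ l = 0" for l
        using eventually_nhds_x_imp_x[OF ps[of l]] eventually_nhds_x_imp_x[OF d(2)[of l]] C(2)[of l] \<Phi>0
        by (simp add: ev_0)
      then show ?thesis by (simp add: vec_eq_iff)
    qed
    moreover have "solves_system k P a F (ps_sum c)"
    proof (rule equiv[of "ps_sum c" C, THEN iffD2, OF _ C(1,2) _ C(3)])
      show "hol (\<lambda>x. ps_sum c x $ l)" for l
        by (rule hol_cong[OF hol_ev[OF d(1)[of l]]]) (use ps[of l] in \<open>eventually_elim, simp\<close>)
      show "\<forall>\<^sub>F u in nhds 0. ps_sum c (\<Psi> u) $ l = ev (C l) u" for l
        using eventually_compose_filterlim[OF ps[of l] lim\<Psi>] eventually_compose_filterlim[OF d(2)[of l] lim\<Psi>] \<Psi>(3)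
        by eventually_elim simp
    qed
    ultimately show "\<exists>c. ps_convergent c \<and> ps_sum c 0 = 0 \<and> solves_system k P a F (ps_sum c)"
      using conv(1) by blast
  next
    fix c c' :: "nat^'d::{finite,linorder} \<Rightarrow> complex^'m"
    \<comment> \<open>Any solution is recovered near 0 from its straightened coefficients
      \<open>C\<close>; as these are unique, \<open>ev_cancel\<close> forces the original
      coefficients to agree.\<close>
    have straight: "\<exists>C. (\<forall>l. geo (C l) \<and> C l 0 = 0) \<and> formal C \<and>
        (\<forall>l. \<forall>\<^sub>F x in nhds 0. ev (\<lambda>\<alpha>. c \<alpha> $ l) x = ev (C l) (flatten p P x))"
      if c: "ps_convergent c" "ps_sum c 0 = 0" "solves_system k P a F (ps_sum c)"
      for c :: "nat^'d::{finite,linorder} \<Rightarrow> complex^'m"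
    proof -
      have gc: "geo (\<lambda>\<alpha>. c \<alpha> $ l)" for l by (rule ps_convergent_imp_geo[OF c(1)])
      have ps: "\<forall>\<^sub>F x in nhds 0. ps_sum c x $ l = ev (\<lambda>\<alpha>. c \<alpha> $ l) x" for l
        using geo_imp_ps_convergent(2)[of c, OF gc] by eventually_elim simp
      have hol: "hol (\<lambda>x. ps_sum c x $ l)" for l
        by (rule hol_cong[OF hol_ev[OF gc[of l]]]) (use ps[of l] in \<open>eventually_elim, simp\<close>)
      have "\<forall>l. \<exists>d. geo d \<and> (\<forall>\<^sub>F u in nhds 0. ps_sum c (\<Psi> u) $ l = ev d u)"
        using hol_imp_analytic[OF hol_compose[OF hol \<Psi>(1,2)]] by blast
      then obtain C where C: "\<And>l. geo (C l)" "\<And>l. \<forall>\<^sub>F u in nhds 0. ps_sum c (\<Psi> u) $ l = ev (C l) u" by metis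
      have C0: "C l 0 = 0" for l
        using eventually_nhds_x_imp_x[OF C(2)[of l]] c(2) by (simp add: ev_0 \<Psi>(2))
      have "formal C" using equiv[of "ps_sum c" C, OF hol C(1) C0 C(2)] c(3) by blast
      moreover have "\<forall>\<^sub>F x in nhds 0. ev (\<lambda>\<alpha>. c \<alpha> $ l) x = ev (C l) (flatten p P x)" for l
        using eventually_compose_filterlim[OF C(2)[of l] lim\<Phi>] \<Psi>(4) ps[of l]
        by eventually_elim simp
      ultimately show ?thesis using C(1) C0 by blast
    qed
    assume c: "ps_convergent c \<and> ps_sum c 0 = 0 \<and> solves_system k P a F (ps_sum c)"
      and c': "ps_convergent c' \<and> ps_sum c' 0 = 0 \<and> solves_system k P a F (ps_sum c')"
    obtain C where C: "(\<forall>l. geo (C l) \<and> C l 0 = 0) \<and> formal C"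
      "\<And>l. \<forall>\<^sub>F x in nhds 0. ev (\<lambda>\<alpha>. c \<alpha> $ l) x = ev (C l) (flatten p P x)"
      using straight[of c] c by blast
    obtain C' where C': "(\<forall>l. geo (C' l) \<and> C' l 0 = 0) \<and> formal C'"
      "\<And>l. \<forall>\<^sub>F x in nhds 0. ev (\<lambda>\<alpha>. c' \<alpha> $ l) x = ev (C' l) (flatten p P x)"
      using straight[of c'] c' by blast
    have "C = C'" using unique C(1) C'(1) by blast
    have "(\<lambda>\<alpha>. c \<alpha> $ l) = (\<lambda>\<alpha>. c' \<alpha> $ l)" for l
    proof (rule ev_cancel)
      show "\<forall>\<^sub>F x in nhds 0. ev (\<lambda>\<alpha>. c \<alpha> $ l) x = ev (\<lambda>\<alpha>. c' \<alpha> $ l) x"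
        using C(2)[of l] C'(2)[of l] by eventually_elim (simp add: \<open>C = C'\<close>)
    qed (use c c' ps_convergent_imp_geo in blast)+
    then have "c \<alpha> $ l = c' \<alpha> $ l" for \<alpha> l by (rule fun_cong)
    then show "c = c'" by (simp add: vec_eq_iff fun_eq_iff)
  qed
qed

end
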